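(* Let $\Omega$ be an arbitrary finite tree of in-plane elastic strings with edges $e_1,\dots,e_N$, edge lengths $l_1,\dots,l_N$, coefficients $k_{i1},k_{i2}>0$ ($i=1,\dots,N$), angles $\alpha_{ij}$ between edges meeting at internal vertices, and boundary vertices $\Gamma=\{\gamma_1,\dots,\gamma_m\}$, with $\gamma_m$ being the root. Then the tree (i.e. the lengths of the edges, the connectivity of the graph and the angles between edges) and the parameters of the system (i.e. the coefficients $\{k_{i1},k_{i2}\}_{i=1}^N$) are determined by the entries ($2\times 2$ matrix-valued functions) $M_{ij}(\lambda)$, $\lambda\notin\mathbb{R}$, $1\leqslant i,j\leqslant m-1$, of the Titchmarsh-Weyl matrix.
   Context: Graph: $\Omega$ is a finite connected compact planar graph without cycles (a tree). Each edge $e_i$ is identified with an interval of length $l_i$ and carries two constants $k_{i1},k_{i2}>0$ (the velocities in the first and second channel). The boundary $\Gamma$ is the set of vertices of multiplicity one; the other vertices are called internal. Functions on $\Omega$: $U=\{u,w\}=\left\{\begin{pmatrix}u^i\\ w^i\end{pmatrix}\right\}_{i=1}^N$, where $u^i,w^i$ are functions on $e_i$. They are the components of a planar displacement $u^i e_i+w^i e_i^\perp$ in a local orthonormal frame, where (by abuse of notation) $e_i$ is also the unit vector along the edge in the direction of its parametrization and $e_i^\perp$ is the unit vector orthogonal to it. Angles: $\alpha_{ij}$ is the angle between edges $e_i$ and $e_j$ incident at a common vertex, counted from $e_i$ counterclockwise. Put $$R_\alpha=\begin{pmatrix}\cos\alpha&-\sin\alpha\\ \sin\alpha&\cos\alpha\end{pmatrix},\qquad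 D_i'=\begin{pmatrix}k_{i1}^2&0\\0&k_{i2}^2\end{pmatrix}.$$ Compatibility conditions at an internal vertex $v$ with incident edges $e_1,\dots,e_K$ (renumbered): (continuity) $\begin{pmatrix}u^i(v)\\ w^i(v)\end{pmatrix}=R_{\alpha_{ij}}\begin{pmatrix}u^j(v)\\ w^j(v)\end{pmatrix}$ for $1\leqslant i,j\leqslant K$, $i\neq j$; (force balance) $D_1'\begin{pmatrix}u^1_x(v)\\ w^1_x(v)\end{pmatrix}=\sum_{j=2}^K R_{\alpha_{1j}}D_j'\begin{pmatrix}u^j_x(v)\\ w^j_x(v)\end{pmatrix}$, where the derivative on $e_1$ is taken in the direction toward $v$ and the derivatives on $e_2,\dots,e_K$ in the direction away from $v$. Spectral equations: $-k_{i1}^2\phi^i_{xx}=\lambda\phi^i$, $-k_{i2}^2\psi^i_{xx}=\lambda\psi^i$ on $e_i$, $i=1,\dots,N$, with $\{\phi,\psi\}$ satisfying continuity and force balance at all internal vertices. The associated dynamical system is $\frac{1}{k_{i1}^2}u^i_{tt}-u^i_{xx}=0$, $\frac{1}{k_{i2}^2}w^i_{tt}-w^i_{xx}=0$ on $e_i$ with the same compatibility conditions; it has the same parameters $k_{i1},k_{i2}$. Titchmarsh-Weyl (TW) matrix: let $\lambda\notin\mathbb{R}$. For a boundary vertex $\gamma_i$ let $\{\phi^1,\psi^1\}$ and $\{\phi^2,\psi^2\}$ (superscripts here number the two solutions) be the solutions of the spectral equations with compatibility conditions whose boundary values at $\gamma_i$ are $(1,0)$ and $(0,1)$ respectively, and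 $(0,0)$ at all other boundary vertices. Then $$M_{ij}(\lambda)=\begin{pmatrix}\phi^1_x(\gamma_j,\lambda)&\psi^1_x(\gamma_j,\lambda)\\ \phi^2_x(\gamma_j,\lambda)&\psi^2_x(\gamma_j,\lambda)\end{pmatrix},$$ where the derivatives at $\gamma_j$ are taken in the direction from $\gamma_j$ into the edge. "Determined" means uniquely determined: the data are the listed matrix-valued functions of $\lambda\notin\mathbb{R}$, and the unknowns to be recovered from them are the edge lengths, the connectivity, the angles between edges, and the coefficients $\{k_{i1},k_{i2}\}$.
   Formalization: Degree-2 vertices with equal planar stiffness on both sides are excluded; on edges not at γ_1..γ_{m-1}, angles and coefficients are determined only up to undetectable frame turns (by π; by π/2 swapping k_{i1},k_{i2}; any angle if k_{i1}=k_{i2}). *)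

theory Defs
  imports "HOL-Analysis.Analysis" "Graph_Theory.Digraph_Component"
begin

section \<open>Trees of in-plane elastic strings\<close>

text \<open>
  The arc \<open>e\<close> is parametrised by \<open>[0, len e]\<close>, with \<open>0\<close> at its tail.  The unit vector along \<open>e\<close> in
  the direction of the parametrisation is \<open>(cos (dir e), sin (dir e))\<close>; together with its
  counterclockwise normal it is the local frame of \<open>e\<close>.  The vertices
  \<open>bvertex 1, \<dots>, bvertex m\<close> enumerate the boundary, the last of them being the root.
\<close>

record ('v, 'e) string_network =
  graph :: "('v, 'e) pre_digraph"
  len :: "'e \<Rightarrow> real"
  k1 :: "'e \<Rightarrow> real"
  k2 :: "'e \<Rightarrow> real"
  dir :: "'e \<Rightarrow> real"
  bvertex :: "nat \<Rightarrow> 'v"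

definition edges_at :: "('v, 'e) string_network \<Rightarrow> 'v \<Rightarrow> 'e set" where
  "edges_at N v = in_arcs (graph N) v \<union> out_arcs (graph N) v"

definition boundary :: "('v, 'e) string_network \<Rightarrow> 'v set" where
  "boundary N = {v \<in> verts (graph N). card (edges_at N v) = 1}"

definition internal :: "('v, 'e) string_network \<Rightarrow> 'v set" where
  "internal N = verts (graph N) - boundary N"

definition bedge :: "('v, 'e) string_network \<Rightarrow> nat \<Rightarrow> 'e" where
  "bedge N i = the_elem (edges_at N (bvertex N i))"

definition angle :: "('v, 'e) string_network \<Rightarrow> 'e \<Rightarrow> 'e \<Rightarrow> real" where
  "angle N e e' = dir N e' - dir N e"

text \<open>
  \<^const>\<open>forest\<close> only excludes directed cycles, and the orientation of an edge is merely its
  parametrisation.  A cycle of the underlying undirected multigraph is a directed cycle for a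
  suitable orientation of the edges.
\<close>

definition reorientation :: "('v, 'e) pre_digraph \<Rightarrow> ('v, 'e) pre_digraph \<Rightarrow> bool" where
  "reorientation G H \<longleftrightarrow> verts H = verts G \<and> arcs H = arcs G \<and>
     (\<forall>e \<in> arcs G. {tail H e, head H e} = {tail G e, head G e})"

definition undirected_tree :: "('v, 'e) pre_digraph \<Rightarrow> bool" where
  "undirected_tree G \<longleftrightarrow> Digraph_Component.connected G \<and> (\<forall>H. reorientation G H \<longrightarrow> forest H)"

definition elastic_tree :: "nat \<Rightarrow> ('v, 'e) string_network \<Rightarrow> bool" where
  "elastic_tree m N \<longleftrightarrow>
     fin_digraph (graph N) \<and> undirected_tree (graph N) \<and> arcs (graph N) \<noteq> {} \<and>
     (\<forall>e \<in> arcs (graph N). len N e > 0 \<and> k1 N e > 0 \<and> k2 N e > 0) \<and>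
     bij_betw (bvertex N) {1..m} (boundary N)"

section \<open>Compatibility conditions and spectral equations\<close>

definition rot :: "real \<Rightarrow> complex^2^2" where
  "rot a = vector [vector [of_real (cos a), - of_real (sin a)],
                   vector [of_real (sin a), of_real (cos a)]]"

definition stiffness :: "('v, 'e) string_network \<Rightarrow> 'e \<Rightarrow> complex^2^2" where
  "stiffness N e = vector [vector [of_real ((k1 N e)\<^sup>2), 0],
                           vector [0, of_real ((k2 N e)\<^sup>2)]]"

definition value_at :: "('v, 'e) string_network \<Rightarrow> ('e \<Rightarrow> real \<Rightarrow> complex^2) \<Rightarrow> 'e \<Rightarrow> 'v \<Rightarrow> complex^2" where
  "value_at N U e v = (if tail (graph N) e = v then U e 0 else U e (len N e))"

definition deriv_away :: "('v, 'e) string_network \<Rightarrow> ('e \<Rightarrow> real \<Rightarrow> complex^2) \<Rightarrow> 'e \<Rightarrow> 'v \<Rightarrow> complex^2" where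
  "deriv_away N U e v =
     (if tail (graph N) e = v then vector_derivative (U e) (at 0 within {0..len N e})
      else - vector_derivative (U e) (at (len N e) within {0..len N e}))"

definition deriv_toward :: "('v, 'e) string_network \<Rightarrow> ('e \<Rightarrow> real \<Rightarrow> complex^2) \<Rightarrow> 'e \<Rightarrow> 'v \<Rightarrow> complex^2" where
  "deriv_toward N U e v = - deriv_away N U e v"

definition continuity_at :: "('v, 'e) string_network \<Rightarrow> ('e \<Rightarrow> real \<Rightarrow> complex^2) \<Rightarrow> 'v \<Rightarrow> bool" where
  "continuity_at N U v \<longleftrightarrow>
     (\<forall>e \<in> edges_at N v. \<forall>e' \<in> edges_at N v. e \<noteq> e' \<longrightarrow>
        value_at N U e v = rot (angle N e e') *v value_at N U e' v)"

text \<open>Any incident edge may play the role of the distinguished edge \<open>e\<close>.\<close>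

definition force_balance_at :: "('v, 'e) string_network \<Rightarrow> ('e \<Rightarrow> real \<Rightarrow> complex^2) \<Rightarrow> 'v \<Rightarrow> bool" where
  "force_balance_at N U v \<longleftrightarrow>
     (\<forall>e \<in> edges_at N v.
        stiffness N e *v deriv_toward N U e v =
        (\<Sum>e' \<in> edges_at N v - {e}. rot (angle N e e') *v (stiffness N e' *v deriv_away N U e' v)))"

definition spectral_equations_on :: "('v, 'e) string_network \<Rightarrow> complex \<Rightarrow> ('e \<Rightarrow> real \<Rightarrow> complex^2) \<Rightarrow> 'e \<Rightarrow> bool" where
  "spectral_equations_on N lam U e \<longleftrightarrow>
     (\<exists>U1 U2. \<forall>x \<in> {0..len N e}.
        (U e has_vector_derivative U1 x) (at x within {0..len N e}) \<and>
        (U1 has_vector_derivative U2 x) (at x within {0..len N e}) \<and>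
        - of_real ((k1 N e)\<^sup>2) * U2 x $ 1 = lam * U e x $ 1 \<and>
        - of_real ((k2 N e)\<^sup>2) * U2 x $ 2 = lam * U e x $ 2)"

definition spectral_solution :: "('v, 'e) string_network \<Rightarrow> complex \<Rightarrow> ('e \<Rightarrow> real \<Rightarrow> complex^2) \<Rightarrow> bool" where
  "spectral_solution N lam U \<longleftrightarrow>
     (\<forall>e \<in> arcs (graph N). spectral_equations_on N lam U e) \<and>
     (\<forall>v \<in> internal N. continuity_at N U v \<and> force_balance_at N U v)"

section \<open>The Titchmarsh-Weyl matrix\<close>

definition tw_solution :: "('v, 'e) string_network \<Rightarrow> complex \<Rightarrow> 'v \<Rightarrow> complex^2 \<Rightarrow> ('e \<Rightarrow> real \<Rightarrow> complex^2) \<Rightarrow> bool" where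
  "tw_solution N lam \<gamma> b U \<longleftrightarrow> spectral_solution N lam U \<and>
     (\<forall>v \<in> boundary N. \<forall>e \<in> edges_at N v. value_at N U e v = (if v = \<gamma> then b else 0))"

text \<open>
  Row \<open>r\<close> belongs to the solution with boundary value the \<open>r\<close>-th unit vector.  For non-real \<open>lam\<close> this
  solution exists and is unique on the edges, since the operator with Dirichlet boundary
  conditions is self-adjoint.
\<close>

definition tw_matrix :: "('v, 'e) string_network \<Rightarrow> complex \<Rightarrow> nat \<Rightarrow> nat \<Rightarrow> complex^2^2" where
  "tw_matrix N lam i j =
     (\<chi> r c. deriv_away N (SOME U. tw_solution N lam (bvertex N i) (axis r 1) U)
               (bedge N j) (bvertex N j) $ c)"

section \<open>What the data can determine\<close>

text \<open>
  Let the frames of the edges be turned by angles \<open>\<rho> e\<close>.  The equations keep their form, with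
  coefficients \<open>c1\<close>, \<open>c2\<close> replaced by \<open>d1\<close>, \<open>d2\<close>, iff \<open>rot (- \<rho>)\<close> conjugates the stiffness matrix
  for \<open>c1\<close>, \<open>c2\<close> into the one for \<open>d1\<close>, \<open>d2\<close>; the lemma \<open>frame_change_iff\<close> says that this is the
  following relation.  In particular \<open>c1 > c2\<close> and \<open>d1 > d2\<close> imply that the coefficients agree
  and that \<open>\<rho>\<close> is a multiple of \<open>\<pi>\<close>.
\<close>

definition frame_change :: "real \<Rightarrow> real \<Rightarrow> real \<Rightarrow> real \<Rightarrow> real \<Rightarrow> bool" where
  "frame_change \<rho> c1 c2 d1 d2 \<longleftrightarrow>
     (d1 = c1 \<and> d2 = c2 \<and> (sin \<rho> = 0 \<or> c1 = c2)) \<or>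
     (d1 = c2 \<and> d2 = c1 \<and> cos \<rho> = 0)"

text \<open>
  At a fictitious vertex two edges carry the same stiffness, seen in the plane: the
  compatibility conditions there only say that the planar displacement is continuously
  differentiable, so that no solution of the equations distinguishes the vertex from an interior
  point of an edge.
\<close>

definition fictitious_vertex :: "('v, 'e) string_network \<Rightarrow> 'v \<Rightarrow> bool" where
  "fictitious_vertex N v \<longleftrightarrow> v \<in> verts (graph N) \<and>
     (\<exists>e e'. e \<noteq> e' \<and> edges_at N v = {e, e'} \<and>
        frame_change (angle N e e') (k1 N e) (k2 N e) (k1 N e') (k2 N e'))"

text \<open>
  Equality of two networks up to the numbering and orientation of vertices and edges and up to
  the choice of the local frames on the edges that are not observed.  The latter freedom is
  inherent: by \<open>tw_solution_change_frames\<close> below, turning the frame of an edge other than those at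
  \<open>bvertex 1, \<dots>, bvertex (m - 1)\<close> changes no boundary measurement.  Angles are understood modulo
  \<open>2 * pi\<close>; those between observed edges (\<open>\<rho> = 0\<close>) are determined exactly.
\<close>

definition same_network :: "nat \<Rightarrow> ('v, 'e) string_network \<Rightarrow> ('w, 'f) string_network \<Rightarrow> bool" where
  "same_network m N N' \<longleftrightarrow>
     (\<exists>f g \<rho>.
        bij_betw f (verts (graph N)) (verts (graph N')) \<and>
        bij_betw g (arcs (graph N)) (arcs (graph N')) \<and>
        (\<forall>e \<in> arcs (graph N).
           {tail (graph N') (g e), head (graph N') (g e)} = {f (tail (graph N) e), f (head (graph N) e)}) \<and>
        (\<forall>i \<in> {1..m}. f (bvertex N i) = bvertex N' i) \<and>
        (\<forall>e \<in> arcs (graph N). len N' (g e) = len N e) \<and>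
        (\<forall>e \<in> arcs (graph N).
           frame_change (\<rho> e) (k1 N e) (k2 N e) (k1 N' (g e)) (k2 N' (g e))) \<and>
        (\<forall>v \<in> verts (graph N). \<forall>e \<in> edges_at N v. \<forall>e' \<in> edges_at N v.
           \<exists>n::int. angle N' (g e) (g e') = angle N e e' + \<rho> e' - \<rho> e + 2 * pi * of_int n) \<and>
        (\<forall>i \<in> {1..m-1}. \<rho> (bedge N i) = 0))"

lemma rot_mult: "rot a ** rot b = rot (a + b)"
  by (simp add: rot_def vec_eq_iff forall_2 matrix_matrix_mult_def sum_2 cos_add sin_add algebra_simps)

lemma rot_0: "rot 0 = mat 1"
  by (simp add: rot_def vec_eq_iff forall_2 mat_def)

lemma frame_change_iff:
  assumes "k1 N e > 0" "k2 N e > 0" "k1 N' e' > 0" "k2 N' e' > 0"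
  shows "frame_change \<rho> (k1 N e) (k2 N e) (k1 N' e') (k2 N' e') \<longleftrightarrow>
         stiffness N' e' = rot (- \<rho>) ** stiffness N e ** rot \<rho>"
proof -
  define a b a' b' c s where defs: "a = (k1 N e)\<^sup>2" "b = (k2 N e)\<^sup>2" "a' = (k1 N' e')\<^sup>2" "b' = (k2 N' e')\<^sup>2"
    "c = cos \<rho>" "s = sin \<rho>"
  have cs: "c\<^sup>2 + s\<^sup>2 = 1"
    by (simp add: defs)
  have "stiffness N' e' = rot (- \<rho>) ** stiffness N e ** rot \<rho> \<longleftrightarrow>
      complex_of_real a' = of_real (c\<^sup>2 * a + s\<^sup>2 * b) \<and> complex_of_real b' = of_real (s\<^sup>2 * a + c\<^sup>2 * b) \<and>
      complex_of_real 0 = of_real (c * s * (b - a))"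
    by (auto simp: defs stiffness_def rot_def vec_eq_iff forall_2 matrix_matrix_mult_def sum_2
        algebra_simps power2_eq_square)
  also have "\<dots> \<longleftrightarrow> a' = c\<^sup>2 * a + s\<^sup>2 * b \<and> b' = s\<^sup>2 * a + c\<^sup>2 * b \<and> 0 = c * s * (b - a)"
    unfolding of_real_eq_iff ..
  also have "\<dots> \<longleftrightarrow> (a' = a \<and> b' = b \<and> (s = 0 \<or> a = b)) \<or> (a' = b \<and> b' = a \<and> c = 0)"
  proof -
    have 1: "c\<^sup>2 * a + s\<^sup>2 * a = a" for a :: real
      using cs by (metis distrib_right mult_1)
    have 2: "c = 0 \<Longrightarrow> s\<^sup>2 = 1" "s = 0 \<Longrightarrow> c\<^sup>2 = 1"
      using cs by auto
    show ?thesis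
      using 1[of a] 2 by (cases "c = 0"; cases "s = 0"; cases "a = b") (auto simp: add.commute)
  qed
  also have "\<dots> \<longleftrightarrow> frame_change \<rho> (k1 N e) (k2 N e) (k1 N' e') (k2 N' e')"
    using assms by (simp add: defs frame_change_def)
  finally show ?thesis
    by blast
qed

lemma rot_vector_derivative:
  assumes "(u has_vector_derivative u') (at x within S)"
  shows "((\<lambda>x. rot a *v u x) has_vector_derivative rot a *v u') (at x within S)"
proof -
  have "bounded_linear (\<lambda>y. rot a *v y)"
    by (intro linear_conv_bounded_linear[THEN iffD1] linearI)
       (simp_all add: matrix_vector_right_distrib vec_eq_iff forall_2 matrix_vector_mult_def sum_2 algebra_simps)
  then show ?thesis
    using assms by (rule bounded_linear.has_vector_derivative)
qed

text \<open>
  Turning the frames away from the observed edges carries the solutions that define the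
  Titchmarsh-Weyl matrix to such solutions of the other network, with the same derivatives at the
  observed edges.  So the freedom in \<^const>\<open>same_network\<close> cannot be removed.
\<close>

lemma tw_solution_change_frames:
  fixes N :: "('v, 'e) string_network"
  assumes N: "elastic_tree m N"
    and N': "graph N' = graph N" "len N' = len N" "bvertex N' = bvertex N"
      "\<And>e. dir N' e = dir N e + \<rho> e"
      "\<And>e. e \<in> arcs (graph N) \<Longrightarrow> k1 N' e > 0 \<and> k2 N' e > 0"
      "\<And>e. e \<in> arcs (graph N) \<Longrightarrow> frame_change (\<rho> e) (k1 N e) (k2 N e) (k1 N' e) (k2 N' e)"
    and keep: "\<And>e. e \<in> edges_at N \<gamma> \<Longrightarrow> \<rho> e = 0"
    and U: "tw_solution N lam \<gamma> b U"
  defines "U' \<equiv> \<lambda>e x. rot (- \<rho> e) *v U e x"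
  shows "tw_solution N' lam \<gamma> b U'"
    and "\<And>v e. e \<in> edges_at N v \<Longrightarrow> \<rho> e = 0 \<Longrightarrow> deriv_away N' U' e v = deriv_away N U e v"
proof -
  have pos: "len N e > 0" "k1 N e > 0" "k2 N e > 0" if "e \<in> arcs (graph N)" for e
    using N that by (auto simp: elastic_tree_def)
  have conj: "stiffness N' e ** rot (- \<rho> e) = rot (- \<rho> e) ** stiffness N e" if "e \<in> arcs (graph N)" for e
  proof -
    have "stiffness N' e = rot (- \<rho> e) ** stiffness N e ** rot (\<rho> e)"
      using frame_change_iff[of N e N' e "\<rho> e"] pos[OF that] N'(5,6)[OF that] by blast
    then show ?thesis
      by (metis (no_types) matrix_mul_assoc rot_mult rot_0 add.right_inverse matrix_mul_rid)
  qed
  have neg: "A *v (- x) = - (A *v x)" for A :: "complex^2^2" and x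
    by (simp add: matrix_vector_mult_def vec_eq_iff sum_negf)
  have edges[simp]: "edges_at N' = edges_at N"
    by (simp add: edges_at_def fun_eq_iff N' in_arcs_def out_arcs_def)
  have bnd[simp]: "boundary N' = boundary N" "internal N' = internal N"
    by (simp_all add: boundary_def internal_def N')
  have edges_arcs: "e \<in> arcs (graph N)" if "e \<in> edges_at N v" for e v
    using that by (auto simp: edges_at_def)
  have val: "value_at N' U' e v = rot (- \<rho> e) *v value_at N U e v" for e v
    by (simp add: value_at_def U'_def N')
  have eqs: "spectral_equations_on N lam U e" if "e \<in> arcs (graph N)" for e
    using U that by (auto simp: tw_solution_def spectral_solution_def)
  have vd: "vector_derivative (U' e) (at x within {0..len N e}) =
            rot (- \<rho> e) *v vector_derivative (U e) (at x within {0..len N e})"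
    if e: "e \<in> arcs (graph N)" and x: "x \<in> {0..len N e}" for e x
  proof -
    obtain U1 where d: "(U e has_vector_derivative U1 x) (at x within {0..len N e})"
      using eqs[OF e] x unfolding spectral_equations_on_def by blast
    then have d': "(U' e has_vector_derivative rot (- \<rho> e) *v U1 x) (at x within {0..len N e})"
      unfolding U'_def by (rule rot_vector_derivative)
    show ?thesis
      using vector_derivative_within_cbox[of 0 "len N e" x "U e", unfolded box_real, OF _ x d]
        vector_derivative_within_cbox[of 0 "len N e" x "U' e", unfolded box_real, OF _ x d'] pos[OF e]
      by simp
  qed
  have da: "deriv_away N' U' e v = rot (- \<rho> e) *v deriv_away N U e v" if "e \<in> arcs (graph N)" for e v
    using vd[OF that, of 0] vd[OF that, of "len N e"] pos[OF that]
    by (auto simp: deriv_away_def N' matrix_vector_mult_def vec_eq_iff sum_2)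
  show "deriv_away N' U' e v = deriv_away N U e v" if "e \<in> edges_at N v" "\<rho> e = 0" for v e
    using da edges_arcs[OF that(1)] that(2) by (simp add: rot_0)
  have sys: "spectral_equations_on N lam U e \<longleftrightarrow>
     (\<exists>U1 U2. \<forall>x \<in> {0..len N e}.
        (U e has_vector_derivative U1 x) (at x within {0..len N e}) \<and>
        (U1 has_vector_derivative U2 x) (at x within {0..len N e}) \<and>
        - (stiffness N e *v U2 x) = lam *s U e x)" for N :: "('v, 'e) string_network" and U e
    by (simp add: spectral_equations_on_def stiffness_def vec_eq_iff forall_2 matrix_vector_mult_def sum_2)
  have "spectral_equations_on N' lam U' e" if e: "e \<in> arcs (graph N)" for e
  proof -
    obtain U1 U2 where U12: "\<forall>x \<in> {0..len N e}.
        (U e has_vector_derivative U1 x) (at x within {0..len N e}) \<and>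
        (U1 has_vector_derivative U2 x) (at x within {0..len N e}) \<and>
        - (stiffness N e *v U2 x) = lam *s U e x"
      using eqs[OF e] unfolding sys by blast
    have "- (stiffness N' e *v (rot (- \<rho> e) *v U2 x)) = lam *s U' e x" if "x \<in> {0..len N e}" for x
    proof -
      have "- (stiffness N' e *v (rot (- \<rho> e) *v U2 x)) = rot (- \<rho> e) *v (- (stiffness N e *v U2 x))"
        by (simp add: neg matrix_vector_mul_assoc conj[OF e])
      also have "\<dots> = rot (- \<rho> e) *v (lam *s U e x)"
        using U12 that by simp
      also have "\<dots> = lam *s U' e x"
        by (simp add: U'_def vec_eq_iff matrix_vector_mult_def sum_2 algebra_simps)
      finally show ?thesis .
    qed
    then show ?thesis
      unfolding sys N'(2) using U12
      by (intro exI[of _ "\<lambda>x. rot (- \<rho> e) *v U1 x"] exI[of _ "\<lambda>x. rot (- \<rho> e) *v U2 x"])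
         (auto simp: U'_def intro!: rot_vector_derivative)
  qed
  moreover have ang: "rot (angle N' e e') ** rot (- \<rho> e') = rot (- \<rho> e) ** rot (angle N e e')" for e e'
    by (simp add: rot_mult angle_def N' algebra_simps)
  have "continuity_at N' U' v" if "v \<in> internal N" for v
  proof -
    have c: "continuity_at N U v"
      using U that by (auto simp: tw_solution_def spectral_solution_def)
    show ?thesis
      unfolding continuity_at_def edges
    proof (intro ballI impI)
      fix e e' assume "e \<in> edges_at N v" "e' \<in> edges_at N v" "e \<noteq> e'"
      with c have "value_at N U e v = rot (angle N e e') *v value_at N U e' v"
        unfolding continuity_at_def by blast
      then have "value_at N' U' e v = (rot (- \<rho> e) ** rot (angle N e e')) *v value_at N U e' v"
        by (simp add: val matrix_vector_mul_assoc)
      then show "value_at N' U' e v = rot (angle N' e e') *v value_at N' U' e' v"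
        by (simp add: val matrix_vector_mul_assoc flip: ang)
    qed
  qed
  moreover have "force_balance_at N' U' v" if v: "v \<in> internal N" for v
    unfolding force_balance_at_def edges
  proof
    fix e assume e: "e \<in> edges_at N v"
    have fb: "force_balance_at N U v"
      using U v by (auto simp: tw_solution_def spectral_solution_def)
    have "stiffness N' e *v deriv_toward N' U' e v = rot (- \<rho> e) *v (stiffness N e *v deriv_toward N U e v)"
      using da[OF edges_arcs[OF e], of v]
      by (simp add: deriv_toward_def neg matrix_vector_mul_assoc conj[OF edges_arcs[OF e]])
    also have "\<dots> = (\<Sum>e' \<in> edges_at N v - {e}.
        rot (- \<rho> e) *v (rot (angle N e e') *v (stiffness N e' *v deriv_away N U e' v)))"
      using fb e by (simp add: force_balance_at_def linear_sum[OF matrix_vector_mul_linear])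
    also have "\<dots> = (\<Sum>e' \<in> edges_at N v - {e}.
        rot (angle N' e e') *v (stiffness N' e' *v deriv_away N' U' e' v))"
    proof (rule sum.cong[OF refl])
      fix e' assume "e' \<in> edges_at N v - {e}"
      then have e': "e' \<in> arcs (graph N)"
        using edges_arcs by blast
      have "rot (- \<rho> e) *v (rot (angle N e e') *v (stiffness N e' *v deriv_away N U e' v)) =
          (rot (angle N' e e') ** rot (- \<rho> e')) *v (stiffness N e' *v deriv_away N U e' v)"
        unfolding ang by (simp only: matrix_vector_mul_assoc matrix_mul_assoc)
      also have "\<dots> = rot (angle N' e e') *v ((stiffness N' e' ** rot (- \<rho> e')) *v deriv_away N U e' v)"
        unfolding conj[OF e'] by (simp only: matrix_vector_mul_assoc matrix_mul_assoc)
      also have "\<dots> = rot (angle N' e e') *v (stiffness N' e' *v deriv_away N' U' e' v)"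
        unfolding da[OF e'] by (simp only: matrix_vector_mul_assoc)
      finally show "rot (- \<rho> e) *v (rot (angle N e e') *v (stiffness N e' *v deriv_away N U e' v)) =
          rot (angle N' e e') *v (stiffness N' e' *v deriv_away N' U' e' v)" .
    qed
    finally show "stiffness N' e *v deriv_toward N' U' e v = (\<Sum>e' \<in> edges_at N v - {e}.
        rot (angle N' e e') *v (stiffness N' e' *v deriv_away N' U' e' v))" .
  qed
  moreover have "value_at N' U' e v = (if v = \<gamma> then b else 0)"
    if "v \<in> boundary N" "e \<in> edges_at N v" for v e
    using U that keep by (auto simp: val tw_solution_def rot_0)
  ultimately show "tw_solution N' lam \<gamma> b U'"
    by (simp add: tw_solution_def spectral_solution_def N'(1))
qed

end

theory Submission
  imports Defs "HOL-Real_Asymp.Real_Asymp"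
begin

text \<open>
  Write \<open>\<lambda> = - s\<^sup>2\<close> and pass to planar displacements and forces, rooting the tree at the last boundary
  vertex. The flux \<open>Re (p \<bullet> f)\<close> increases along every edge, which makes the Dirichlet problem uniquely
  solvable for \<open>Re (s\<^sup>2) \<ge> 0\<close>; by compactness equality of the data extends from non-real \<open>\<lambda>\<close> to all
  real \<open>s \<ge> 0\<close>, including the static case \<open>s = 0\<close>. For large real \<open>s\<close> the data at a boundary vertex
  give the stiffness of its edge in the observed frame.

  The trees are then compared by removing boundary edges. A boundary edge of known stiffness can be
  cut off on the level of the data. If corresponding boundary edges had different lengths, cutting
  off the shorter one would make a boundary vertex of one network correspond to an inner point of an
  edge of the other. At a vertex of degree two this forces equal stiffness, so the vertex is
  fictitious. At a branching vertex that separates boundary vertices it contradicts unique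
  continuation. The remaining case, in which the vertex only separates the root from the rest, is
  not visible at high frequency, since the impedances may match; there the static problem decides,
  because the only force that can hold the rest in constant displacement acts at that vertex. With
  lengths and stiffnesses known, two boundary edges meet at a common vertex iff their far ends always
  have the same displacement, so a vertex all of whose children are leaves can be identified in both
  trees and its boundary edges removed; induction on the number of edges finishes the proof.
\<close>

text \<open>The data live at non-real \<open>\<lambda>\<close>, while the high-frequency and the
  static arguments both need real \<open>s\<close>. The Dirichlet problem is well posed on the
  closed set \<open>Re (s\<^sup>2) \<ge> 0\<close>, so real \<open>s \<ge> 0\<close> is reached by
  limits of solutions. The measured derivatives refer to the frames of the boundary edges. Turning
  them into forces in the plane costs an unknown stiffness and an unknown angle per boundary edge.
  The stiffness drops out since the leading term at high frequency is the impedance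
  \<open>Z\<close>, the positive square root of the stiffness: a relation between \<open>Z\<close>
  and its square remains, which forces the impedances of paired edges to be conjugate. The angles
  \<open>q j\<close> stay. They are known to agree, modulo full turns, only for leaves already
  recognised as siblings, and at the end one rotation \<open>c\<close> of the whole plane is left.
  Until then every argument has to tolerate independent rotations at the leaves: it may speak of
  vanishing displacements and forces, or of circularly polarised vectors, which rotations only
  multiply by a phase. While lengths are unknown, a leaf of one tree may be paired with an inner
  vertex of the other; hence the boundary set \<open>B\<close> may be larger than the set of
  leaves.\<close>

section \<open>Rotations, and matrices that are diagonal in a turned frame\<close>

definition diag2 :: "complex \<Rightarrow> complex \<Rightarrow> complex^2^2" where
  "diag2 a b = vector [vector [a, 0], vector [0, b]]"

text \<open>An operator that is diagonal in the frame of an edge, written in the fixed frame of the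
  plane. For fixed \<open>\<theta>\<close> these matrices form a commutative algebra.\<close>

definition turned :: "real \<Rightarrow> complex \<Rightarrow> complex \<Rightarrow> complex^2^2" where
  "turned \<theta> a b = rot \<theta> ** diag2 a b ** rot (- \<theta>)"

lemmas mat2_simps = vec_eq_iff forall_2 matrix_matrix_mult_def matrix_vector_mult_def sum_2 mat_def

lemma rot_inv [simp]: "rot a ** rot (- a) = mat 1" "rot (- a) ** rot a = mat 1"
  by (simp_all add: rot_mult rot_0)

lemma rot_cancel [simp]: "rot a *v (rot (- a) *v x) = x" "rot (- a) *v (rot a *v x) = x"
  by (simp_all add: matrix_vector_mul_assoc)

lemma rot_eq_imp: "rot a = rot b \<Longrightarrow> \<exists>n::int. a = b + 2 * pi * of_int n"
proof -
  assume "rot a = rot b"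
  then have "rot a $ 1 $ 1 = rot b $ 1 $ 1" "rot a $ 2 $ 1 = rot b $ 2 $ 1"
    by simp_all
  then have "cos a = cos b" "sin a = sin b"
    by (simp_all add: rot_def)
  then show ?thesis
    using sin_cos_eq_iff[of a b] by (auto simp: algebra_simps)
qed

lemma inner_rot [simp]: "(rot a *v x) \<bullet> (rot a *v y) = x \<bullet> y"
proof -
  define c s where cs: "c = cos a" "s = sin a"
  have "(rot a *v x) \<bullet> (rot a *v y) = (c * c + s * s) * (x \<bullet> y)"
    unfolding rot_def inner_vec_def matrix_vector_mult_def sum_2 inner_complex_def cs [symmetric]
    by (simp add: algebra_simps)
  moreover have "c * c + s * s = 1"
    using sin_cos_squared_add3 [of a] by (simp add: cs)
  ultimately show ?thesis
    by simp
qed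

lemma turned_mult: "turned \<theta> a b ** turned \<theta> c d = turned \<theta> (a * c) (b * d)"
proof -
  have "turned \<theta> a b ** turned \<theta> c d =
      rot \<theta> ** diag2 a b ** (rot (- \<theta>) ** rot \<theta>) ** diag2 c d ** rot (- \<theta>)"
    by (simp only: turned_def matrix_mul_assoc)
  also have "\<dots> = rot \<theta> ** (diag2 a b ** diag2 c d) ** rot (- \<theta>)"
    by (simp add: matrix_mul_assoc)
  also have "diag2 a b ** diag2 c d = diag2 (a * c) (b * d)"
    by (simp add: diag2_def mat2_simps)
  finally show ?thesis
    by (simp add: turned_def)
qed

lemma turned_add: "turned \<theta> a b + turned \<theta> c d = turned \<theta> (a + c) (b + d)"
  by (simp add: turned_def diag2_def rot_def mat2_simps algebra_simps)

lemma turned_1 [simp]: "turned \<theta> 1 1 = mat 1"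
proof -
  have "diag2 1 1 = mat 1"
    by (simp add: diag2_def mat2_simps)
  then show ?thesis
    by (simp add: turned_def)
qed

lemma turned_0 [simp]: "turned \<theta> 0 0 = 0"
  by (simp add: turned_def diag2_def rot_def mat2_simps)

lemma rot_turned: "rot \<phi> ** turned \<theta> a b ** rot (- \<phi>) = turned (\<phi> + \<theta>) a b"
proof -
  have "rot \<phi> ** turned \<theta> a b ** rot (- \<phi>) = (rot \<phi> ** rot \<theta>) ** diag2 a b ** (rot (- \<theta>) ** rot (- \<phi>))"
    by (simp only: turned_def matrix_mul_assoc)
  then show ?thesis
    by (simp add: rot_mult turned_def add.commute)
qed

lemma rot_turned_vec: "rot \<phi> *v (turned \<theta> a b *v x) = turned (\<phi> + \<theta>) a b *v (rot \<phi> *v x)"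
  by (simp add: matrix_vector_mul_assoc matrix_mul_assoc flip: rot_turned)
     (simp flip: matrix_mul_assoc)

text \<open>Rotations preserve the inner product, so it splits into the two channels of the turned
  frame. This reduces the flux through an edge to scalar functions.\<close>

lemma inner_turned:
  assumes "rot (- \<theta>) *v x = x'" "rot (- \<theta>) *v y = y'"
  shows "(turned \<theta> a b *v x + turned \<theta> a' b' *v y) \<bullet> (turned \<theta> c d *v x + turned \<theta> c' d' *v y) =
    (a * x' $ 1 + a' * y' $ 1) \<bullet> (c * x' $ 1 + c' * y' $ 1) +
    (b * x' $ 2 + b' * y' $ 2) \<bullet> (d * x' $ 2 + d' * y' $ 2)"
proof -
  have eq: "turned \<theta> a b *v x + turned \<theta> a' b' *v y = rot \<theta> *v (diag2 a b *v x' + diag2 a' b' *v y')"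
    for a b a' b'
    using assms by (simp add: turned_def matrix_vector_right_distrib flip: matrix_vector_mul_assoc)
  show ?thesis
    unfolding eq inner_rot by (simp add: inner_vec_def sum_2 diag2_def matrix_vector_mult_def)
qed

section \<open>The transfer along an edge\<close>

text \<open>
  For \<open>\<lambda> = - s\<^sup>2\<close> and one channel with velocity \<open>k\<close>, displacement \<open>p\<close> and force \<open>f = k\<^sup>2 p'\<close> at one end
  of an edge of length \<open>l\<close> become \<open>tc p + ts f\<close> and \<open>tz p + tc f\<close> at the other end. The value of \<open>ts\<close> at
  \<open>s = 0\<close> is its limit, so that the static problem is included.
\<close>

definition tc :: "complex \<Rightarrow> real \<Rightarrow> real \<Rightarrow> complex" where
  "tc s l k = cosh (s * of_real l / of_real k)"

definition ts :: "complex \<Rightarrow> real \<Rightarrow> real \<Rightarrow> complex" where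
  "ts s l k = (if s = 0 then of_real (l / k\<^sup>2) else sinh (s * of_real l / of_real k) / (s * of_real k))"

definition tz :: "complex \<Rightarrow> real \<Rightarrow> real \<Rightarrow> complex" where
  "tz s l k = s * of_real k * sinh (s * of_real l / of_real k)"

lemma tc_ts_tz: "k > 0 \<Longrightarrow> tc s l k * tc s l k - ts s l k * tz s l k = 1"
  using cosh_square_eq[of "s * of_real l / of_real k"]
  by (auto simp: tc_def ts_def tz_def power2_eq_square)

lemma transfer_add:
  assumes "k > 0"
  shows "tc s (l + l') k = tc s l' k * tc s l k + ts s l' k * tz s l k"
    and "ts s (l + l') k = tc s l' k * ts s l k + ts s l' k * tc s l k"
    and "tz s (l + l') k = tz s l' k * tc s l k + tc s l' k * tz s l k"
proof -
  have e: "s * of_real (l + l') / of_real k = s * of_real l' / of_real k + s * of_real l / of_real k"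
    by (simp add: algebra_simps add_divide_distrib)
  show "tc s (l + l') k = tc s l' k * tc s l k + ts s l' k * tz s l k"
    using assms unfolding tc_def ts_def tz_def e cosh_add by auto
  show "ts s (l + l') k = tc s l' k * ts s l k + ts s l' k * tc s l k"
    using assms unfolding tc_def ts_def tz_def e sinh_add by (auto simp: field_simps)
  show "tz s (l + l') k = tz s l' k * tc s l k + tc s l' k * tz s l k"
    using assms unfolding tc_def ts_def tz_def e sinh_add by (auto simp: field_simps)
qed

text \<open>The flux P \<bullet> F along the channel has derivative |F|^2 / k^2 + Re (s^2) |P|^2,
  which is nonnegative. Equality at both ends makes the flux constant and forces F = 0 on the whole
  channel.\<close>

lemma channel_flux:
  fixes p f :: complex
  assumes "k > 0" "l > 0" "Re (s\<^sup>2) \<ge> 0"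
  shows "(tc s l k * p + ts s l k * f) \<bullet> (tz s l k * p + tc s l k * f) \<ge> p \<bullet> f"
    and "(tc s l k * p + ts s l k * f) \<bullet> (tz s l k * p + tc s l k * f) = p \<bullet> f \<Longrightarrow> f = 0"
proof -
  have "(tc s l k * p + ts s l k * f) \<bullet> (tz s l k * p + tc s l k * f) \<ge> p \<bullet> f \<and>
    ((tc s l k * p + ts s l k * f) \<bullet> (tz s l k * p + tc s l k * f) = p \<bullet> f \<longrightarrow> f = 0)"
  proof (cases "s = 0")
    case True
    define d where "d = l / k\<^sup>2"
    have "d > 0"
      using assms by (simp add: d_def)
    moreover have "(tc s l k * p + ts s l k * f) \<bullet> (tz s l k * p + tc s l k * f) = p \<bullet> f + d * (f \<bullet> f)"
      using True by (simp add: tc_def ts_def tz_def inner_add_left inner_complex_def algebra_simps flip: d_def)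
    ultimately show ?thesis
      by simp
  next
    case False
    \<comment> \<open>P and F are displacement and force at distance x from the first end: P' = F /
      k^2 and F' = s^2 P.\<close>
    define c where "c = s / of_real k"
    define P where "P x = cosh (c * of_real x) * p + sinh (c * of_real x) * (f / (s * of_real k))" for x :: real
    define F where "F x = sinh (c * of_real x) * (s * of_real k * p) + cosh (c * of_real x) * f" for x :: real
    have PF: "P x = tc s x k * p + ts s x k * f" "F x = tz s x k * p + tc s x k * f" for x
      using False by (simp_all add: P_def F_def tc_def ts_def tz_def c_def)
    have dc: "((\<lambda>x. cosh (c * of_real x)) has_vector_derivative c * sinh (c * of_real x)) (at x)"
      and ds: "((\<lambda>x. sinh (c * of_real x)) has_vector_derivative c * cosh (c * of_real x)) (at x)" for x :: real
      by (rule has_vector_derivative_real_field, auto intro!: derivative_eq_intros)+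
    have dP: "(P has_vector_derivative F x / of_real (k\<^sup>2)) (at x)" for x
    proof -
      have "(P has_vector_derivative c * sinh (c * of_real x) * p + c * cosh (c * of_real x) * (f / (s * of_real k))) (at x)"
        unfolding P_def by (intro has_vector_derivative_add has_vector_derivative_mult_left dc ds)
      also have "c * sinh (c * of_real x) * p + c * cosh (c * of_real x) * (f / (s * of_real k)) = F x / of_real (k\<^sup>2)"
        using False assms by (simp add: F_def c_def field_simps power2_eq_square)
      finally show ?thesis .
    qed
    have dF: "(F has_vector_derivative s\<^sup>2 * P x) (at x)" for x
    proof -
      have "(F has_vector_derivative c * cosh (c * of_real x) * (s * of_real k * p) + c * sinh (c * of_real x) * f) (at x)"
        unfolding F_def by (intro has_vector_derivative_add has_vector_derivative_mult_left dc ds)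
      also have "c * cosh (c * of_real x) * (s * of_real k * p) + c * sinh (c * of_real x) * f = s\<^sup>2 * P x"
        using False assms by (simp add: P_def c_def field_simps power2_eq_square)
      finally show ?thesis .
    qed
    define \<phi> where "\<phi> x = P x \<bullet> F x" for x
    define d where "d x = (norm (F x))\<^sup>2 / k\<^sup>2 + Re (s\<^sup>2) * (norm (P x))\<^sup>2" for x
    have "(\<phi> has_vector_derivative (P x \<bullet> (s\<^sup>2 * P x) + (F x / of_real (k\<^sup>2)) \<bullet> F x)) (at x)" for x
      unfolding \<phi>_def by (intro bounded_bilinear.has_vector_derivative[OF bounded_bilinear_inner] dP dF)
    moreover have "P x \<bullet> (s\<^sup>2 * P x) + (F x / of_real (k\<^sup>2)) \<bullet> F x = d x" for x
    proof -
      have 1: "z \<bullet> (w * z) = Re w * (norm z)\<^sup>2" for z w :: complex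
        unfolding cmod_power2 inner_complex_def by (simp add: algebra_simps power2_eq_square)
      have 2: "(z / of_real (k\<^sup>2)) \<bullet> z = (norm z)\<^sup>2 / k\<^sup>2" for z :: complex
        using 1[of z "inverse (of_real (k\<^sup>2))"] by (simp add: inner_commute divide_inverse mult.commute flip: of_real_power of_real_inverse)
      show ?thesis
        unfolding 1 2 d_def by simp
    qed
    ultimately have d\<phi>: "(\<phi> has_real_derivative d x) (at x)" for x
      by (simp add: has_real_derivative_iff_has_vector_derivative)
    have d0: "d x \<ge> 0" for x
      using assms by (simp add: d_def)
    have mono: "\<phi> x \<le> \<phi> y" if "x \<le> y" for x y
      using DERIV_nonneg_imp_nondecreasing[OF that] d\<phi> d0 by blast
    have P0: "P 0 = p" and F0: "F 0 = f"
      by (simp_all add: P_def F_def)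
    have "f = 0" if eq: "\<phi> l = \<phi> 0"
    proof -
      have const: "\<phi> x = \<phi> 0" if "x \<in> {0..l}" for x
      proof (rule antisym)
        show "\<phi> x \<le> \<phi> 0"
          using mono[of x l] that unfolding eq by simp
        show "\<phi> 0 \<le> \<phi> x"
          using that by (intro mono) simp
      qed
      have dx: "d x = 0" if x: "x \<in> {0<..<l}" for x
      proof -
        have "0 < min x (l - x)"
          using x by simp
        moreover have "\<forall>y. \<bar>x - y\<bar> < min x (l - x) \<longrightarrow> \<phi> x = \<phi> y"
        proof (intro allI impI)
          fix y assume "\<bar>x - y\<bar> < min x (l - x)"
          then have "y \<in> {0..l}" "x \<in> {0..l}"
            using x by (auto simp: abs_if split: if_splits)
          then show "\<phi> x = \<phi> y"
            by (simp only: const)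
        qed
        ultimately show ?thesis
          using DERIV_local_const[OF d\<phi>[of x]] by blast
      qed
      have Fx: "F x = 0" if "x \<in> {0<..<l}" for x
      proof -
        have "(norm (F x))\<^sup>2 / k\<^sup>2 \<ge> 0" "Re (s\<^sup>2) * (norm (P x))\<^sup>2 \<ge> 0"
          using assms by simp_all
        then have "(norm (F x))\<^sup>2 / k\<^sup>2 = 0"
          using dx[OF that] unfolding d_def by linarith
        then show ?thesis
          using assms by simp
      qed
      \<comment> \<open>F vanishes so far at interior points only; continuity carries this to the
        end 0.\<close>
      have "continuous (at 0) F"
        using dF has_vector_derivative_continuous by blast
      then have "(F \<longlongrightarrow> F 0) (at_right 0)"
        unfolding continuous_within using filterlim_at_split by blast
      moreover have "eventually (\<lambda>x. F x = 0) (at_right 0)"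
        using eventually_at_right_real[OF \<open>l > 0\<close>] by eventually_elim (rule Fx)
      ultimately have "F 0 = 0"
        by (metis tendsto_eventually tendsto_unique trivial_limit_at_right_real)
      then show "f = 0"
        using F0 by simp
    qed
    then show ?thesis
      using mono[of 0 l] assms P0 F0 by (simp add: \<phi>_def PF)
  qed
  then show "(tc s l k * p + ts s l k * f) \<bullet> (tz s l k * p + tc s l k * f) \<ge> p \<bullet> f"
    and "(tc s l k * p + ts s l k * f) \<bullet> (tz s l k * p + tc s l k * f) = p \<bullet> f \<Longrightarrow> f = 0"
    by blast+
qed

text \<open>For p = 0 and f = 1 a zero of \<open>ts\<close> would make the flux vanish at both ends,
  and then f = 0.\<close>

lemma ts_nonzero: "k > 0 \<Longrightarrow> l > 0 \<Longrightarrow> Re (s\<^sup>2) \<ge> 0 \<Longrightarrow> ts s l k \<noteq> 0"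
  using channel_flux(2)[of k l s 0 1] by auto

lemma tendsto_tc: "(s \<longlongrightarrow> s0) F \<Longrightarrow> ((\<lambda>n. tc (s n) l k) \<longlongrightarrow> tc s0 l k) F"
  unfolding tc_def divide_inverse by (intro tendsto_intros)

lemma tendsto_tz: "(s \<longlongrightarrow> s0) F \<Longrightarrow> ((\<lambda>n. tz (s n) l k) \<longlongrightarrow> tz s0 l k) F"
  unfolding tz_def divide_inverse by (intro tendsto_intros)

text \<open>The value at 0 removes the singularity: the limit is the derivative of sinh.\<close>

lemma isCont_ts:
  assumes "k > 0"
  shows "isCont (\<lambda>s. ts s l k) s0"
proof (cases "s0 = 0")
  case True
  have "((\<lambda>z. sinh (z * c)) has_field_derivative c) (at 0)" for c :: complex
    by (auto intro!: derivative_eq_intros)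
  from this[of "of_real l / of_real k"]
  have "((\<lambda>z. sinh (z * of_real l / of_real k)) has_field_derivative of_real l / of_real k) (at (0::complex))"
    by simp
  then have "((\<lambda>z. sinh (z * of_real l / of_real k) / z) \<longlongrightarrow> of_real l / of_real k) (at (0::complex))"
    by (simp add: has_field_derivative_iff)
  then have "((\<lambda>z. sinh (z * of_real l / of_real k) / z / of_real k) \<longlongrightarrow> of_real l / of_real k / of_real k) (at (0::complex))"
    by (rule tendsto_divide[OF _ tendsto_const]) (use assms in auto)
  then have "((\<lambda>z. ts z l k) \<longlongrightarrow> of_real l / of_real k / of_real k) (at 0)"
    by (rule tendsto_cong[THEN iffD1, rotated]) (simp add: ts_def eventually_at_filter)
  then show ?thesis
    using True assms by (simp add: isCont_def ts_def power2_eq_square)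
next
  case False
  have "isCont (\<lambda>s. sinh (s * of_real l / of_real k) / (s * of_real k)) s0"
    using assms False by (intro continuous_intros) auto
  moreover have "eventually (\<lambda>s. sinh (s * of_real l / of_real k) / (s * of_real k) = ts s l k) (nhds s0)"
    using t1_space_nhds[OF False] by eventually_elim (simp add: ts_def)
  ultimately show ?thesis
    using isCont_cong[of "\<lambda>s. sinh (s * of_real l / of_real k) / (s * of_real k)" "\<lambda>s. ts s l k"] by blast
qed

lemma tendsto_ts: "k > 0 \<Longrightarrow> (s \<longlongrightarrow> s0) F \<Longrightarrow> ((\<lambda>n. ts (s n) l k) \<longlongrightarrow> ts s0 l k) F"
  using isCont_tendsto_compose[OF isCont_ts] .

section \<open>Rooted networks\<close>

text \<open>
  In a rooted network the vertex \<open>v\<close> other than the base stands also for the edge from \<open>v\<close> to its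
  parent. Displacements \<open>p v\<close> and forces \<open>f v\<close> refer to the end \<open>v\<close> of this edge and to a fixed frame of
  the plane; \<open>top_value\<close> and \<open>top_force\<close> are their values at the parent end. The displacement
  vanishes at the base, and the forces need not balance at the vertices of \<open>B\<close>.
\<close>

record 'a rooted_net =
  nodes :: "'a set"
  base :: 'a
  parent :: "'a \<Rightarrow> 'a"
  elen :: "'a \<Rightarrow> real"
  vel1 :: "'a \<Rightarrow> real"
  vel2 :: "'a \<Rightarrow> real"
  frame :: "'a \<Rightarrow> real"

definition edges :: "'a rooted_net \<Rightarrow> 'a set" where
  "edges R = nodes R - {base R}"

definition children :: "'a rooted_net \<Rightarrow> 'a \<Rightarrow> 'a set" where
  "children R v = {w \<in> edges R. parent R w = v}"

definition leaves :: "'a rooted_net \<Rightarrow> 'a set" where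
  "leaves R = {v \<in> edges R. children R v = {}}"

text \<open>A height that drops from each vertex to its parent expresses that every path of parents
  ends at the base; it drives the inductions from the leaves upwards and from the base
  downwards.\<close>

definition net :: "'a rooted_net \<Rightarrow> bool" where
  "net R \<longleftrightarrow> finite (nodes R) \<and> base R \<in> nodes R \<and> parent R ` edges R \<subseteq> nodes R \<and>
     (\<exists>h::'a \<Rightarrow> nat. \<forall>v\<in>edges R. h (parent R v) < h v) \<and>
     (\<forall>v\<in>edges R. elen R v > 0 \<and> vel1 R v > 0 \<and> vel2 R v > 0)"

text \<open>Functional calculus of the velocity matrix of the edge: \<open>efun R v of_real\<close>
  is its impedance and \<open>efun R v (\<lambda>k. of_real (k\<^sup>2))\<close> its stiffness, both
  in the fixed frame.\<close>

definition efun :: "'a rooted_net \<Rightarrow> 'a \<Rightarrow> (real \<Rightarrow> complex) \<Rightarrow> complex^2^2" where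
  "efun R v g = turned (frame R v) (g (vel1 R v)) (g (vel2 R v))"

definition top_value where
  "top_value R s p f v = efun R v (tc s (elen R v)) *v p v + efun R v (ts s (elen R v)) *v f v"

definition top_force where
  "top_force R s p f v = efun R v (tz s (elen R v)) *v p v + efun R v (tc s (elen R v)) *v f v"

text \<open>The imbalance at \<open>v\<close>, that is, the force applied from outside. At a leaf it
  is \<open>f v\<close> itself.\<close>

definition ext_force :: "'a rooted_net \<Rightarrow> complex \<Rightarrow> ('a \<Rightarrow> complex^2) \<Rightarrow> ('a \<Rightarrow> complex^2) \<Rightarrow> 'a \<Rightarrow> complex^2" where
  "ext_force R s p f v = f v - (\<Sum>w\<in>children R v. top_force R s p f w)"

definition sol :: "'a rooted_net \<Rightarrow> 'a set \<Rightarrow> complex \<Rightarrow> ('a \<Rightarrow> complex^2) \<Rightarrow> ('a \<Rightarrow> complex^2) \<Rightarrow> bool" where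
  "sol R B s p f \<longleftrightarrow>
     (\<forall>v\<in>edges R. top_value R s p f v = (if parent R v = base R then 0 else p (parent R v))) \<and>
     (\<forall>v\<in>edges R - B. ext_force R s p f v = 0)"

lemma finite_edges [simp]: "net R \<Longrightarrow> finite (edges R)"
  by (simp add: net_def edges_def)

lemma finite_children [simp]: "net R \<Longrightarrow> finite (children R v)"
  by (rule finite_subset[OF _ finite_edges]) (auto simp: children_def)

lemma children_edges: "w \<in> children R v \<Longrightarrow> w \<in> edges R"
  by (simp add: children_def)

lemma net_pos: "net R \<Longrightarrow> v \<in> edges R \<Longrightarrow> elen R v > 0 \<and> vel1 R v > 0 \<and> vel2 R v > 0"
  by (simp add: net_def)

lemma net_parent: "net R \<Longrightarrow> v \<in> edges R \<Longrightarrow> parent R v \<noteq> base R \<Longrightarrow> parent R v \<in> edges R"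
  by (auto simp: net_def edges_def)

lemma base_notin_edges [simp]: "base R \<notin> edges R"
  by (simp add: edges_def)

lemma net_induct_up [consumes 2, case_names step]:
  assumes "net R" "v \<in> edges R"
    and "\<And>v. v \<in> edges R \<Longrightarrow> (\<And>w. w \<in> children R v \<Longrightarrow> P w) \<Longrightarrow> P v"
  shows "P v"
proof -
  obtain h :: "'a \<Rightarrow> nat" where h: "\<And>v. v \<in> edges R \<Longrightarrow> h (parent R v) < h v"
    using assms(1) by (auto simp: net_def)
  define M where "M = Max (h ` edges R)"
  have M: "h w \<le> M" if "w \<in> edges R" for w
    using that assms(1) by (simp add: M_def)
  show ?thesis
    using assms(2)
  proof (induction "M - h v" arbitrary: v rule: less_induct)
    case less
    show ?case
    proof (rule assms(3)[OF less.prems])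
      fix w assume "w \<in> children R v"
      then show "P w"
        using less.hyps[of w] h[of w] M[of w] by (fastforce simp: children_def)
    qed
  qed
qed

lemma net_induct_down [consumes 2, case_names step]:
  assumes "net R" "v \<in> edges R"
    and "\<And>v. v \<in> edges R \<Longrightarrow> (parent R v \<noteq> base R \<Longrightarrow> P (parent R v)) \<Longrightarrow> P v"
  shows "P v"
proof -
  obtain h :: "'a \<Rightarrow> nat" where h: "\<And>v. v \<in> edges R \<Longrightarrow> h (parent R v) < h v"
    using assms(1) by (auto simp: net_def)
  show ?thesis
    using assms(2)
  proof (induction "h v" arbitrary: v rule: less_induct)
    case less
    show ?case
      by (rule assms(3)[OF less.prems])
        (use less h[of v] net_parent[OF assms(1)] in blast)
  qed
qed

lemma efun_mult: "efun R v g ** efun R v h = efun R v (\<lambda>k. g k * h k)"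
  by (simp add: efun_def turned_mult)

lemma efun_mult_vec: "efun R v g *v (efun R v h *v x) = efun R v (\<lambda>k. g k * h k) *v x"
  by (simp add: matrix_vector_mul_assoc efun_mult)

lemma efun_cong: "g (vel1 R v) = h (vel1 R v) \<Longrightarrow> g (vel2 R v) = h (vel2 R v) \<Longrightarrow> efun R v g = efun R v h"
  by (simp add: efun_def)

lemma efun_add_vec: "efun R v g *v x + efun R v h *v x = efun R v (\<lambda>k. g k + h k) *v x"
  by (simp add: efun_def turned_add flip: matrix_vector_mult_add_rdistrib)

lemma efun_1 [simp]: "efun R v (\<lambda>_. 1) = mat 1"
  by (simp add: efun_def)

lemma efun_0 [simp]: "efun R v (\<lambda>_. 0) = 0"
  by (simp add: efun_def)

text \<open>The transfer matrix has determinant one.\<close>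

lemma transfer_inverse:
  assumes "net R" "v \<in> edges R"
  shows "efun R v (tc s x) *v (efun R v (tc s x) *v P - efun R v (ts s x) *v F) +
      efun R v (ts s x) *v (efun R v (tc s x) *v F - efun R v (tz s x) *v P) = P"
    and "efun R v (tz s x) *v (efun R v (tc s x) *v P - efun R v (ts s x) *v F) +
      efun R v (tc s x) *v (efun R v (tc s x) *v F - efun R v (tz s x) *v P) = F"
proof -
  have k: "vel1 R v > 0" "vel2 R v > 0"
    using net_pos[OF assms] by auto
  have 1: "efun R v (\<lambda>k. tc s x k * tc s x k) *v y =
      y + efun R v (\<lambda>k. ts s x k * tz s x k) *v y" for y
  proof -
    have "efun R v (\<lambda>k. tc s x k * tc s x k) = efun R v (\<lambda>k. 1 + ts s x k * tz s x k)"
      using tc_ts_tz[OF k(1), of s x] tc_ts_tz[OF k(2), of s x]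
      by (intro efun_cong) (simp_all add: algebra_simps)
    then show ?thesis
      using efun_add_vec[of R v "\<lambda>_. 1" y] by simp
  qed
  show "efun R v (tc s x) *v (efun R v (tc s x) *v P - efun R v (ts s x) *v F) +
      efun R v (ts s x) *v (efun R v (tc s x) *v F - efun R v (tz s x) *v P) = P"
    by (simp add: matrix_vector_mult_diff_distrib efun_mult_vec 1 mult.commute)
  show "efun R v (tz s x) *v (efun R v (tc s x) *v P - efun R v (ts s x) *v F) +
      efun R v (tc s x) *v (efun R v (tc s x) *v F - efun R v (tz s x) *v P) = F"
    by (simp add: matrix_vector_mult_diff_distrib efun_mult_vec 1 mult.commute)
qed

lemma top_zero:
  assumes "net R" "v \<in> edges R" "top_value R s p f v = 0" "top_force R s p f v = 0"
  shows "p v = 0" "f v = 0"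
proof -
  \<comment> \<open>The inverse of the transfer is the transfer with the sign of the force reversed,
    as if the edge were run backwards.\<close>
  have "efun R v (tc s (elen R v)) *v p v - efun R v (ts s (elen R v)) *v (- f v) = 0"
    using assms(3) by (simp add: top_value_def vec.neg)
  moreover have "efun R v (tc s (elen R v)) *v (- f v) - efun R v (tz s (elen R v)) *v p v = - top_force R s p f v"
    by (simp add: top_force_def vec.neg)
  ultimately show "p v = 0" "f v = 0"
    using transfer_inverse[OF assms(1,2), of s "elen R v" "p v" "- f v"] assms(4) by simp_all
qed

lemma top_of_zero:
  "p v = 0 \<Longrightarrow> f v = 0 \<Longrightarrow> top_value R s p f v = 0"
  "p v = 0 \<Longrightarrow> f v = 0 \<Longrightarrow> top_force R s p f v = 0"
  by (simp_all add: top_value_def top_force_def)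

lemma top_cong:
  "p v = p' v \<Longrightarrow> f v = f' v \<Longrightarrow> top_value R s p f v = top_value R s p' f' v"
  "p v = p' v \<Longrightarrow> f v = f' v \<Longrightarrow> top_force R s p f v = top_force R s p' f' v"
  by (simp_all add: top_value_def top_force_def)

lemma ext_force_cong:
  assumes "\<And>w. w \<in> children R v \<Longrightarrow> p w = p' w \<and> f w = f' w" "f v = f' v"
  shows "ext_force R s p f v = ext_force R s p' f' v"
proof -
  have "(\<Sum>w\<in>children R v. top_force R s p f w) = (\<Sum>w\<in>children R v. top_force R s p' f' w)"
    by (rule sum.cong) (use assms in \<open>auto intro!: top_cong\<close>)
  then show ?thesis
    using assms by (simp add: ext_force_def)
qed

lemma top_add:
  "top_value R s (\<lambda>v. p v + p' v) (\<lambda>v. f v + f' v) v = top_value R s p f v + top_value R s p' f' v"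
  "top_force R s (\<lambda>v. p v + p' v) (\<lambda>v. f v + f' v) v = top_force R s p f v + top_force R s p' f' v"
  by (simp_all add: top_value_def top_force_def matrix_vector_right_distrib)

lemma ext_force_add:
  "ext_force R s (\<lambda>v. p v + p' v) (\<lambda>v. f v + f' v) v = ext_force R s p f v + ext_force R s p' f' v"
  by (simp add: ext_force_def top_add sum.distrib)

lemma sol_add: "sol R B s p f \<Longrightarrow> sol R B s p' f' \<Longrightarrow> sol R B s (\<lambda>v. p v + p' v) (\<lambda>v. f v + f' v)"
  by (simp add: sol_def top_add ext_force_add)

lemma top_scale:
  "top_value R s (\<lambda>v. c *s p v) (\<lambda>v. c *s f v) v = c *s top_value R s p f v"
  "top_force R s (\<lambda>v. c *s p v) (\<lambda>v. c *s f v) v = c *s top_force R s p f v"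
  by (simp_all add: top_value_def top_force_def vector_scalar_commute vector_add_ldistrib)

lemma ext_force_scale: "ext_force R s (\<lambda>v. c *s p v) (\<lambda>v. c *s f v) v = c *s ext_force R s p f v"
  by (simp add: ext_force_def top_scale vec_eq_iff sum_distrib_left algebra_simps)

lemma sol_scale: "sol R B s p f \<Longrightarrow> sol R B s (\<lambda>v. c *s p v) (\<lambda>v. c *s f v)"
  by (simp add: sol_def top_scale ext_force_scale)

lemma sol_child:
  "sol R B s p f \<Longrightarrow> w \<in> children R v \<Longrightarrow> v \<in> edges R \<Longrightarrow> top_value R s p f w = p v"
  by (auto simp: sol_def children_def edges_def)

lemma sol_root_child:
  "sol R B s p f \<Longrightarrow> w \<in> children R (base R) \<Longrightarrow> top_value R s p f w = 0"
  by (auto simp: sol_def children_def)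

lemma sol_balance:
  "sol R B s p f \<Longrightarrow> v \<in> edges R \<Longrightarrow> v \<notin> B \<Longrightarrow> f v = (\<Sum>w\<in>children R v. top_force R s p f w)"
  by (auto simp: sol_def ext_force_def)

lemma scaleR_vec: "r *\<^sub>R (x::complex^2) = of_real r *s x"
  by (simp add: vec_eq_iff) (simp add: scaleR_conv_of_real)

lemma sol_0: "sol R B s (\<lambda>_. 0) (\<lambda>_. 0)"
  by (auto simp: sol_def top_of_zero ext_force_def)

section \<open>Flux and uniqueness\<close>

lemma edge_flux:
  assumes "net R" "v \<in> edges R" "Re (s\<^sup>2) \<ge> 0"
  shows "p v \<bullet> f v \<le> top_value R s p f v \<bullet> top_force R s p f v"
    and "top_value R s p f v \<bullet> top_force R s p f v = p v \<bullet> f v \<Longrightarrow> f v = 0"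
proof -
  define x y where xy: "x = rot (- frame R v) *v p v" "y = rot (- frame R v) *v f v"
  note pos = net_pos[OF assms(1,2)]
  have eq: "top_value R s p f v \<bullet> top_force R s p f v =
      (tc s (elen R v) (vel1 R v) * x $ 1 + ts s (elen R v) (vel1 R v) * y $ 1) \<bullet>
      (tz s (elen R v) (vel1 R v) * x $ 1 + tc s (elen R v) (vel1 R v) * y $ 1) +
      (tc s (elen R v) (vel2 R v) * x $ 2 + ts s (elen R v) (vel2 R v) * y $ 2) \<bullet>
      (tz s (elen R v) (vel2 R v) * x $ 2 + tc s (elen R v) (vel2 R v) * y $ 2)"
    unfolding top_value_def top_force_def efun_def by (rule inner_turned) (simp_all add: xy)
  have pf: "p v \<bullet> f v = x $ 1 \<bullet> y $ 1 + x $ 2 \<bullet> y $ 2"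
    using inner_rot[of "- frame R v" "p v" "f v"] by (simp add: xy[symmetric] inner_vec_def sum_2)
  note cf1 = channel_flux[of "vel1 R v" "elen R v" s "x $ 1" "y $ 1"]
  note cf2 = channel_flux[of "vel2 R v" "elen R v" s "x $ 2" "y $ 2"]
  show "p v \<bullet> f v \<le> top_value R s p f v \<bullet> top_force R s p f v"
    using cf1(1) cf2(1) pos assms(3) unfolding eq pf by simp
  assume "top_value R s p f v \<bullet> top_force R s p f v = p v \<bullet> f v"
  then have "y $ 1 = 0" "y $ 2 = 0"
    using cf1 cf2 pos assms(3) unfolding eq pf by simp_all
  then have "y = 0"
    by (simp add: vec_eq_iff forall_2)
  then show "f v = 0"
    using rot_cancel(1)[of "frame R v" "f v"] by (simp add: xy)
qed

text \<open>A discrete Green formula. Edges are grouped by their upper vertex, where all of them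
  share the displacement \<open>p u\<close>; the base contributes nothing because it is at
  rest.\<close>

lemma flux_sum:
  assumes "net R" "B \<subseteq> edges R" "sol R B s p f"
  shows "(\<Sum>v\<in>edges R. top_value R s p f v \<bullet> top_force R s p f v - p v \<bullet> f v) =
    - (\<Sum>v\<in>B. p v \<bullet> ext_force R s p f v)"
proof -
  let ?F = "top_force R s p f"
  have fin: "finite (nodes R)" and img: "parent R ` edges R \<subseteq> nodes R" and b: "base R \<in> nodes R"
    using assms(1) by (auto simp: net_def)
  have "(\<Sum>v\<in>edges R. top_value R s p f v \<bullet> ?F v) =
      (\<Sum>u\<in>nodes R. \<Sum>v\<in>{v \<in> edges R. parent R v = u}. top_value R s p f v \<bullet> ?F v)"
    by (rule sum.group[symmetric]) (use assms(1) fin img in auto)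
  also have "\<dots> = (\<Sum>u\<in>edges R. p u \<bullet> (\<Sum>v\<in>children R u. ?F v))"
  proof -
    have "(\<Sum>v\<in>{v \<in> edges R. parent R v = u}. top_value R s p f v \<bullet> ?F v) =
        (if u = base R then 0 else p u \<bullet> (\<Sum>v\<in>children R u. ?F v))" for u
      using assms(3) by (auto simp: sol_def children_def inner_sum_right intro!: sum.cong sum.neutral)
    then show ?thesis
      using sum.remove[OF fin b, of "\<lambda>u. if u = base R then 0 else p u \<bullet> (\<Sum>v\<in>children R u. ?F v)"]
      by (simp add: edges_def cong: sum.cong_simp)
  qed
  finally have "(\<Sum>v\<in>edges R. top_value R s p f v \<bullet> ?F v - p v \<bullet> f v) =
      (\<Sum>u\<in>edges R. - (p u \<bullet> ext_force R s p f u))"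
    by (simp add: sum_subtractf ext_force_def inner_diff_right)
  also have "\<dots> = (\<Sum>u\<in>B. - (p u \<bullet> ext_force R s p f u))"
    by (rule sum.mono_neutral_right) (use assms in \<open>auto simp: sol_def\<close>)
  finally show ?thesis
    by (simp add: sum_negf)
qed

text \<open>The boundary term of \<open>flux_sum\<close> is zero, so no edge gains flux and all
  forces vanish. Without forces, zero displacement at the leaves spreads upwards.\<close>

lemma sol_zero:
  assumes "net R" "leaves R \<subseteq> B" "B \<subseteq> edges R" "Re (s\<^sup>2) \<ge> 0" "sol R B s p f"
    and "\<And>v. v \<in> B \<Longrightarrow> p v = 0" and "v \<in> edges R"
  shows "p v = 0" "f v = 0"
proof -
  have "(\<Sum>v\<in>edges R. top_value R s p f v \<bullet> top_force R s p f v - p v \<bullet> f v) = 0"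
    using flux_sum[OF assms(1,3,5)] assms(6) by simp
  then have "\<forall>v\<in>edges R. top_value R s p f v \<bullet> top_force R s p f v - p v \<bullet> f v = 0"
    using edge_flux(1)[OF assms(1) _ assms(4)]
    by (subst (asm) sum_nonneg_eq_0_iff) (use assms(1) in auto)
  then have f: "f v = 0" if "v \<in> edges R" for v
    using edge_flux(2)[OF assms(1) that assms(4), of p f] that by auto
  then show "f v = 0"
    using assms(7) by blast
  show "p v = 0"
    using assms(1,7)
  proof (induction v rule: net_induct_up)
    case (step v)
    show ?case
    proof (cases "v \<in> B")
      case False
      then obtain w where w: "w \<in> children R v"
        using step(1) assms(2) by (auto simp: leaves_def)
      then have "top_value R s p f w = 0"
        using step(2) f by (intro top_of_zero) (auto simp: children_def)
      then show ?thesis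
        using sol_child[OF assms(5) w step(1)] by simp
    qed (use assms(6) in blast)
  qed
qed

lemma sol_diff: "sol R B s p f \<Longrightarrow> sol R B s p' f' \<Longrightarrow> sol R B s (\<lambda>v. p v - p' v) (\<lambda>v. f v - f' v)"
  using sol_add[OF _ sol_scale[of R B s p' f' "-1"], of p f] by (simp add: vec_eq_iff)

lemma sol_unique:
  assumes "net R" "leaves R \<subseteq> B" "B \<subseteq> edges R" "Re (s\<^sup>2) \<ge> 0" "sol R B s p f" "sol R B s p' f'"
    and "\<And>v. v \<in> B \<Longrightarrow> p v = p' v" and "v \<in> edges R"
  shows "p v = p' v" "f v = f' v"
  using sol_zero[OF assms(1-4) sol_diff[OF assms(5,6)] _ assms(8)] assms(7) by simp_all

lemma sol_unique_force:
  assumes "net R" "leaves R \<subseteq> B" "B \<subseteq> edges R" "Re (s\<^sup>2) \<ge> 0" "sol R B s p f" "sol R B s p' f'"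
    and "\<And>v. v \<in> B \<Longrightarrow> p v = p' v" and "v \<in> edges R"
  shows "ext_force R s p f v = ext_force R s p' f' v"
  by (rule ext_force_cong) (use sol_unique[OF assms(1-7)] assms(8) in \<open>auto simp: children_def\<close>)

section \<open>Existence\<close>

text \<open>Induction on the number of vertices outside \<open>B\<close>. If all displacements are
  prescribed, every edge is solved by itself. To release a vertex, its displacement is adjusted
  until the external force there vanishes; this is possible because an injective linear map of a
  finite-dimensional space is onto.\<close>

lemma dirichlet_exists:
  assumes "net R" "Re (s\<^sup>2) \<ge> 0" "leaves R \<subseteq> B" "B \<subseteq> edges R"
  shows "\<exists>p f. sol R B s p f \<and> (\<forall>v\<in>B. p v = b v)"
  using assms(3,4)
proof (induction "card (edges R - B)" arbitrary: B b)
  case 0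
  then have B: "B = edges R"
    using assms(1) by auto
  define q where "q v = (if parent R v = base R then 0 else b (parent R v))" for v
  define f where "f v = efun R v (\<lambda>k. inverse (ts s (elen R v) k)) *v (q v - efun R v (tc s (elen R v)) *v b v)" for v
  have "top_value R s b f v = q v" if v: "v \<in> edges R" for v
  proof -
    have "efun R v (\<lambda>k. ts s (elen R v) k * inverse (ts s (elen R v) k)) = efun R v (\<lambda>_. 1)"
      using net_pos[OF assms(1) v] ts_nonzero assms(2) by (intro efun_cong) auto
    then show ?thesis
      by (simp add: top_value_def f_def efun_mult_vec)
  qed
  then show ?case
    using B by (intro exI[of _ b] exI[of _ f]) (auto simp: sol_def q_def)
next
  case (Suc n)
  have fin: "finite (edges R - B)"
    using assms(1) by simp
  then obtain x where x: "x \<in> edges R" "x \<notin> B"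
    using Suc(2) by (metis DiffE card.empty ex_in_conv nat.distinct(1))
  have c: "n = card (edges R - insert x B)"
  proof -
    have "edges R - B = insert x (edges R - insert x B)"
      using x by auto
    moreover have "finite (edges R - insert x B)" "x \<notin> edges R - insert x B"
      using assms(1) by auto
    ultimately show ?thesis
      using Suc(2) card_insert_disjoint by (metis old.nat.inject)
  qed
  note IH = Suc(1)[OF c, of "b(x := 0)"] and B' = Suc(3,4)
  have ins: "leaves R \<subseteq> insert x B" "insert x B \<subseteq> edges R"
    using B' x by auto
  have "\<forall>y. \<exists>p f. sol R (insert x B) s p f \<and> (\<forall>v\<in>insert x B. p v = (if v = x then y else 0))"
    by (intro allI Suc(1)[OF c ins])
  then obtain P F where PF: "\<And>y. sol R (insert x B) s (P y) (F y)"
      "\<And>y v. v \<in> insert x B \<Longrightarrow> P y v = (if v = x then y else 0)"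
    by metis
  \<comment> \<open>The external force needed at x to produce displacement y there while the rest of
    the boundary is at rest. Uniqueness makes it independent of the chosen solutions and hence
    linear.\<close>
  define G where "G y = ext_force R s (P y) (F y) x" for y
  have G: "G y = ext_force R s p f x"
    if "sol R (insert x B) s p f" "\<And>v. v \<in> insert x B \<Longrightarrow> p v = (if v = x then y else 0)" for y p f
    unfolding G_def using sol_unique_force[OF assms(1) ins assms(2) PF(1) that(1)] PF(2) that(2) x by auto
  have "linear G"
  proof (rule linearI)
    show "G (y + z) = G y + G z" for y z
      unfolding G_def[of y] G_def[of z] ext_force_add[symmetric]
      by (rule G) (use PF in \<open>auto intro: sol_add\<close>)
    show "G (r *\<^sub>R y) = r *\<^sub>R G y" for r y
      unfolding G_def[of y] scaleR_vec ext_force_scale[symmetric]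
      by (rule G) (use PF in \<open>auto intro: sol_scale\<close>)
  qed
  moreover have "inj G"
    unfolding linear_injective_0[OF \<open>linear G\<close>]
  proof (intro allI impI)
    fix y assume "G y = 0"
    then have "sol R B s (P y) (F y)"
      using PF(1)[of y] by (auto simp: sol_def G_def)
    then have "P y x = 0"
      by (rule sol_zero(1)[OF assms(1) B' assms(2)]) (use PF(2)[of _ y] x in auto)
    then show "y = 0"
      using PF(2)[of x y] by simp
  qed
  ultimately have "surj G"
    using linear_injective_imp_surjective by blast
  obtain p f where pf: "sol R (insert x B) s p f" "\<And>v. v \<in> insert x B \<Longrightarrow> p v = (b(x := 0)) v"
    using IH[OF ins] by blast
  obtain y where y: "G y = - ext_force R s p f x"
    using \<open>surj G\<close> by (metis surj_def)
  have "sol R (insert x B) s (\<lambda>v. p v + P y v) (\<lambda>v. f v + F y v)"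
    using pf(1) PF(1) by (rule sol_add)
  moreover have "ext_force R s (\<lambda>v. p v + P y v) (\<lambda>v. f v + F y v) x = 0"
    using y by (simp add: ext_force_add G_def)
  ultimately have "sol R B s (\<lambda>v. p v + P y v) (\<lambda>v. f v + F y v)"
    by (auto simp: sol_def)
  moreover have "p v + P y v = b v" if "v \<in> B" for v
    using that pf(2)[of v] PF(2)[of v y] x by auto
  ultimately show ?case
    by blast
qed

section \<open>Equality of boundary data\<close>

text \<open>\<open>H\<close> is kept apart from \<open>Q\<close>: the measurements fix a force only
  up to the stiffness of its edge. One direction suffices, since displacements on the boundary
  determine the solution.\<close>

definition same_data where
  "same_data R B R' B' \<phi> Q H s \<longleftrightarrow>
     (\<forall>p f. sol R B s p f \<longrightarrow> (\<exists>p' f'. sol R' B' s p' f' \<and>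
        (\<forall>j\<in>B. p' (\<phi> j) = Q j *v p j \<and> ext_force R' s p' f' (\<phi> j) = H j *v ext_force R s p f j)))"

lemma tendsto_mat2_vec:
  fixes A :: "'x \<Rightarrow> complex^2^2"
  assumes "(A \<longlongrightarrow> A0) F" "(x \<longlongrightarrow> x0) F"
  shows "((\<lambda>n. A n *v x n) \<longlongrightarrow> A0 *v x0) F"
  unfolding matrix_vector_mult_def
  by (intro tendsto_vec_lambda tendsto_sum tendsto_mult tendsto_vec_nth assms)

lemma tendsto_mat2_mult:
  fixes A :: "'x \<Rightarrow> complex^2^2"
  assumes "(A \<longlongrightarrow> A0) F" "(B \<longlongrightarrow> B0) F"
  shows "((\<lambda>n. A n ** B n) \<longlongrightarrow> A0 ** B0) F"
  unfolding matrix_matrix_mult_def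
  by (intro tendsto_vec_lambda tendsto_sum tendsto_mult tendsto_vec_nth assms)

lemma tendsto_efun:
  assumes "((\<lambda>n. g n (vel1 R v)) \<longlongrightarrow> h (vel1 R v)) F" "((\<lambda>n. g n (vel2 R v)) \<longlongrightarrow> h (vel2 R v)) F"
  shows "((\<lambda>n. efun R v (g n)) \<longlongrightarrow> efun R v h) F"
proof -
  have "diag2 a b = (\<chi> i j. if i = j then if i = 1 then a else b else 0)" for a b
    by (auto simp: diag2_def vec_eq_iff forall_2)
  then have "((\<lambda>n. diag2 (g n (vel1 R v)) (g n (vel2 R v))) \<longlongrightarrow> diag2 (h (vel1 R v)) (h (vel2 R v))) F"
    using assms by (auto intro!: tendsto_vec_lambda)
  then show ?thesis
    unfolding efun_def turned_def by (intro tendsto_mat2_mult tendsto_const)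
qed

lemma tendsto_top:
  assumes "net R" "v \<in> edges R" "(s \<longlongrightarrow> s0) F" "((\<lambda>n. p n v) \<longlongrightarrow> p0 v) F" "((\<lambda>n. f n v) \<longlongrightarrow> f0 v) F"
  shows "((\<lambda>n. top_value R (s n) (p n) (f n) v) \<longlongrightarrow> top_value R s0 p0 f0 v) F"
    and "((\<lambda>n. top_force R (s n) (p n) (f n) v) \<longlongrightarrow> top_force R s0 p0 f0 v) F"
  unfolding top_value_def top_force_def using net_pos[OF assms(1,2)]
  by (intro tendsto_add tendsto_mat2_vec tendsto_efun tendsto_tc tendsto_ts tendsto_tz assms; simp)+

lemma tendsto_ext_force:
  assumes "net R" "v \<in> edges R" "(s \<longlongrightarrow> s0) F"
    "\<And>v. v \<in> edges R \<Longrightarrow> ((\<lambda>n. p n v) \<longlongrightarrow> p0 v) F" "\<And>v. v \<in> edges R \<Longrightarrow> ((\<lambda>n. f n v) \<longlongrightarrow> f0 v) F"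
  shows "((\<lambda>n. ext_force R (s n) (p n) (f n) v) \<longlongrightarrow> ext_force R s0 p0 f0 v) F"
  unfolding ext_force_def
  by (intro tendsto_diff tendsto_sum tendsto_top assms) (use assms(2) in \<open>auto simp: children_def\<close>)

lemma tendsto_sol:
  fixes s :: "nat \<Rightarrow> complex"
  assumes "net R" "s \<longlonglongrightarrow> s0"
    "\<And>v. v \<in> edges R \<Longrightarrow> (\<lambda>n. p n v) \<longlonglongrightarrow> p0 v" "\<And>v. v \<in> edges R \<Longrightarrow> (\<lambda>n. f n v) \<longlonglongrightarrow> f0 v"
    and "\<And>n. sol R B (s n) (p n) (f n)"
  shows "sol R B s0 p0 f0"
  unfolding sol_def
proof (intro conjI ballI)
  fix v assume v: "v \<in> edges R"
  have 1: "(\<lambda>n. top_value R (s n) (p n) (f n) v) \<longlonglongrightarrow> top_value R s0 p0 f0 v"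
    by (intro tendsto_top assms v)
  have 2: "(\<lambda>n. if parent R v = base R then 0 else p n (parent R v)) \<longlonglongrightarrow>
      (if parent R v = base R then 0 else p0 (parent R v))"
    using assms(3) net_parent[OF assms(1) v] by auto
  show "top_value R s0 p0 f0 v = (if parent R v = base R then 0 else p0 (parent R v))"
    by (rule LIMSEQ_unique[OF 1]) (use 2 assms(5) v in \<open>simp add: sol_def cong: if_cong\<close>)
next
  fix v assume v: "v \<in> edges R - B"
  have 1: "(\<lambda>n. ext_force R (s n) (p n) (f n) v) \<longlonglongrightarrow> ext_force R s0 p0 f0 v"
    by (intro tendsto_ext_force assms) (use v in auto)
  show "ext_force R s0 p0 f0 v = 0"
    by (rule LIMSEQ_unique[OF 1]) (use assms(5) v in \<open>simp add: sol_def\<close>)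
qed

lemma bounded_family_subseq:
  fixes X :: "nat \<Rightarrow> 'i \<Rightarrow> 'b::heine_borel"
  assumes "finite I" "\<And>i. i \<in> I \<Longrightarrow> bounded (range (\<lambda>n. X n i))"
  shows "\<exists>r L. strict_mono (r::nat\<Rightarrow>nat) \<and> (\<forall>i\<in>I. (\<lambda>n. X (r n) i) \<longlonglongrightarrow> L i)"
  using assms
proof (induction I)
  case empty
  then show ?case
    using strict_mono_id by blast
next
  case (insert i I)
  then obtain r L where r: "strict_mono r" "\<And>j. j \<in> I \<Longrightarrow> (\<lambda>n. X (r n) j) \<longlonglongrightarrow> L j"
    by auto
  have "bounded (range (\<lambda>n. X (r n) i))"
    by (rule bounded_subset[OF insert.prems[of i]]) auto
  then obtain l q where q: "strict_mono q" "((\<lambda>n. X (r n) i) \<circ> q) \<longlonglongrightarrow> l"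
    using bounded_imp_convergent_subsequence by blast
  have "(\<lambda>n. X ((r \<circ> q) n) j) \<longlonglongrightarrow> (L(i := l)) j" if "j \<in> insert i I" for j
    using that q(2) LIMSEQ_subseq_LIMSEQ[OF r(2) q(1)] insert.hyps
    by (auto simp: o_def)
  then show ?case
    using strict_mono_o[OF r(1) q(1)] by blast
qed

text \<open>
  The boundary data are not known to depend continuously on \<open>s\<close>; instead the solutions at \<open>s n\<close>
  are normalised and a limit of a subsequence is identified by uniqueness.
\<close>

lemma same_data_limit:
  fixes s :: "nat \<Rightarrow> complex"
  assumes R: "net R" "leaves R \<subseteq> B" "B \<subseteq> edges R"
    and R': "net R'" "leaves R' \<subseteq> B'" "B' \<subseteq> edges R'"
    and \<phi>: "\<phi> ` B = B'"
    and s: "s \<longlonglongrightarrow> s0" "\<And>n. Re ((s n)\<^sup>2) \<ge> 0" "\<And>n. same_data R B R' B' \<phi> Q H (s n)"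
  shows "same_data R B R' B' \<phi> Q H s0"
proof -
  have s0: "Re (s0\<^sup>2) \<ge> 0"
  proof (rule LIMSEQ_le_const)
    show "(\<lambda>n. Re ((s n)\<^sup>2)) \<longlonglongrightarrow> Re (s0\<^sup>2)"
      using s(1) by (intro tendsto_intros)
  qed (use s(2) in auto)
  show ?thesis
    unfolding same_data_def
  proof (intro allI impI)
    fix p f assume pf: "sol R B s0 p f"
    have "\<forall>n. \<exists>q g q' g'. sol R B (s n) q g \<and> (\<forall>v\<in>B. q v = p v) \<and> sol R' B' (s n) q' g' \<and>
       (\<forall>j\<in>B. q' (\<phi> j) = Q j *v q j \<and> ext_force R' (s n) q' g' (\<phi> j) = H j *v ext_force R (s n) q g j)"
      using dirichlet_exists[OF R(1) s(2) R(2,3)] s(3) unfolding same_data_def by blast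
    then obtain q g q' g' where q: "\<And>n. sol R B (s n) (q n) (g n)" "\<And>n v. v \<in> B \<Longrightarrow> q n v = p v"
      and q': "\<And>n. sol R' B' (s n) (q' n) (g' n)"
        "\<And>n j. j \<in> B \<Longrightarrow> q' n (\<phi> j) = Q j *v q n j"
        "\<And>n j. j \<in> B \<Longrightarrow> ext_force R' (s n) (q' n) (g' n) (\<phi> j) = H j *v ext_force R (s n) (q n) (g n) j"
      by metis
    \<comment> \<open>After division by M the summand 1 becomes c; its limit L0 is the factor by
      which the prescribed boundary values survive in the limit, and all weights still add up to
      1.\<close>
    define M where "M n = 1 + (\<Sum>v\<in>edges R. norm (q n v) + norm (g n v)) +
      (\<Sum>v\<in>edges R'. norm (q' n v) + norm (g' n v))" for n
    define c where "c n = 1 / M n" for n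
    define X where "X n i = (case i of Inl v \<Rightarrow> (c n *\<^sub>R q n v, c n *\<^sub>R g n v) | Inr v \<Rightarrow> (c n *\<^sub>R q' n v, c n *\<^sub>R g' n v))"
      for n and i :: "'a + 'b"
    have fin: "finite (edges R)" "finite (edges R')"
      using R R' by auto
    have M: "M n \<ge> 1" "v \<in> edges R \<Longrightarrow> norm (q n v) + norm (g n v) \<le> M n"
      "w \<in> edges R' \<Longrightarrow> norm (q' n w) + norm (g' n w) \<le> M n" for n v w
      using fin member_le_sum[of v "edges R" "\<lambda>v. norm (q n v) + norm (g n v)"]
        member_le_sum[of w "edges R'" "\<lambda>v. norm (q' n v) + norm (g' n v)"]
        sum_nonneg[of "edges R" "\<lambda>v. norm (q n v) + norm (g n v)"]
        sum_nonneg[of "edges R'" "\<lambda>v. norm (q' n v) + norm (g' n v)"]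
      by (simp_all add: M_def)
    have c: "c n \<ge> 0" "c n \<le> 1" "c n > 0" for n
      using M(1)[of n] by (simp_all add: c_def)
    have X1: "norm (X n i) \<le> 1" if "i \<in> Inl ` edges R \<union> Inr ` edges R'" for n i
    proof -
      have "norm (X n i) \<le> c n * M n"
      proof -
        have "norm (c n *\<^sub>R (x::complex^2), c n *\<^sub>R (y::complex^2)) \<le> c n * M n" if "norm x + norm y \<le> M n" for x y
          using norm_Pair_le[of "c n *\<^sub>R x" "c n *\<^sub>R y"] mult_left_mono[OF that c(1)[of n]] c(1)[of n]
          by (simp add: algebra_simps)
        then show ?thesis
          using that M by (auto simp: X_def)
      qed
      then show ?thesis
        using M(1)[of n] by (simp add: c_def)
    qed
    have "bounded (range (\<lambda>n. c n))"
      using c by (auto simp: bounded_iff intro!: exI[of _ 1])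
    then obtain L0 r0 where r0: "strict_mono (r0::nat\<Rightarrow>nat)" "(\<lambda>n. c (r0 n)) \<longlonglongrightarrow> L0"
      using bounded_imp_convergent_subsequence[of c] by (auto simp: o_def)
    have "\<exists>r L. strict_mono (r::nat\<Rightarrow>nat) \<and>
        (\<forall>i\<in>Inl ` edges R \<union> Inr ` edges R'. (\<lambda>n. X (r0 (r n)) i) \<longlonglongrightarrow> L i)"
      by (rule bounded_family_subseq[of _ "\<lambda>n. X (r0 n)"])
        (use fin X1 in \<open>auto simp: bounded_iff intro!: exI[of _ "1::real"]\<close>)
    then obtain r1 L where r1: "strict_mono (r1::nat\<Rightarrow>nat)"
      and L: "\<And>i. i \<in> Inl ` edges R \<union> Inr ` edges R' \<Longrightarrow> (\<lambda>n. X (r0 (r1 n)) i) \<longlonglongrightarrow> L i"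
      by blast
    define r where "r n = r0 (r1 n)" for n
    have r: "strict_mono r"
      using strict_mono_o[OF r0(1) r1] by (simp add: r_def[abs_def] o_def)
    define p0 f0 p0' f0' where d0: "p0 v = fst (L (Inl v))" "f0 v = snd (L (Inl v))"
      "p0' w = fst (L (Inr w))" "f0' w = snd (L (Inr w))" for v w
    have lim0: "(\<lambda>n. c (r n)) \<longlonglongrightarrow> L0"
      using LIMSEQ_subseq_LIMSEQ[OF r0(2) r1] by (simp add: o_def r_def)
    have lim: "(\<lambda>n. c (r n) *\<^sub>R q (r n) v) \<longlonglongrightarrow> p0 v" "(\<lambda>n. c (r n) *\<^sub>R g (r n) v) \<longlonglongrightarrow> f0 v"
      if "v \<in> edges R" for v
      using tendsto_fst[OF L[of "Inl v"]] tendsto_snd[OF L[of "Inl v"]] that by (auto simp: X_def d0 r_def)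
    have lim': "(\<lambda>n. c (r n) *\<^sub>R q' (r n) v) \<longlonglongrightarrow> p0' v" "(\<lambda>n. c (r n) *\<^sub>R g' (r n) v) \<longlonglongrightarrow> f0' v"
      if "v \<in> edges R'" for v
      using tendsto_fst[OF L[of "Inr v"]] tendsto_snd[OF L[of "Inr v"]] that by (auto simp: X_def d0 r_def)
    have ls: "(\<lambda>n. s (r n)) \<longlonglongrightarrow> s0"
      using LIMSEQ_subseq_LIMSEQ[OF s(1) r] by (simp add: o_def)
    have sc: "sol R B (s n) (\<lambda>v. c n *\<^sub>R q n v) (\<lambda>v. c n *\<^sub>R g n v)"
      "sol R' B' (s n) (\<lambda>v. c n *\<^sub>R q' n v) (\<lambda>v. c n *\<^sub>R g' n v)" for n
      unfolding scaleR_vec by (intro sol_scale q q')+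
    have S: "sol R B s0 p0 f0"
      by (rule tendsto_sol[OF R(1) ls lim sc(1)])
    have S': "sol R' B' s0 p0' f0'"
      by (rule tendsto_sol[OF R'(1) ls lim' sc(2)])
    have \<phi>e: "\<phi> j \<in> edges R'" and Be: "j \<in> edges R" if "j \<in> B" for j
      using that \<phi> R(3) R'(3) by blast+
    have p0: "p0 v = L0 *\<^sub>R p v" if "v \<in> B" for v
    proof (rule LIMSEQ_unique[OF lim(1)[OF Be[OF that]]])
      show "(\<lambda>n. c (r n) *\<^sub>R q (r n) v) \<longlonglongrightarrow> L0 *\<^sub>R p v"
        unfolding q(2)[OF that] by (intro tendsto_intros lim0)
    qed
    have p0': "p0' (\<phi> j) = Q j *v p0 j" if j: "j \<in> B" for j
    proof (rule LIMSEQ_unique[OF lim'(1)])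
      show "\<phi> j \<in> edges R'"
        by (rule \<phi>e[OF j])
      have eq: "c (r n) *\<^sub>R q' (r n) (\<phi> j) = Q j *v (c (r n) *\<^sub>R q (r n) j)" for n
        unfolding scaleR_vec q'(2)[OF j] vector_scalar_commute ..
      show "(\<lambda>n. c (r n) *\<^sub>R q' (r n) (\<phi> j)) \<longlonglongrightarrow> Q j *v p0 j"
        unfolding eq by (rule tendsto_mat2_vec[OF tendsto_const lim(1)[OF Be[OF j]]])
    qed
    have F0: "ext_force R' s0 p0' f0' (\<phi> j) = H j *v ext_force R s0 p0 f0 j" if j: "j \<in> B" for j
    proof -
      have a: "(\<lambda>n. ext_force R' (s (r n)) (\<lambda>v. c (r n) *\<^sub>R q' (r n) v) (\<lambda>v. c (r n) *\<^sub>R g' (r n) v) (\<phi> j))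
          \<longlonglongrightarrow> ext_force R' s0 p0' f0' (\<phi> j)"
        by (rule tendsto_ext_force[OF R'(1) \<phi>e[OF j] ls lim'])
      have 1: "(\<lambda>n. ext_force R (s (r n)) (\<lambda>v. c (r n) *\<^sub>R q (r n) v) (\<lambda>v. c (r n) *\<^sub>R g (r n) v) j)
          \<longlonglongrightarrow> ext_force R s0 p0 f0 j"
        by (rule tendsto_ext_force[OF R(1) Be[OF j] ls lim])
      have eq: "ext_force R' (s (r n)) (\<lambda>v. c (r n) *\<^sub>R q' (r n) v) (\<lambda>v. c (r n) *\<^sub>R g' (r n) v) (\<phi> j) =
          H j *v ext_force R (s (r n)) (\<lambda>v. c (r n) *\<^sub>R q (r n) v) (\<lambda>v. c (r n) *\<^sub>R g (r n) v) j" for n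
        unfolding scaleR_vec ext_force_scale q'(3)[OF j] vector_scalar_commute ..
      have b: "(\<lambda>n. ext_force R' (s (r n)) (\<lambda>v. c (r n) *\<^sub>R q' (r n) v) (\<lambda>v. c (r n) *\<^sub>R g' (r n) v) (\<phi> j))
          \<longlonglongrightarrow> H j *v ext_force R s0 p0 f0 j"
        unfolding eq by (rule tendsto_mat2_vec[OF tendsto_const 1])
      show ?thesis
        by (rule LIMSEQ_unique[OF a b])
    qed
    have one: "L0 + (\<Sum>v\<in>edges R. norm (p0 v) + norm (f0 v)) + (\<Sum>v\<in>edges R'. norm (p0' v) + norm (f0' v)) = 1"
    proof -
      have a: "(\<lambda>n. c (r n) + (\<Sum>v\<in>edges R. norm (c (r n) *\<^sub>R q (r n) v) + norm (c (r n) *\<^sub>R g (r n) v)) +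
          (\<Sum>v\<in>edges R'. norm (c (r n) *\<^sub>R q' (r n) v) + norm (c (r n) *\<^sub>R g' (r n) v))) \<longlonglongrightarrow>
        L0 + (\<Sum>v\<in>edges R. norm (p0 v) + norm (f0 v)) + (\<Sum>v\<in>edges R'. norm (p0' v) + norm (f0' v))"
        by (rule tendsto_add[OF tendsto_add[OF lim0 tendsto_sum] tendsto_sum])
          (rule tendsto_add[OF tendsto_norm tendsto_norm], (erule lim lim')+)+
      have "c n + (\<Sum>v\<in>edges R. norm (c n *\<^sub>R q n v) + norm (c n *\<^sub>R g n v)) +
          (\<Sum>v\<in>edges R'. norm (c n *\<^sub>R q' n v) + norm (c n *\<^sub>R g' n v)) = c n * M n" for n
        using c(1)[of n] by (simp add: M_def sum_distrib_left sum.distrib distrib_left)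
      also have "c n * M n = 1" for n
        using M(1)[of n] by (simp add: c_def)
      finally have b: "(\<lambda>n. c (r n) + (\<Sum>v\<in>edges R. norm (c (r n) *\<^sub>R q (r n) v) + norm (c (r n) *\<^sub>R g (r n) v)) +
          (\<Sum>v\<in>edges R'. norm (c (r n) *\<^sub>R q' (r n) v) + norm (c (r n) *\<^sub>R g' (r n) v))) \<longlonglongrightarrow> 1"
        by simp
      show ?thesis
        by (rule LIMSEQ_unique[OF a b])
    qed
    \<comment> \<open>For L0 = 0 both limit solutions would have zero boundary values and vanish by
      uniqueness, against the total weight 1.\<close>
    have L0: "L0 \<noteq> 0"
    proof
      assume 0: "L0 = 0"
      have z: "p0 v = 0" "f0 v = 0" if "v \<in> edges R" for v
        using sol_zero[OF R s0 S _ that] p0 0 by auto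
      have "p0' v = 0" if "v \<in> B'" for v
        using that p0' z(1) Be unfolding \<phi>[symmetric] by auto
      then have "p0' w = 0" "f0' w = 0" if "w \<in> edges R'" for w
        using sol_zero[OF R' s0 S' _ that] by auto
      with z one 0 show False
        by simp
    qed
    \<comment> \<open>Undoing the scaling gives a limit with the boundary values of p; by uniqueness
      it has the forces of the given solution.\<close>
    define k where "k = complex_of_real (inverse L0)"
    have k: "k *s (L0 *\<^sub>R x) = x" for x :: "complex^2"
      using L0 by (simp add: k_def scaleR_vec vec_eq_iff)
    have Sk: "sol R B s0 (\<lambda>v. k *s p0 v) (\<lambda>v. k *s f0 v)"
      by (intro sol_scale S)
    have kp: "k *s p0 v = p v" if "v \<in> B" for v
      using p0[OF that] k by simp
    have ef: "ext_force R s0 (\<lambda>v. k *s p0 v) (\<lambda>v. k *s f0 v) j = ext_force R s0 p f j" if "j \<in> B" for j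
      by (rule sol_unique_force[OF R s0 Sk pf kp Be[OF that]])
    show "\<exists>p' f'. sol R' B' s0 p' f' \<and>
        (\<forall>j\<in>B. p' (\<phi> j) = Q j *v p j \<and> ext_force R' s0 p' f' (\<phi> j) = H j *v ext_force R s0 p f j)"
    proof (intro exI conjI ballI)
      show "sol R' B' s0 (\<lambda>v. k *s p0' v) (\<lambda>v. k *s f0' v)"
        by (intro sol_scale S')
      fix j assume j: "j \<in> B"
      show "k *s p0' (\<phi> j) = Q j *v p j"
        unfolding p0'[OF j] kp[OF j, symmetric] vector_scalar_commute ..
      show "ext_force R' s0 (\<lambda>v. k *s p0' v) (\<lambda>v. k *s f0' v) (\<phi> j) = H j *v ext_force R s0 p f j"
        unfolding ef[OF j, symmetric] ext_force_scale F0[OF j] vector_scalar_commute ..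
    qed
  qed
qed

section \<open>High-frequency asymptotics at a leaf\<close>

text \<open>\<open>\<gamma>\<close> and \<open>p - \<gamma>\<close> are the amplitudes of the modes
  that grow and decay away from the first end; the flux at the other end contains no mixed
  term.\<close>

lemma channel_reflection:
  fixes p f :: complex
  assumes "k > 0" "t > 0"
  defines "\<gamma> \<equiv> (p + f / of_real (t * k)) / 2"
  shows "(tc (of_real t) l k * p + ts (of_real t) l k * f) \<bullet> (tz (of_real t) l k * p + tc (of_real t) l k * f) =
    t * (k * (exp (2 * (t * l / k)) * (norm \<gamma>)\<^sup>2 - exp (- 2 * (t * l / k)) * (norm (p - \<gamma>))\<^sup>2))"
proof -
  define x where "x = exp (t * l / k)"
  define \<alpha> where "\<alpha> = p - \<gamma>"
  have x: "x > 0"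
    by (simp add: x_def)
  have pf: "p = \<alpha> + \<gamma>" "f = of_real (t * k) * (\<gamma> - \<alpha>)"
    using assms(1,2) by (simp_all add: \<alpha>_def \<gamma>_def field_simps)
  have C: "tc (of_real t) l k = of_real ((x + inverse x) / 2)"
    and Sh: "sinh (of_real t * of_real l / of_real k :: complex) = of_real ((x - inverse x) / 2)"
    by (simp_all add: tc_def x_def cosh_field_def sinh_field_def exp_minus flip: exp_of_real)
  have tsf: "ts (of_real t) l k * f = sinh (of_real t * of_real l / of_real k) * (\<gamma> - \<alpha>)"
    using assms(1,2) by (simp add: ts_def pf)
  have half: "(y + z) / 2 * (\<alpha> + \<gamma>) + (y - z) / 2 * (\<gamma> - \<alpha>) = y * \<gamma> + z * \<alpha>"
    "(y - z) / 2 * (\<alpha> + \<gamma>) + (y + z) / 2 * (\<gamma> - \<alpha>) = y * \<gamma> - z * \<alpha>" for y z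
    by (simp_all add: field_simps)
  have P: "tc (of_real t) l k * p + ts (of_real t) l k * f = of_real x * \<gamma> + of_real (inverse x) * \<alpha>"
    unfolding C tsf Sh using half(1)[of "of_real x" "of_real (inverse x)"] pf(1) by simp
  have F: "tz (of_real t) l k * p + tc (of_real t) l k * f = of_real (t * k) * (of_real x * \<gamma> - of_real (inverse x) * \<alpha>)"
  proof -
    have "of_real t * of_real k * y * (\<alpha> + \<gamma>) + z * (of_real (t * k) * (\<gamma> - \<alpha>)) =
        of_real (t * k) * (y * (\<alpha> + \<gamma>) + z * (\<gamma> - \<alpha>))" for y z
      by (simp add: algebra_simps)
    then show ?thesis
      unfolding C tz_def Sh pf(2) using half(2)[of "of_real x" "of_real (inverse x)"]
      by (subst pf(1)) (simp only: of_real_divide of_real_add of_real_diff of_real_numeral)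
  qed
  have "(of_real x * \<gamma> + of_real y * \<alpha>) \<bullet> (of_real (t * k) * (of_real x * \<gamma> - of_real y * \<alpha>)) =
      t * k * (x\<^sup>2 * (norm \<gamma>)\<^sup>2 - y\<^sup>2 * (norm \<alpha>)\<^sup>2)" for y
    unfolding cmod_power2 inner_complex_def by (simp add: algebra_simps power2_eq_square)
  moreover have "x\<^sup>2 = exp (2 * (t * l / k))" "(inverse x)\<^sup>2 = exp (- 2 * (t * l / k))"
    by (simp_all add: x_def exp_double[symmetric] exp_minus[symmetric])
  ultimately show ?thesis
    unfolding P F by (simp only: \<alpha>_def mult.assoc)
qed

text \<open>A flux that is not positive at the upper end bounds the growing modes by the decaying
  ones times a factor that is exponentially small in the frequency. In the limit the edge behaves
  like a half-infinite one, with force \<open>- t k p\<close> in each channel.\<close>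

lemma edge_no_reflection:
  fixes f :: "nat \<Rightarrow> 'a \<Rightarrow> complex^2"
  assumes "net R" "v \<in> edges R"
    and "\<And>n. top_value R (of_nat (Suc n)) p (f n) v \<bullet> top_force R (of_nat (Suc n)) p (f n) v \<le> 0"
  shows "(\<lambda>n. f n v /\<^sub>R real (Suc n)) \<longlonglongrightarrow> - (efun R v of_real *v p v)"
proof -
  note pos = net_pos[OF assms(1,2)]
  define a b l where abl: "a = vel1 R v" "b = vel2 R v" "l = elen R v"
  have ab: "a > 0" "b > 0" "l > 0"
    using pos by (auto simp: abl)
  define x where "x = rot (- frame R v) *v p v"
  define y where "y n = rot (- frame R v) *v f n v" for n
  define t where "t n = real (Suc n)" for n
  have t: "t n > 0" "of_nat (Suc n) = complex_of_real (t n)" for n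
    by (simp_all add: t_def)
  define g1 where "g1 n = (x $ 1 + y n $ 1 / of_real (t n * a)) / 2" for n
  define g2 where "g2 n = (x $ 2 + y n $ 2 / of_real (t n * b)) / 2" for n
  \<comment> \<open>The travel time of the faster channel, so that one exponential
    \<open>q n\<close> estimates both channels.\<close>
  define \<delta> where "\<delta> = min (l / a) (l / b)"
  have \<delta>: "\<delta> > 0" "\<delta> \<le> l / a" "\<delta> \<le> l / b"
    using ab by (auto simp: \<delta>_def)
  define q where "q n = exp (- 2 * (t n * \<delta>))" for n
  define W where "W n = a * (norm (g1 n))\<^sup>2 + b * (norm (g2 n))\<^sup>2" for n
  define P where "P = a * (norm (x $ 1))\<^sup>2 + b * (norm (x $ 2))\<^sup>2"
  have PW: "P \<ge> 0" "W n \<ge> 0" for n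
    using ab by (simp_all add: P_def W_def)
  have q: "q n > 0" for n
    by (simp add: q_def)
  have main: "W n \<le> (q n)\<^sup>2 * (2 * P + 2 * W n)" for n
  proof -
    have "top_value R (of_real (t n)) p (f n) v \<bullet> top_force R (of_real (t n)) p (f n) v =
      (tc (of_real (t n)) l a * x $ 1 + ts (of_real (t n)) l a * y n $ 1) \<bullet>
      (tz (of_real (t n)) l a * x $ 1 + tc (of_real (t n)) l a * y n $ 1) +
      (tc (of_real (t n)) l b * x $ 2 + ts (of_real (t n)) l b * y n $ 2) \<bullet>
      (tz (of_real (t n)) l b * x $ 2 + tc (of_real (t n)) l b * y n $ 2)"
      unfolding top_value_def top_force_def efun_def abl by (rule inner_turned) (simp_all add: x_def y_def)
    also have "\<dots> = t n * ((a * (exp (2 * (t n * l / a)) * (norm (g1 n))\<^sup>2 - exp (- 2 * (t n * l / a)) * (norm (x $ 1 - g1 n))\<^sup>2)) +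
       (b * (exp (2 * (t n * l / b)) * (norm (g2 n))\<^sup>2 - exp (- 2 * (t n * l / b)) * (norm (x $ 2 - g2 n))\<^sup>2)))"
      unfolding g1_def g2_def using channel_reflection ab t by (simp only: distrib_left)
    finally have 0: "a * (exp (2 * (t n * l / a)) * (norm (g1 n))\<^sup>2 - exp (- 2 * (t n * l / a)) * (norm (x $ 1 - g1 n))\<^sup>2) +
       b * (exp (2 * (t n * l / b)) * (norm (g2 n))\<^sup>2 - exp (- 2 * (t n * l / b)) * (norm (x $ 2 - g2 n))\<^sup>2) \<le> 0"
      using assms(3)[of n] t(1)[of n] unfolding t(2) by (simp add: mult_le_0_iff)
    have e: "inverse (q n) \<le> exp (2 * (t n * l / k))" "exp (- 2 * (t n * l / k)) \<le> q n" if "\<delta> \<le> l / k" for k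
      using mult_left_mono[OF that, of "t n"] t(1)[of n] by (simp_all add: q_def flip: exp_minus)
    have n2: "(norm (z - w))\<^sup>2 \<le> 2 * (norm z)\<^sup>2 + 2 * (norm w)\<^sup>2" for z w :: complex
      unfolding cmod_power2 using sum_squares_bound[of "- Re z" "Re w"] sum_squares_bound[of "- Im z" "Im w"]
      by (simp add: algebra_simps power2_eq_square)
    have ch: "k * (inverse (q n) * (norm w)\<^sup>2 - q n * (2 * (norm z)\<^sup>2 + 2 * (norm w)\<^sup>2)) \<le>
        k * (exp (2 * (t n * l / k)) * (norm w)\<^sup>2 - exp (- 2 * (t n * l / k)) * (norm (z - w))\<^sup>2)"
      if "\<delta> \<le> l / k" "k > 0" for k and z w :: complex
    proof -
      have "inverse (q n) * (norm w)\<^sup>2 \<le> exp (2 * (t n * l / k)) * (norm w)\<^sup>2"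
        by (rule mult_right_mono) (use e[OF that(1)] in auto)
      moreover have "exp (- 2 * (t n * l / k)) * (norm (z - w))\<^sup>2 \<le> q n * (2 * (norm z)\<^sup>2 + 2 * (norm w)\<^sup>2)"
        by (rule mult_mono) (use e[OF that(1)] q[of n] n2 in auto)
      ultimately show ?thesis
        using that(2) by (intro mult_left_mono) auto
    qed
    have "a * (inverse (q n) * (norm (g1 n))\<^sup>2 - q n * (2 * (norm (x $ 1))\<^sup>2 + 2 * (norm (g1 n))\<^sup>2)) +
        b * (inverse (q n) * (norm (g2 n))\<^sup>2 - q n * (2 * (norm (x $ 2))\<^sup>2 + 2 * (norm (g2 n))\<^sup>2)) \<le> 0"
      using ch[OF \<delta>(2) ab(1), of "g1 n" "x $ 1"] ch[OF \<delta>(3) ab(2), of "g2 n" "x $ 2"] 0 by linarith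
    then have "inverse (q n) * W n \<le> q n * (2 * P + 2 * W n)"
      by (simp add: W_def P_def algebra_simps)
    then have "q n * (inverse (q n) * W n) \<le> q n * (q n * (2 * P + 2 * W n))"
      using q[of n] by (intro mult_left_mono) auto
    then show ?thesis
      using q[of n] by (simp add: power2_eq_square mult.assoc flip: mult.assoc)
  qed
  have "(\<lambda>n. exp (- 2 * (t n * \<delta>))) \<longlonglongrightarrow> 0"
    unfolding t_def using \<delta>(1) by real_asymp
  then have q0: "q \<longlonglongrightarrow> 0"
    by (simp add: q_def[abs_def])
  then have q2: "(\<lambda>n. (q n)\<^sup>2) \<longlonglongrightarrow> 0"
    using tendsto_power[of q 0 sequentially 2] by simp
  \<comment> \<open>Then the term with W on the right of \<open>main\<close> is at most half of W
    and is absorbed on the left.\<close>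
  have "eventually (\<lambda>n. (q n)\<^sup>2 < 1 / 4) sequentially"
    using order_tendstoD(2)[OF q2, of "1 / 4"] by simp
  then have "eventually (\<lambda>n. W n \<le> 4 * (q n)\<^sup>2 * P) sequentially"
  proof eventually_elim
    case (elim n)
    have "(q n)\<^sup>2 * (2 * W n) \<le> 1 / 4 * (2 * W n)"
      using elim PW by (intro mult_right_mono) auto
    then show ?case
      using main[of n] by (simp add: algebra_simps)
  qed
  moreover have "(\<lambda>n. 4 * (q n)\<^sup>2 * P) \<longlonglongrightarrow> 0"
    using tendsto_mult[OF tendsto_mult[OF tendsto_const[of 4] q2] tendsto_const[of P]] by simp
  ultimately have W: "W \<longlonglongrightarrow> 0"
    using PW by (intro tendsto_sandwich[of "\<lambda>_. 0" W _ "\<lambda>n. 4 * (q n)\<^sup>2 * P"]) auto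
  have sq: "g \<longlonglongrightarrow> 0" if "k > 0" "\<And>n. k * (norm (g n))\<^sup>2 \<le> W n" for g :: "nat \<Rightarrow> complex" and k
  proof -
    have "(\<lambda>n. k * (norm (g n))\<^sup>2) \<longlonglongrightarrow> 0"
      using that by (intro tendsto_sandwich[OF _ _ tendsto_const W]) auto
    from tendsto_mult[OF tendsto_const[of "inverse k"] this]
    have "(\<lambda>n. (norm (g n))\<^sup>2) \<longlonglongrightarrow> 0"
      using that(1) by (simp flip: mult.assoc)
    from tendsto_real_sqrt[OF this] show ?thesis
      by (simp add: tendsto_norm_zero_iff)
  qed
  have g: "g1 \<longlonglongrightarrow> 0" "g2 \<longlonglongrightarrow> 0"
    using sq[of a g1] sq[of b g2] ab by (auto simp: W_def)
  have y: "y n /\<^sub>R t n = diag2 (of_real a) (of_real b) *v (vector [2 * g1 n, 2 * g2 n] - x)" for n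
    using ab t(1)[of n] unfolding scaleR_vec
    by (simp add: g1_def g2_def diag2_def mat2_simps field_simps)
  have "f n v /\<^sub>R t n = rot (frame R v) *v (y n /\<^sub>R t n)" for n
    by (simp add: y_def scaleR_vec vector_scalar_commute[symmetric])
  then have f: "f n v /\<^sub>R t n = rot (frame R v) *v (diag2 (of_real a) (of_real b) *v (vector [2 * g1 n, 2 * g2 n] - x))" for n
    unfolding y .
  have v0: "(\<lambda>n. vector [2 * g1 n, 2 * g2 n] :: complex^2) \<longlonglongrightarrow> 0"
  proof (rule vec_tendstoI)
    fix i :: 2
    show "(\<lambda>n. (vector [2 * g1 n, 2 * g2 n] :: complex^2) $ i) \<longlonglongrightarrow> 0 $ i"
      using tendsto_mult[OF tendsto_const[of 2] g(1)] tendsto_mult[OF tendsto_const[of 2] g(2)]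
      by (cases i rule: exhaust_2[THEN disjE]) auto
  qed
  have "(\<lambda>n. rot (frame R v) *v (diag2 (of_real a) (of_real b) *v (vector [2 * g1 n, 2 * g2 n] - x))) \<longlonglongrightarrow>
      rot (frame R v) *v (diag2 (of_real a) (of_real b) *v (0 - x))"
    by (intro tendsto_mat2_vec tendsto_const tendsto_diff v0)
  moreover have "rot (frame R v) *v (diag2 (of_real a) (of_real b) *v (0 - x)) = - (efun R v of_real *v p v)"
    by (simp add: efun_def turned_def x_def abl vec.neg flip: matrix_vector_mul_assoc)
  ultimately show ?thesis
    unfolding f[symmetric] by (simp add: t_def)
qed

text \<open>Only the leaf \<open>i\<close> moves, so the total gain of flux over all edges is
  \<open>- (a \<bullet> f n i)\<close>. The gain on the edge of \<open>i\<close> is a part of it,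
  and therefore the flux at the top of that edge is not positive.\<close>

lemma leaf_asymptotics:
  assumes "net R" "leaves R \<subseteq> B" "B \<subseteq> edges R" "i \<in> leaves R"
    and "\<And>n. sol R B (of_nat (Suc n)) (p n) (f n)"
    and "\<And>n v. v \<in> B \<Longrightarrow> p n v = (if v = i then a else 0)"
  shows "(\<lambda>n. f n i /\<^sub>R real (Suc n)) \<longlonglongrightarrow> - (efun R i of_real *v a)"
proof -
  have i: "i \<in> edges R" "i \<in> B" "children R i = {}"
    using assms(2,4) by (auto simp: leaves_def)
  have fl: "top_value R (of_nat (Suc n)) (\<lambda>_. a) (f n) i \<bullet> top_force R (of_nat (Suc n)) (\<lambda>_. a) (f n) i \<le> 0" for n
  proof -
    define s :: complex where "s = of_nat (Suc n)"
    have s: "Re (s\<^sup>2) \<ge> 0"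
      unfolding s_def of_nat_power[symmetric] by simp
    have pa: "p n i = a"
      using assms(6)[OF i(2)] by simp
    let ?d = "\<lambda>v. top_value R s (p n) (f n) v \<bullet> top_force R s (p n) (f n) v - p n v \<bullet> f n v"
    have fin: "finite B"
      using finite_subset[OF assms(3)] assms(1) by simp
    have "(\<Sum>v\<in>B. p n v \<bullet> ext_force R s (p n) (f n) v) = (\<Sum>v\<in>B. if v = i then a \<bullet> f n i else 0)"
      by (rule sum.cong) (use assms(6) i(3) in \<open>auto simp: ext_force_def\<close>)
    then have "sum ?d (edges R) = - (a \<bullet> f n i)"
      using flux_sum[OF assms(1,3), of s "p n" "f n"] assms(5)[of n] fin i(2) by (simp add: s_def)
    moreover have "?d i \<le> sum ?d (edges R)"
      using edge_flux(1)[OF assms(1) _ s] assms(1) i(1) by (intro member_le_sum) auto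
    ultimately have "top_value R s (p n) (f n) i \<bullet> top_force R s (p n) (f n) i \<le> 0"
      by (simp add: pa)
    then show ?thesis
      using top_cong[of "p n" i "\<lambda>_. a" "f n" "f n" R s] pa by (simp add: s_def)
  qed
  show ?thesis
    using edge_no_reflection[OF assms(1) i(1) fl] by simp
qed

section \<open>Subtrees and unique continuation\<close>

definition subtree :: "'a rooted_net \<Rightarrow> 'a \<Rightarrow> 'a set" where
  "subtree R v = {u \<in> edges R. (u, v) \<in> {(x, parent R x) | x. x \<in> edges R}\<^sup>*}"

definition single_root :: "'a rooted_net \<Rightarrow> bool" where
  "single_root R \<longleftrightarrow> (\<forall>v\<in>children R (base R). \<forall>w\<in>children R (base R). v = w)"

lemma subtree_edges: "u \<in> subtree R v \<Longrightarrow> u \<in> edges R"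
  by (simp add: subtree_def)

lemma subtree_refl [simp]: "v \<in> edges R \<Longrightarrow> v \<in> subtree R v"
  by (simp add: subtree_def)

lemma subtree_parent:
  assumes "u \<in> edges R" "u \<noteq> v" "v \<in> edges R"
  shows "u \<in> subtree R v \<longleftrightarrow> parent R u \<in> subtree R v"
proof
  assume "u \<in> subtree R v"
  then have *: "(u, v) \<in> {(x, parent R x) | x. x \<in> edges R}\<^sup>*"
    by (simp add: subtree_def)
  from this assms(2) obtain y where y: "(u, y) \<in> {(x, parent R x) | x. x \<in> edges R}"
      "(y, v) \<in> {(x, parent R x) | x. x \<in> edges R}\<^sup>*"
    by (auto elim: converse_rtranclE)
  then have "y = parent R u"
    by auto
  moreover have "y \<in> edges R"
    using y(2) assms(3) by (auto elim: converse_rtranclE)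
  ultimately show "parent R u \<in> subtree R v"
    using y by (simp add: subtree_def)
next
  assume "parent R u \<in> subtree R v"
  then show "u \<in> subtree R v"
    using assms(1) by (auto simp: subtree_def intro: converse_rtrancl_into_rtrancl)
qed

lemma subtree_height:
  assumes "\<And>v. v \<in> edges R \<Longrightarrow> h (parent R v) < (h v :: nat)" "u \<in> subtree R v"
  shows "h v \<le> h u"
proof -
  have "(u, v) \<in> {(x, parent R x) | x. x \<in> edges R}\<^sup>*"
    using assms(2) by (simp add: subtree_def)
  then show ?thesis
    by (induction rule: converse_rtrancl_induct) (use assms(1) in fastforce)+
qed

lemma not_in_subtree_child:
  assumes "net R" "w \<in> children R v"
  shows "v \<notin> subtree R w"
proof
  assume v: "v \<in> subtree R w"
  obtain h :: "'a \<Rightarrow> nat" where h: "\<And>v. v \<in> edges R \<Longrightarrow> h (parent R v) < h v"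
    using assms(1) by (auto simp: net_def)
  show False
    using subtree_height[of R h v w] h[of w] h v assms(2) by (fastforce simp: children_def)
qed

lemma parent_notin_subtree: "net R \<Longrightarrow> v \<in> edges R \<Longrightarrow> parent R v \<notin> subtree R v"
  by (rule not_in_subtree_child) (auto simp: children_def)

lemma child_in_subtree: "w \<in> children R v \<Longrightarrow> v \<in> edges R \<Longrightarrow> u \<in> subtree R w \<Longrightarrow> u \<in> subtree R v"
  unfolding subtree_def children_def by (auto intro: rtrancl_into_rtrancl)

lemma subtree_child_exists:
  assumes "u \<in> subtree R v" "u \<noteq> v"
  shows "\<exists>w\<in>children R v. u \<in> subtree R w"
proof -
  have "(u, v) \<in> {(x, parent R x) | x. x \<in> edges R}\<^sup>*"
    using assms(1) by (simp add: subtree_def)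
  then obtain w where "(u, w) \<in> {(x, parent R x) | x. x \<in> edges R}\<^sup>*" "(w, v) \<in> {(x, parent R x) | x. x \<in> edges R}"
    using assms(2) by (auto elim: rtranclE)
  then show ?thesis
    using assms(1) by (auto simp: subtree_def children_def)
qed

lemma subtree_children_disjoint:
  assumes "net R" "w \<in> children R v" "w' \<in> children R v" "u \<in> subtree R w" "u \<in> subtree R w'"
  shows "w = w'"
proof (rule ccontr)
  assume ne: "w \<noteq> w'"
  have w: "w \<in> edges R" "w' \<in> edges R" "parent R w = v" "parent R w' = v"
    using assms(2,3) by (auto simp: children_def)
  have "u \<in> edges R"
    using assms(4) by (rule subtree_edges)
  from assms(1) this assms(4,5) show False
  proof (induction u rule: net_induct_down)
    case (step u)
    have nv: "v \<notin> subtree R w" "v \<notin> subtree R w'"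
      using not_in_subtree_child[OF assms(1)] assms(2,3) by auto
    have "u \<noteq> w"
      using step(4) subtree_parent[of w R w'] ne w nv by auto
    moreover have "u \<noteq> w'"
      using step(3) subtree_parent[of w' R w] ne w nv by auto
    ultimately have "parent R u \<in> subtree R w" "parent R u \<in> subtree R w'"
      using step subtree_parent[of u R] w by auto
    moreover from this have "parent R u \<noteq> base R"
      using subtree_edges base_notin_edges by metis
    ultimately show False
      using step(2) by blast
  qed
qed

lemma leaf_in_subtree:
  assumes "net R" "v \<in> edges R"
  shows "\<exists>j\<in>leaves R. j \<in> subtree R v"
  using assms
proof (induction v rule: net_induct_up)
  case (step v)
  show ?case
  proof (cases "children R v = {}")
    case True
    then show ?thesis
      using step(1) by (auto simp: leaves_def)
  next
    case False
    then obtain w where w: "w \<in> children R v"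
      by blast
    then show ?thesis
      using step(2)[OF w] child_in_subtree[OF w step(1)] by blast
  qed
qed

lemma top_ancestor:
  assumes "net R" "u \<in> edges R"
  shows "\<exists>c\<in>children R (base R). u \<in> subtree R c"
  using assms
proof (induction u rule: net_induct_down)
  case (step u)
  show ?case
  proof (cases "parent R u = base R")
    case True
    then show ?thesis
      using step(1) by (auto simp: children_def)
  next
    case False
    then obtain c where c: "c \<in> children R (base R)" "parent R u \<in> subtree R c"
      using step(2) by blast
    then have "u \<in> subtree R c"
      using subtree_parent[of u R c] step(1) by (cases "u = c") (auto simp: children_def)
    then show ?thesis
      using c by blast
  qed
qed

text \<open>
  If the value vanishes at a vertex, the solution may be replaced by zero on all but one of the
  branches at this vertex: the result solves the equations with a further boundary vertex.
\<close>

lemma vanishing_below: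
  assumes R: "net R" "leaves R \<subseteq> B" "B \<subseteq> edges R" "Re (s\<^sup>2) \<ge> 0" "sol R B s p f"
    and w: "w \<in> children R y" "y \<in> edges R \<Longrightarrow> p y = 0"
    and zero: "\<And>v. v \<in> B \<Longrightarrow> v \<in> subtree R w \<Longrightarrow> p v = 0"
    and u: "u \<in> subtree R w"
  shows "p u = 0" "f u = 0"
proof -
  define p1 where "p1 v = (if v \<in> subtree R w then p v else 0)" for v
  define f1 where "f1 v = (if v \<in> subtree R w then f v else 0)" for v
  have we: "w \<in> edges R" "parent R w = y" "y \<notin> subtree R w"
    using w(1) not_in_subtree_child[OF R(1)] by (auto simp: children_def)
  have sp: "v \<in> subtree R w \<longleftrightarrow> parent R v \<in> subtree R w" if "v \<in> edges R" "v \<noteq> w" for v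
    using subtree_parent[OF that we(1)] .
  have nb: "base R \<notin> subtree R w"
    using subtree_edges base_notin_edges by metis
  have tv: "top_value R s p f w = 0"
    using R(5) we w(2) net_parent[OF R(1) we(1)] by (auto simp: sol_def)
  have S: "sol R (B \<union> ({y} \<inter> edges R)) s p1 f1"
    unfolding sol_def
  proof (intro conjI ballI)
    fix v assume v: "v \<in> edges R"
    show "top_value R s p1 f1 v = (if parent R v = base R then 0 else p1 (parent R v))"
    proof (cases "v \<in> subtree R w")
      case True
      then have 1: "top_value R s p1 f1 v = top_value R s p f v"
        by (intro top_cong) (simp_all add: p1_def f1_def)
      show ?thesis
      proof (cases "v = w")
        case True
        then show ?thesis
          using 1 tv we by (simp add: p1_def)
      next
        case False
        then have "parent R v \<in> subtree R w" "parent R v \<noteq> base R"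
          using sp[OF v] True nb by auto
        then show ?thesis
          using 1 R(5) v by (simp add: sol_def p1_def)
      qed
    next
      case False
      then have "v \<noteq> w"
        using we by auto
      then have "parent R v \<notin> subtree R w"
        using sp[OF v] False by blast
      then show ?thesis
        using False by (simp add: p1_def f1_def top_of_zero)
    qed
  next
    fix v assume v: "v \<in> edges R - (B \<union> ({y} \<inter> edges R))"
    show "ext_force R s p1 f1 v = 0"
    proof (cases "v \<in> subtree R w")
      case True
      have "ext_force R s p1 f1 v = ext_force R s p f v"
      proof (rule ext_force_cong)
        fix x assume "x \<in> children R v"
        then have "x \<in> edges R" "parent R x = v" "x \<noteq> w"
          using we v by (auto simp: children_def)
        then have "x \<in> subtree R w"
          using sp True by simp
        then show "p1 x = p x \<and> f1 x = f x"
          by (simp add: p1_def f1_def)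
      qed (use True in \<open>simp add: f1_def\<close>)
      then show ?thesis
        using R(5) v by (simp add: sol_def)
    next
      case False
      have "top_force R s p1 f1 x = 0" if "x \<in> children R v" for x
      proof -
        have "x \<in> edges R" "parent R x = v" "x \<noteq> w"
          using that we v by (auto simp: children_def)
        then have "x \<notin> subtree R w"
          using sp False by simp
        then show ?thesis
          by (simp add: p1_def f1_def top_of_zero)
      qed
      then show ?thesis
        using False by (simp add: ext_force_def f1_def)
    qed
  qed
  have "p1 v = 0" if "v \<in> B \<union> ({y} \<inter> edges R)" for v
    using that zero we by (auto simp: p1_def)
  from sol_zero[OF R(1) _ _ R(4) S this subtree_edges[OF u]] R(2,3)
  show "p u = 0" "f u = 0"
    using u by (auto simp: p1_def f1_def)
qed

text \<open>The upward branch: everything strictly below \<open>y\<close> is replaced by zero, while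
  \<open>y\<close> keeps its own edge and becomes a boundary vertex at rest. The remaining solution
  has zero boundary values.\<close>

lemma vanishing_above:
  assumes R: "net R" "leaves R \<subseteq> B" "B \<subseteq> edges R" "Re (s\<^sup>2) \<ge> 0" "sol R B s p f"
    and y: "y \<in> edges R" "p y = 0"
    and zero: "\<And>v. v \<in> B \<Longrightarrow> v \<notin> subtree R y \<Longrightarrow> p v = 0"
  shows "f y = 0"
proof -
  let ?K = "\<lambda>v. v \<notin> subtree R y \<or> v = y"
  define p1 where "p1 v = (if ?K v then p v else 0)" for v
  define f1 where "f1 v = (if ?K v then f v else 0)" for v
  have ny: "parent R y \<notin> subtree R y"
    using parent_notin_subtree[OF R(1) y(1)] .
  have sp: "v \<in> subtree R y \<longleftrightarrow> parent R v \<in> subtree R y" if "v \<in> edges R" "v \<noteq> y" for v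
    using subtree_parent[OF that y(1)] .
  have S: "sol R (insert y B) s p1 f1"
    unfolding sol_def
  proof (intro conjI ballI)
    fix v assume v: "v \<in> edges R"
    show "top_value R s p1 f1 v = (if parent R v = base R then 0 else p1 (parent R v))"
    proof (cases "?K v")
      case True
      then have "top_value R s p1 f1 v = top_value R s p f v"
        by (intro top_cong) (simp_all add: p1_def f1_def)
      moreover have "parent R v \<notin> subtree R y"
        using sp[OF v] True ny by auto
      ultimately show ?thesis
        using R(5) v by (simp add: sol_def p1_def)
    next
      case False
      then have "p1 (parent R v) = 0"
        using sp[OF v] y(2) by (auto simp: p1_def)
      then show ?thesis
        using False by (simp add: p1_def f1_def top_of_zero)
    qed
  next
    fix v assume v: "v \<in> edges R - insert y B"
    show "ext_force R s p1 f1 v = 0"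
    proof (cases "?K v")
      case True
      have "ext_force R s p1 f1 v = ext_force R s p f v"
      proof (rule ext_force_cong)
        fix x assume "x \<in> children R v"
        then have "?K x"
          using sp[of x] True v by (auto simp: children_def)
        then show "p1 x = p x \<and> f1 x = f x"
          by (simp add: p1_def f1_def)
      qed (use True in \<open>simp add: f1_def\<close>)
      then show ?thesis
        using R(5) v by (simp add: sol_def)
    next
      case False
      have "top_force R s p1 f1 x = 0" if "x \<in> children R v" for x
      proof -
        have "\<not> ?K x"
          using sp[of x] False that ny by (auto simp: children_def)
        then show ?thesis
          by (simp add: p1_def f1_def top_of_zero)
      qed
      then show ?thesis
        using False by (simp add: ext_force_def f1_def)
    qed
  qed
  have "p1 v = 0" if "v \<in> insert y B" for v
    using that zero y by (auto simp: p1_def)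
  from sol_zero(2)[OF R(1) _ _ R(4) S this y(1)] R(2,3) y(1)
  show "f y = 0"
    by (auto simp: f1_def)
qed

text \<open>Displacement and force both vanish at \<open>j\<close>. This zero state is carried up
  from \<open>j\<close> to the edge at the base, which lies above \<open>k\<close> as well because
  the root is single, and from there down to \<open>k\<close>.\<close>

lemma unique_continuation:
  assumes R: "net R" "single_root R" "Re (s\<^sup>2) \<ge> 0" "sol R (leaves R) s p f"
    and jk: "j \<in> leaves R" "k \<in> leaves R" "j \<noteq> k"
    and zero: "\<And>v. v \<in> leaves R \<Longrightarrow> v \<noteq> k \<Longrightarrow> p v = 0" and f: "f j = 0"
  shows "p k = 0"
proof -
  have le: "leaves R \<subseteq> leaves R" "leaves R \<subseteq> edges R"
    by (auto simp: leaves_def)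
  have k: "k \<in> edges R" and j: "j \<in> edges R"
    using jk le by auto
  have below: "p u = 0 \<and> f u = 0" if "w \<in> children R y" "y \<in> edges R" "p y = 0" "k \<notin> subtree R w" "u \<in> subtree R w" for w y u
    using vanishing_below[OF R(1) le R(3,4) that(1) _ _ that(5)] that zero by blast
  have up: "p v = 0 \<and> f v = 0" if "v \<in> edges R" "j \<in> subtree R v" for v
    using R(1) that
  proof (induction v rule: net_induct_up)
    case (step v)
    show ?case
    proof (cases "v = j")
      case True
      then show ?thesis
        using zero jk f by auto
    next
      case False
      then obtain w where w: "w \<in> children R v" "j \<in> subtree R w"
        using subtree_child_exists[OF step(3)] by auto
      then have pw: "p w = 0" "f w = 0"
        using step(2) by auto
      have pv: "p v = 0"
        using sol_child[OF R(4) w(1) step(1)] top_of_zero(1)[of p w f R s] pw by simp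
      show ?thesis
      proof (cases "k \<in> subtree R v")
        \<comment> \<open>The branch towards k is not yet controlled, so balance at v is of no use;
          but all boundary vertices not below v are at rest, which gives the force from
          above.\<close>
        case True
        then have "f v = 0"
          using vanishing_above[OF R(1) le R(3,4) step(1) pv] zero by metis
        then show ?thesis
          using pv by simp
      next
        case False
        have "top_force R s p f x = 0" if x: "x \<in> children R v" for x
        proof -
          have "k \<notin> subtree R x"
            using False child_in_subtree[OF x step(1)] by blast
          then show ?thesis
            using below[OF x step(1) pv, of x] x by (intro top_of_zero) (auto simp: children_def)
        qed
        moreover have "v \<notin> leaves R"
          using w by (auto simp: leaves_def)
        ultimately show ?thesis
          using sol_balance[OF R(4) step(1)] pv by simp
      qed
    qed
  qed
  \<comment> \<open>Downwards along the path to k: the branches off the path are at rest, so balance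
    leaves zero force at the top of the next edge, and the transfer is invertible.\<close>
  have "p v = 0 \<and> f v = 0" if "v \<in> edges R" "k \<in> subtree R v" for v
    using R(1) that
  proof (induction v rule: net_induct_down)
    case (step v)
    show ?case
    proof (cases "parent R v = base R")
      case True
      then have "v \<in> children R (base R)"
        using step(1) by (auto simp: children_def)
      then have "j \<in> subtree R v"
        using top_ancestor[OF R(1) j] R(2) by (auto simp: single_root_def)
      then show ?thesis
        using up[OF step(1)] by blast
    next
      case False
      define y where "y = parent R v"
      have y: "y \<in> edges R" and vy: "v \<in> children R y"
        using net_parent[OF R(1) step(1) False] step(1) by (auto simp: y_def children_def)
      have "k \<in> subtree R y"
        using child_in_subtree[OF vy y step(3)] .
      then have py: "p y = 0" "f y = 0"
        using step(2)[OF False] by (auto simp: y_def)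
      have "top_force R s p f x = 0" if "x \<in> children R y - {v}" for x
      proof -
        have x: "x \<in> children R y"
          using that by blast
        have "k \<notin> subtree R x"
          using subtree_children_disjoint[OF R(1) x vy _ step(3)] that by blast
        then show ?thesis
          using below[OF x y py(1), of x] x by (intro top_of_zero) (auto simp: children_def)
      qed
      then have "(\<Sum>x\<in>children R y. top_force R s p f x) = top_force R s p f v"
        using sum.remove[OF finite_children[OF R(1)] vy, of "top_force R s p f"] by simp
      moreover have "y \<notin> leaves R"
        using vy by (auto simp: leaves_def)
      ultimately have "top_force R s p f v = 0"
        using sol_balance[OF R(4) y] py(2) by simp
      moreover have "top_value R s p f v = 0"
        using sol_child[OF R(4) vy y] py(1) by simp
      ultimately show ?thesis
        using top_zero[OF R(1) step(1)] by blast
    qed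
  qed
  then show ?thesis
    using k by simp
qed

section \<open>Comparison of two networks\<close>

text \<open>Only the leaf \<open>i\<close> is displaced, and the forces are divided by the growing
  frequency. The limits are the impedances of the two paired edges.\<close>

lemma same_data_conj:
  assumes R: "net R" "leaves R \<subseteq> B" "B \<subseteq> edges R"
    and R': "net R'" "leaves R' \<subseteq> B'" "B' \<subseteq> edges R'"
    and \<phi>: "bij_betw \<phi> B B'"
    and data: "\<And>t. t \<ge> 0 \<Longrightarrow> same_data R B R' B' \<phi> Q H (of_real t)"
    and i: "i \<in> leaves R" "\<phi> i \<in> leaves R'"
  shows "H i *v (efun R i of_real *v a) = efun R' (\<phi> i) of_real *v (Q i *v a)"
proof -
  have iB: "i \<in> B" and ch: "children R i = {}" "children R' (\<phi> i) = {}"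
    using i R(2) by (auto simp: leaves_def)
  have s: "Re ((of_nat n)\<^sup>2) \<ge> 0" for n
    unfolding of_nat_power[symmetric] by simp
  have "\<forall>n. \<exists>p f p' f'. sol R B (of_nat (Suc n)) p f \<and> (\<forall>v\<in>B. p v = (if v = i then a else 0)) \<and>
      sol R' B' (of_nat (Suc n)) p' f' \<and>
      (\<forall>j\<in>B. p' (\<phi> j) = Q j *v p j \<and> ext_force R' (of_nat (Suc n)) p' f' (\<phi> j) = H j *v ext_force R (of_nat (Suc n)) p f j)"
  proof
    fix n
    obtain p f where pf: "sol R B (of_nat (Suc n)) p f" "\<forall>v\<in>B. p v = (if v = i then a else 0)"
      using dirichlet_exists[OF R(1) s[of "Suc n"] R(2,3), of "\<lambda>v. if v = i then a else 0"] by blast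
    moreover have "same_data R B R' B' \<phi> Q H (of_nat (Suc n))"
      using data[of "real (Suc n)"] by simp
    ultimately show "\<exists>p f p' f'. sol R B (of_nat (Suc n)) p f \<and> (\<forall>v\<in>B. p v = (if v = i then a else 0)) \<and>
      sol R' B' (of_nat (Suc n)) p' f' \<and>
      (\<forall>j\<in>B. p' (\<phi> j) = Q j *v p j \<and> ext_force R' (of_nat (Suc n)) p' f' (\<phi> j) = H j *v ext_force R (of_nat (Suc n)) p f j)"
      unfolding same_data_def by blast
  qed
  then obtain p f p' f' where *: "\<And>n. sol R B (of_nat (Suc n)) (p n) (f n)"
      "\<And>n v. v \<in> B \<Longrightarrow> p n v = (if v = i then a else 0)"
      "\<And>n. sol R' B' (of_nat (Suc n)) (p' n) (f' n)"
      "\<And>n j. j \<in> B \<Longrightarrow> p' n (\<phi> j) = Q j *v p n j"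
      "\<And>n j. j \<in> B \<Longrightarrow> ext_force R' (of_nat (Suc n)) (p' n) (f' n) (\<phi> j) = H j *v ext_force R (of_nat (Suc n)) (p n) (f n) j"
    by metis
  have f': "f' n (\<phi> i) = H i *v f n i" for n
    using *(5)[OF iB, of n] ch by (simp add: ext_force_def)
  have p': "p' n v = (if v = \<phi> i then Q i *v a else 0)" if v: "v \<in> B'" for n v
  proof -
    obtain j where j: "j \<in> B" "v = \<phi> j"
      using v \<phi> by (auto simp: bij_betw_def)
    moreover have "\<phi> j = \<phi> i \<longleftrightarrow> j = i"
      using \<phi> j(1) iB by (auto simp: bij_betw_def dest: inj_onD)
    ultimately show ?thesis
      using *(4)[OF j(1), of n] *(2)[OF j(1), of n] by simp
  qed
  have l1: "(\<lambda>n. f n i /\<^sub>R real (Suc n)) \<longlonglongrightarrow> - (efun R i of_real *v a)"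
    by (rule leaf_asymptotics[OF R i(1) *(1,2)])
  have l2: "(\<lambda>n. f' n (\<phi> i) /\<^sub>R real (Suc n)) \<longlonglongrightarrow> - (efun R' (\<phi> i) of_real *v (Q i *v a))"
    by (rule leaf_asymptotics[OF R' i(2) *(3) p'])
  have eq: "f' n (\<phi> i) /\<^sub>R real (Suc n) = H i *v (f n i /\<^sub>R real (Suc n))" for n
    unfolding f' scaleR_vec vector_scalar_commute ..
  have l3: "(\<lambda>n. f' n (\<phi> i) /\<^sub>R real (Suc n)) \<longlonglongrightarrow> H i *v (- (efun R i of_real *v a))"
    unfolding eq by (rule tendsto_mat2_vec[OF tendsto_const l1])
  show ?thesis
    using LIMSEQ_unique[OF l2 l3] by (simp add: vec.neg)
qed

abbreviation rot_data where
  "rot_data R B R' B' \<phi> q s \<equiv> same_data R B R' B' \<phi> (\<lambda>j. rot (q j)) (\<lambda>j. rot (q j)) s"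

text \<open>Solve the Dirichlet problem in the first network with the displacements turned back. By
  uniqueness its partner in the second network is the given solution.\<close>

lemma rot_data_sym:
  assumes R: "net R" "leaves R \<subseteq> B" "B \<subseteq> edges R"
    and R': "net R'" "leaves R' \<subseteq> B'" "B' \<subseteq> edges R'"
    and \<phi>: "bij_betw \<phi> B B'" and s: "Re (s\<^sup>2) \<ge> 0"
    and data: "rot_data R B R' B' \<phi> q s"
    and \<psi>: "\<And>j. j \<in> B \<Longrightarrow> \<psi> (\<phi> j) = j" "\<And>j. j \<in> B \<Longrightarrow> q' (\<phi> j) = - q j"
  shows "rot_data R' B' R B \<psi> q' s"
  unfolding same_data_def
proof (intro allI impI)
  fix p' f' assume S': "sol R' B' s p' f'"
  obtain p f where S: "sol R B s p f" "\<And>j. j \<in> B \<Longrightarrow> p j = rot (- q j) *v p' (\<phi> j)"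
    using dirichlet_exists[OF R(1) s R(2,3), of "\<lambda>j. rot (- q j) *v p' (\<phi> j)"] by blast
  obtain p2 f2 where S2: "sol R' B' s p2 f2"
    "\<And>j. j \<in> B \<Longrightarrow> p2 (\<phi> j) = rot (q j) *v p j \<and> ext_force R' s p2 f2 (\<phi> j) = rot (q j) *v ext_force R s p f j"
    using data S(1) unfolding same_data_def by blast
  have eq: "p2 v = p' v" if v: "v \<in> B'" for v
  proof -
    obtain j where j: "j \<in> B" "v = \<phi> j"
      using v \<phi> by (auto simp: bij_betw_def)
    then show ?thesis
      using S2(2)[OF j(1)] S(2)[OF j(1)] by simp
  qed
  show "\<exists>p f. sol R B s p f \<and>
      (\<forall>j\<in>B'. p (\<psi> j) = rot (q' j) *v p' j \<and> ext_force R s p f (\<psi> j) = rot (q' j) *v ext_force R' s p' f' j)"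
  proof (intro exI conjI ballI)
    show "sol R B s p f"
      by (rule S)
    fix v assume v: "v \<in> B'"
    then obtain j where j: "j \<in> B" "v = \<phi> j"
      using \<phi> by (auto simp: bij_betw_def)
    have ve: "v \<in> edges R'"
      using v R'(3) by blast
    show "p (\<psi> v) = rot (q' v) *v p' v"
      using S(2)[OF j(1)] \<psi> j by simp
    have "ext_force R' s p' f' v = rot (q j) *v ext_force R s p f j"
      using sol_unique_force[OF R' s S2(1) S' eq ve] S2(2)[OF j(1)] j(2) by simp
    then show "ext_force R s p f (\<psi> v) = rot (q' v) *v ext_force R' s p' f' v"
      using \<psi> j by simp
  qed
qed

section \<open>The static limit\<close>

text \<open>Its real part is the inner product of \<open>complex^2\<close>. The complex value is
  needed because a phase factor of the second argument must leave the modulus unchanged.\<close>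

definition herm :: "complex^2 \<Rightarrow> complex^2 \<Rightarrow> complex" where
  "herm x y = cnj (x $ 1) * y $ 1 + cnj (x $ 2) * y $ 2"

text \<open>
  Circular polarisation is a common eigenvector of all rotations: the unknown frame angles at the
  boundary turn into phase factors.
\<close>

definition circ :: "complex^2" where
  "circ = vector [1, - \<i>]"

lemma herm_add: "herm x (y + z) = herm x y + herm x z"
  by (simp add: herm_def algebra_simps)

lemma herm_scale: "herm x (c *s y) = c * herm x y"
  by (simp add: herm_def algebra_simps)

lemma circ_nonzero: "circ \<noteq> 0"
  by (simp add: circ_def vec_eq_iff forall_2)

lemma rot_circ: "rot a *v circ = cis a *s circ"
  by (simp add: circ_def rot_def mat2_simps complex_eq_iff)

lemma herm_rot: "herm (rot a *v x) (rot a *v y) = herm x y"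
proof -
  define c s where cs: "c = complex_of_real (cos a)" "s = complex_of_real (sin a)"
  have "herm (rot a *v x) (rot a *v y) = (c * c + s * s) * herm x y"
    unfolding rot_def herm_def matrix_vector_mult_def sum_2 cs
    by (simp add: algebra_simps)
  moreover have "c * c + s * s = 1"
    unfolding cs of_real_mult[symmetric] of_real_add[symmetric] using sin_cos_squared_add3[of a] by simp
  ultimately show ?thesis
    by simp
qed

text \<open>In the frame of the edge the form is a |y1|^2 + b |y2|^2.\<close>

lemma herm_efun_pos:
  assumes "g (vel1 R v) = complex_of_real a" "g (vel2 R v) = complex_of_real b" "a > 0" "b > 0" "F \<noteq> 0"
  shows "\<exists>e>0. herm F (efun R v g *v F) = complex_of_real e"
proof -
  define y where "y = rot (- frame R v) *v F"
  have F: "F = rot (frame R v) *v y"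
    by (simp add: y_def)
  have "y \<noteq> 0"
    using assms(5) F by auto
  have "efun R v g *v F = rot (frame R v) *v (diag2 (of_real a) (of_real b) *v y)"
    by (simp add: efun_def turned_def assms y_def flip: matrix_vector_mul_assoc)
  then have "herm F (efun R v g *v F) = herm y (diag2 (of_real a) (of_real b) *v y)"
    using herm_rot F by metis
  also have "\<dots> = complex_of_real (a * (norm (y $ 1))\<^sup>2 + b * (norm (y $ 2))\<^sup>2)"
    by (simp add: herm_def diag2_def mat2_simps cmod_power2) (simp add: complex_eq_iff algebra_simps power2_eq_square)
  finally have "herm F (efun R v g *v F) = complex_of_real (a * (norm (y $ 1))\<^sup>2 + b * (norm (y $ 2))\<^sup>2)" .
  moreover have "a * (norm (y $ 1))\<^sup>2 + b * (norm (y $ 2))\<^sup>2 > 0"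
  proof -
    have "y $ 1 \<noteq> 0 \<or> y $ 2 \<noteq> 0"
      using \<open>y \<noteq> 0\<close> by (auto simp: vec_eq_iff forall_2)
    then show ?thesis
      using assms(3,4) by (auto intro: add_pos_nonneg add_nonneg_pos)
  qed
  ultimately show ?thesis
    by blast
qed

lemma top_static:
  "top_value R 0 p f v = p v + efun R v (ts 0 (elen R v)) *v f v"
  "top_force R 0 p f v = f v"
proof -
  have "tc 0 (elen R v) = (\<lambda>_. 1)" "tz 0 (elen R v) = (\<lambda>_. 0)"
    by (simp_all add: tc_def tz_def fun_eq_iff)
  then show "top_value R 0 p f v = p v + efun R v (ts 0 (elen R v)) *v f v" "top_force R 0 p f v = f v"
    by (simp_all add: top_value_def top_force_def)
qed

text \<open>
  A static force that enters at the leaf \<open>i\<close> only runs along the path to the root, and the work done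
  along the path is positive. So the displacements at \<open>i\<close> and at an earlier branching point cannot
  both be rotations of the same circularly polarised vector.
\<close>

lemma static_contradiction:
  assumes R: "net R" "single_root R" "sol R (leaves R) 0 p f"
    and ij: "i \<in> leaves R" "j \<in> leaves R" "j \<noteq> i"
    and p: "\<And>k. k \<in> leaves R \<Longrightarrow> p k = rot (a k) *v circ"
    and f: "\<And>k. k \<in> leaves R \<Longrightarrow> k \<noteq> i \<Longrightarrow> f k = 0"
  shows False
proof -
  have ie: "i \<in> edges R" "j \<in> edges R"
    using ij by (auto simp: leaves_def)
  have bal: "f v = (\<Sum>w\<in>children R v. f w)" if "v \<in> edges R" "v \<notin> leaves R" for v
    using sol_balance[OF R(3) that] by (simp add: top_static)
  \<comment> \<open>Off the path from i to the root no force flows, so the displacement is constant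
    on each such branch and keeps its circular polarisation.\<close>
  have off: "f v = 0 \<and> (\<exists>b. p v = rot b *v circ)" if "v \<in> edges R" "i \<notin> subtree R v" for v
    using R(1) that
  proof (induction v rule: net_induct_up)
    case (step v)
    show ?case
    proof (cases "v \<in> leaves R")
      case True
      then show ?thesis
        using p[OF True] f[OF True] step(1,3) by (cases "v = i") auto
    next
      case False
      then obtain w where w: "w \<in> children R v"
        using step(1) by (auto simp: leaves_def)
      have ch: "f x = 0 \<and> (\<exists>b. p x = rot b *v circ)" if x: "x \<in> children R v" for x
        using step(2)[OF x] child_in_subtree[OF x step(1)] step(3) by blast
      have "p w = p v"
        using sol_child[OF R(3) w step(1)] ch[OF w] by (simp add: top_static)
      then show ?thesis
        using ch[OF w] bal[OF step(1) False] ch by auto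
    qed
  qed
  define F where "F = f i"
  \<comment> \<open>The first alternative holds before any branching, with r the work done since i.
    In the second, \<open>rot b *v circ\<close> is the displacement at the first branching point, e
    the work up to there and r the work done after it.\<close>
  have chain: "f v = F \<and> (F \<noteq> 0 \<longrightarrow> (\<exists>r\<ge>0.
      (subtree R v \<inter> leaves R = {i} \<and> herm F (p v) = herm F (p i) + of_real r) \<or>
      (\<exists>b e. e > 0 \<and> herm F (rot b *v circ) = herm F (p i) + of_real e \<and>
         herm F (p v) = herm F (rot b *v circ) + of_real r)))" if "v \<in> edges R" "i \<in> subtree R v" for v
    using R(1) that
  proof (induction v rule: net_induct_up)
    case (step v)
    show ?case
    proof (cases "v = i")
      case True
      have "subtree R i \<inter> leaves R = {i}"
        using subtree_child_exists[of _ R i] ij(1) ie by (auto simp: leaves_def)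
      then show ?thesis
        using True by (auto simp: F_def)
    next
      case False
      then obtain w where w: "w \<in> children R v" "i \<in> subtree R w"
        using subtree_child_exists[OF step(3)] by auto
      have vl: "v \<notin> leaves R"
        using w by (auto simp: leaves_def)
      have we: "w \<in> edges R"
        using w(1) by (rule children_edges)
      have other: "f x = 0 \<and> (\<exists>b. p x = rot b *v circ)" if x: "x \<in> children R v - {w}" for x
        using off[of x] subtree_children_disjoint[OF R(1) _ w(1) _ w(2), of x] x by (auto simp: children_def)
      have fw: "f w = F"
        using step(2)[OF w(1) w(2)] by blast
      have "f v = F"
        using bal[OF step(1) vl] sum.remove[OF finite_children[OF R(1)] w(1), of f] other fw by simp
      moreover have "\<exists>r\<ge>0.
        (subtree R v \<inter> leaves R = {i} \<and> herm F (p v) = herm F (p i) + of_real r) \<or>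
        (\<exists>b e. e > 0 \<and> herm F (rot b *v circ) = herm F (p i) + of_real e \<and>
         herm F (p v) = herm F (rot b *v circ) + of_real r)" if F0: "F \<noteq> 0"
      proof -
        have "\<exists>e>0. herm F (efun R w (ts 0 (elen R w)) *v F) = complex_of_real e"
          using net_pos[OF R(1) we] F0
          by (intro herm_efun_pos[where a = "elen R w / (vel1 R w)\<^sup>2" and b = "elen R w / (vel2 R w)\<^sup>2"])
            (simp_all add: ts_def)
        then obtain e where e: "e > 0" "herm F (efun R w (ts 0 (elen R w)) *v F) = complex_of_real e"
          by blast
        have pv: "herm F (p v) = herm F (p w) + of_real e"
          unfolding e(2)[symmetric] herm_add[symmetric]
          using sol_child[OF R(3) w(1) step(1)] fw by (simp add: top_static)
        obtain r where r: "r \<ge> 0"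
          "(subtree R w \<inter> leaves R = {i} \<and> herm F (p w) = herm F (p i) + of_real r) \<or>
           (\<exists>b e. e > 0 \<and> herm F (rot b *v circ) = herm F (p i) + of_real e \<and>
             herm F (p w) = herm F (rot b *v circ) + of_real r)"
          using step(2)[OF w(1) w(2)] F0 by blast
        from r(2) show ?thesis
        proof
          assume 1: "subtree R w \<inter> leaves R = {i} \<and> herm F (p w) = herm F (p i) + of_real r"
          show ?thesis
          proof (cases "children R v = {w}")
            case True
            have "subtree R v \<inter> leaves R = {i}"
            proof (intro equalityI subsetI)
              fix x assume x: "x \<in> subtree R v \<inter> leaves R"
              then have "x \<noteq> v"
                using vl by auto
              then show "x \<in> {i}"
                using subtree_child_exists[of x R v] x True 1 by auto
            qed (use step(3) ij(1) in auto)
            then show ?thesis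
              using 1 pv r(1) e(1) by (intro exI[of _ "r + e"]) simp
          next
            case False
            then obtain x where x: "x \<in> children R v - {w}"
              using w(1) by blast
            then obtain b where b: "f x = 0" "p x = rot b *v circ"
              using other by blast
            have "p v = rot b *v circ"
              using sol_child[OF R(3) _ step(1), of x] x b by (simp add: top_static)
            then show ?thesis
              using pv 1 r(1) e(1) by (intro exI[of _ 0] conjI disjI2 exI[of _ b] exI[of _ "r + e"]) simp_all
          qed
        next
          assume "\<exists>b e. e > 0 \<and> herm F (rot b *v circ) = herm F (p i) + of_real e \<and>
             herm F (p w) = herm F (rot b *v circ) + of_real r"
          then obtain b e' where "e' > 0" "herm F (rot b *v circ) = herm F (p i) + of_real e'"
             "herm F (p w) = herm F (rot b *v circ) + of_real r"
            by blast
          then show ?thesis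
            using pv r(1) e(1) by (intro exI[of _ "r + e"] conjI disjI2 exI[of _ b] exI[of _ e']) simp_all
        qed
      qed
      ultimately show ?thesis
        by blast
    qed
  qed
  obtain c where c: "c \<in> children R (base R)" "i \<in> subtree R c"
    using top_ancestor[OF R(1) ie(1)] by blast
  have ce: "c \<in> edges R"
    using c(1) by (rule children_edges)
  have jc: "j \<in> subtree R c"
    using top_ancestor[OF R(1) ie(2)] c(1) R(2) by (auto simp: single_root_def)
  have fc: "f c = F"
    using chain[OF ce c(2)] by blast
  have pc: "p c + efun R c (ts 0 (elen R c)) *v F = 0"
    using sol_root_child[OF R(3) c(1)] fc by (simp add: top_static)
  show False
  proof (cases "F = 0")
    case True
    have f0: "f v = 0" if "v \<in> edges R" for v
      using off[OF that] chain[OF that] True by blast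
    have "p v = 0" if "v \<in> edges R" for v
      using R(1) that
    proof (induction v rule: net_induct_down)
      case (step v)
      have "top_value R 0 p f v = p v"
        using f0[OF step(1)] by (simp add: top_static)
      then show ?case
        using R(3) step by (cases "parent R v = base R") (auto simp: sol_def)
    qed
    then have "rot (a i) *v circ = 0"
      using p ij(1) ie(1) by metis
    then show False
      using circ_nonzero rot_cancel(2)[of "a i" circ] by simp
  next
    case False
    have "\<exists>e>0. herm F (efun R c (ts 0 (elen R c)) *v F) = complex_of_real e"
      using net_pos[OF R(1) ce] False
      by (intro herm_efun_pos[where a = "elen R c / (vel1 R c)\<^sup>2" and b = "elen R c / (vel2 R c)\<^sup>2"])
        (simp_all add: ts_def)
    then obtain e where e: "e > 0" "herm F (efun R c (ts 0 (elen R c)) *v F) = complex_of_real e"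
      by blast
    have "subtree R c \<inter> leaves R \<noteq> {i}"
      using jc ij by blast
    then obtain r b e' where r: "r \<ge> 0" "e' > 0" "herm F (rot b *v circ) = herm F (p i) + of_real e'"
         "herm F (p c) = herm F (rot b *v circ) + of_real r"
      using chain[OF ce c(2)] False by blast
    have "herm F (p c) = - of_real e"
      using arg_cong[OF pc, of "herm F"] e(2) by (simp add: herm_add herm_def[of F 0] eq_neg_iff_add_eq_0)
    then have 1: "herm F (rot b *v circ) = of_real (- (e + r))"
      using r(4) by (simp add: algebra_simps)
    have "herm F (p i) = herm F (rot b *v circ) - of_real e'"
      using r(3) by simp
    then have 2: "herm F (p i) = of_real (- (e + r + e'))"
      unfolding 1 by simp
    \<comment> \<open>Rotations change \<open>circ\<close> by a phase only, so the values at i and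
      at the branching point have the same modulus; but both are negative reals, and they differ by
      \<open>e' > 0\<close>.\<close>
    have "norm (herm F circ) = e + r"
      using arg_cong[OF 1, of norm, unfolded norm_of_real] e(1) r(1) by (simp add: rot_circ herm_scale norm_mult)
    moreover have "norm (herm F circ) = e + r + e'"
      using arg_cong[OF 2, of norm, unfolded norm_of_real] e(1) r(1,2) p[OF ij(1)]
      by (simp add: rot_circ herm_scale norm_mult)
    ultimately show False
      using r(2) by simp
  qed
qed

text \<open>
  If \<open>\<phi> i\<close> had children and the other boundary vertices did not all lie on one branch below it, some
  boundary data of the second network would vanish, which unique continuation excludes in the first
  one. If they do, \<open>\<phi> i\<close> separates them from the root, which is visible statically.
\<close>

lemma leaf_not_inner:
  assumes R: "net R" "single_root R"
    and R': "net R'" "leaves R' \<subseteq> B'" "B' \<subseteq> edges R'"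
    and \<phi>: "bij_betw \<phi> (leaves R) B'"
    and data: "\<And>t. t \<ge> 0 \<Longrightarrow> rot_data R (leaves R) R' B' \<phi> q (of_real t)"
    and i: "i \<in> leaves R"
  shows "children R' (\<phi> i) = {}"
proof (rule ccontr)
  assume "children R' (\<phi> i) \<noteq> {}"
  then obtain w where w: "w \<in> children R' (\<phi> i)"
    by blast
  define y where "y = \<phi> i"
  have le: "leaves R \<subseteq> leaves R" "leaves R \<subseteq> edges R"
    by (auto simp: leaves_def)
  have re: "Re ((complex_of_real t)\<^sup>2) \<ge> 0" for t
    by (simp flip: of_real_power)
  define \<psi> where "\<psi> = inv_into (leaves R) \<phi>"
  have \<psi>: "\<psi> (\<phi> j) = j" if "j \<in> leaves R" for j
    using that \<phi> by (simp add: \<psi>_def bij_betw_def)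
  have \<psi>': "\<psi> j \<in> leaves R" "\<phi> (\<psi> j) = j" if "j \<in> B'" for j
    using that \<phi> by (auto simp: \<psi>_def bij_betw_def inv_into_into f_inv_into_f)
  have rdata: "rot_data R' B' R (leaves R) \<psi> (\<lambda>j. - q (\<psi> j)) (of_real t)" if "t \<ge> 0" for t
    by (rule rot_data_sym[OF R(1) le R' \<phi> re data[OF that]]) (simp_all add: \<psi>)
  have y: "y \<in> B'" "y \<in> edges R'"
    using \<phi> i R'(3) by (auto simp: y_def bij_betw_def)
  have w: "w \<in> children R' y" "w \<in> edges R'"
    using w by (auto simp: y_def children_def)
  have leaf_below: "\<exists>j\<in>B'. j \<noteq> y \<and> j \<in> subtree R' x \<and> j \<in> leaves R'" if x: "x \<in> children R' y" for x
    using leaf_in_subtree[OF R'(1), of x] not_in_subtree_child[OF R'(1) x] x R'(2) by (fastforce simp: children_def)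
  show False
  proof (cases "\<exists>x\<in>children R' y. \<exists>k\<in>B'. k \<noteq> y \<and> k \<notin> subtree R' x")
    case True
    then obtain x k where x: "x \<in> children R' y" and k: "k \<in> B'" "k \<noteq> y" "k \<notin> subtree R' x"
      by blast
    obtain j where j: "j \<in> B'" "j \<noteq> y" "j \<in> subtree R' x" "j \<in> leaves R'"
      using leaf_below[OF x] by blast
    \<comment> \<open>Only k moves. The vertex y is at rest, so the branch at x, which avoids k, is
      at rest too and no force is felt at j.\<close>
    obtain p' f' where S': "sol R' B' (of_real 1) p' f'" "\<And>v. v \<in> B' \<Longrightarrow> p' v = (if v = k then circ else 0)"
      using dirichlet_exists[OF R'(1) re[of 1] R'(2,3), of "\<lambda>v. if v = k then circ else 0"] by blast
    have "f' j = 0"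
      by (rule vanishing_below(2)[OF R' re S'(1) x _ _ j(3)]) (use S'(2) y k in auto)
    then have fj: "ext_force R' (of_real 1) p' f' j = 0"
      using j(4) by (simp add: ext_force_def leaves_def)
    have "\<exists>p f. sol R (leaves R) (of_real 1) p f \<and>
      (\<forall>j\<in>B'. p (\<psi> j) = rot (- q (\<psi> j)) *v p' j \<and>
         ext_force R (of_real 1) p f (\<psi> j) = rot (- q (\<psi> j)) *v ext_force R' (of_real 1) p' f' j)"
      using rdata[of 1] S'(1) unfolding same_data_def by simp
    then obtain p f where S: "sol R (leaves R) (of_real 1) p f"
      "\<And>j. j \<in> B' \<Longrightarrow> p (\<psi> j) = rot (- q (\<psi> j)) *v p' j"
      "\<And>j. j \<in> B' \<Longrightarrow> ext_force R (of_real 1) p f (\<psi> j) = rot (- q (\<psi> j)) *v ext_force R' (of_real 1) p' f' j"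
      by blast
    have "children R (\<psi> j) = {}"
      using \<psi>'(1)[OF j(1)] by (simp add: leaves_def)
    then have 1: "f (\<psi> j) = 0"
      using S(3)[OF j(1)] fj by (simp add: ext_force_def)
    have 2: "p v = 0" if v: "v \<in> leaves R" "v \<noteq> \<psi> k" for v
    proof -
      have "\<phi> v \<in> B'" "\<psi> (\<phi> v) = v"
        using v \<phi> \<psi> by (auto simp: bij_betw_def)
      then show ?thesis
        using S(2)[of "\<phi> v"] S'(2)[of "\<phi> v"] v by auto
    qed
    have "\<psi> j \<noteq> \<psi> k"
      using \<psi>'(2) j k by metis
    then have "p (\<psi> k) = 0"
      using unique_continuation[OF R re S(1) _ _ _ 2 1] \<psi>'(1) j(1) k(1) by blast
    then have "rot (- q (\<psi> k)) *v circ = 0"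
      using S(2)[OF k(1)] S'(2)[OF k(1)] by simp
    then show False
      using circ_nonzero rot_cancel(1)[of "q (\<psi> k)" circ] by simp
  next
    case False
    then have all: "k \<in> subtree R' w" if "k \<in> B'" "k \<noteq> y" for k
      using that w by blast
    have ch: "x = w" if x: "x \<in> children R' y" for x
      using leaf_below[OF x] all subtree_children_disjoint[OF R'(1) x w(1)] by blast
    have ny: "y \<notin> subtree R' w"
      using not_in_subtree_child[OF R'(1) w(1)] .
    have re0: "Re (0\<^sup>2) \<ge> 0"
      by simp
    obtain p' f' where S': "sol R' B' 0 p' f'" "\<And>v. v \<in> B' \<Longrightarrow> p' v = circ"
      using dirichlet_exists[OF R'(1) re0 R'(2,3), of "\<lambda>_. circ"] by blast
    \<comment> \<open>Below y the constant displacement \<open>circ\<close> is a static solution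
      without forces. The cut-off difference from it has zero boundary values, so nothing below y
      carries a force.\<close>
    define d where "d v = (if v \<in> subtree R' w then p' v - circ else 0)" for v
    define g where "g v = (if v \<in> subtree R' w then f' v else 0)" for v
    have sp: "v \<in> subtree R' w \<longleftrightarrow> parent R' v \<in> subtree R' w" if "v \<in> edges R'" "v \<noteq> w" for v
      using subtree_parent[OF that w(2)] .
    have nb: "base R' \<notin> subtree R' w"
      using subtree_edges base_notin_edges by metis
    have D: "sol R' B' 0 d g"
      unfolding sol_def
    proof (intro conjI ballI)
      fix v assume v: "v \<in> edges R'"
      show "top_value R' 0 d g v = (if parent R' v = base R' then 0 else d (parent R' v))"
      proof (cases "v \<in> subtree R' w")
        case True
        then have 1: "top_value R' 0 d g v = top_value R' 0 p' f' v - circ"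
          by (simp add: top_static d_def g_def)
        have 2: "top_value R' 0 p' f' v = (if parent R' v = base R' then 0 else p' (parent R' v))"
          using S'(1) v by (simp add: sol_def)
        show ?thesis
        proof (cases "v = w")
          case True
          then have "parent R' v = y"
            using w(1) by (simp add: children_def)
          then show ?thesis
            using 1 2 S'(2)[OF y(1)] y ny by (auto simp: d_def)
        next
          case False
          then have "parent R' v \<in> subtree R' w"
            using sp[OF v] True by blast
          then show ?thesis
            using 1 2 nb by (auto simp: d_def)
        qed
      next
        case False
        then have "parent R' v \<notin> subtree R' w"
          using sp[OF v] w by (cases "v = w") auto
        then show ?thesis
          using False by (simp add: top_static d_def g_def)
      qed
    next
      fix v assume v: "v \<in> edges R' - B'"
      show "ext_force R' 0 d g v = 0"
      proof (cases "v \<in> subtree R' w")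
        case True
        have "x \<in> subtree R' w" if "x \<in> children R' v" for x
          using child_in_subtree[OF that _ subtree_refl] that True sp[of x] w ny by (auto simp: children_def)
        then have "ext_force R' 0 d g v = ext_force R' 0 p' f' v"
          using True by (simp add: ext_force_def top_static g_def)
        then show ?thesis
          using S'(1) v by (simp add: sol_def)
      next
        case False
        have "x \<notin> subtree R' w" if "x \<in> children R' v" for x
          using sp[of x] that False v y w by (cases "x = w") (auto simp: children_def)
        then show ?thesis
          using False by (simp add: ext_force_def top_static g_def)
      qed
    qed
    have gz: "g v = 0" if "v \<in> edges R'" for v
      by (rule sol_zero(2)[OF R' re0 D _ that]) (use S'(2) in \<open>auto simp: d_def\<close>)
    have fz: "ext_force R' 0 p' f' k = 0" if k: "k \<in> B'" "k \<noteq> y" for k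
    proof -
      have "x \<in> subtree R' w" if "x \<in> children R' k" for x
        using that all[OF k] sp[of x] w ny by (auto simp: children_def)
      moreover have "f' x = 0" if "x \<in> subtree R' w" for x
        using gz[OF subtree_edges[OF that]] that by (simp add: g_def)
      ultimately show ?thesis
        using all[OF k] by (simp add: ext_force_def top_static)
    qed
    have "\<exists>p f. sol R (leaves R) 0 p f \<and>
      (\<forall>j\<in>B'. p (\<psi> j) = rot (- q (\<psi> j)) *v p' j \<and>
         ext_force R 0 p f (\<psi> j) = rot (- q (\<psi> j)) *v ext_force R' 0 p' f' j)"
      using rdata[of 0] S'(1) unfolding same_data_def by simp
    then obtain p f where S: "sol R (leaves R) 0 p f"
      "\<And>j. j \<in> B' \<Longrightarrow> p (\<psi> j) = rot (- q (\<psi> j)) *v p' j"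
      "\<And>j. j \<in> B' \<Longrightarrow> ext_force R 0 p f (\<psi> j) = rot (- q (\<psi> j)) *v ext_force R' 0 p' f' j"
      by blast
    obtain j where j: "j \<in> B'" "j \<noteq> y"
      using leaf_below[OF w(1)] by blast
    show False
    proof (rule static_contradiction[OF R S(1) i, of "\<psi> j" "\<lambda>k. - q k"])
      show "\<psi> j \<in> leaves R" "\<psi> j \<noteq> i"
        using \<psi>'[OF j(1)] j(2) by (auto simp: y_def)
      fix k assume k: "k \<in> leaves R"
      then have k': "\<phi> k \<in> B'" "\<psi> (\<phi> k) = k"
        using \<phi> \<psi> by (auto simp: bij_betw_def)
      show "p k = rot (- q k) *v circ"
        using S(2)[OF k'(1)] S'(2)[OF k'(1)] k'(2) by simp
      assume "k \<noteq> i"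
      then have "\<phi> k \<noteq> y"
        using k'(2) \<psi>[OF i] by (auto simp: y_def)
      then have "ext_force R 0 p f k = 0"
        using S(3)[OF k'(1)] fz[OF k'(1)] k'(2) by simp
      then show "f k = 0"
        using k by (simp add: ext_force_def leaves_def)
    qed
  qed
qed

section \<open>Removing and shortening boundary edges\<close>

definition prune :: "'a rooted_net \<Rightarrow> 'a set \<Rightarrow> 'a rooted_net" where
  "prune R D = R\<lparr>nodes := nodes R - D\<rparr>"

definition trim :: "'a rooted_net \<Rightarrow> 'a \<Rightarrow> real \<Rightarrow> 'a rooted_net" where
  "trim R i x = R\<lparr>elen := (elen R)(i := elen R i - x)\<rparr>"

lemma transfer_compose:
  assumes "net R" "v \<in> edges R"
  shows "efun R v (tc s (x + y)) *v p + efun R v (ts s (x + y)) *v f =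
      efun R v (tc s y) *v (efun R v (tc s x) *v p + efun R v (ts s x) *v f) +
      efun R v (ts s y) *v (efun R v (tz s x) *v p + efun R v (tc s x) *v f)"
    and "efun R v (tz s (x + y)) *v p + efun R v (tc s (x + y)) *v f =
      efun R v (tz s y) *v (efun R v (tc s x) *v p + efun R v (ts s x) *v f) +
      efun R v (tc s y) *v (efun R v (tz s x) *v p + efun R v (tc s x) *v f)"
proof -
  have k: "vel1 R v > 0" "vel2 R v > 0"
    using net_pos[OF assms] by auto
  have e: "efun R v (tc s (x + y)) = efun R v (\<lambda>k. tc s y k * tc s x k + ts s y k * tz s x k)"
    "efun R v (ts s (x + y)) = efun R v (\<lambda>k. tc s y k * ts s x k + ts s y k * tc s x k)"
    "efun R v (tz s (x + y)) = efun R v (\<lambda>k. tz s y k * tc s x k + tc s y k * tz s x k)"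
    using transfer_add[OF k(1), of s x y] transfer_add[OF k(2), of s x y] by (auto intro: efun_cong)
  have e': "efun R v (tc s (x + y)) = efun R v (\<lambda>k. tz s y k * ts s x k + tc s y k * tc s x k)"
  proof -
    have "tc s (x + y) k = tz s y k * ts s x k + tc s y k * tc s x k" if "k > 0" for k
      using transfer_add(1)[OF that, of s y x] by (simp add: algebra_simps)
    then show ?thesis
      using k by (intro efun_cong) auto
  qed
  show "efun R v (tc s (x + y)) *v p + efun R v (ts s (x + y)) *v f =
      efun R v (tc s y) *v (efun R v (tc s x) *v p + efun R v (ts s x) *v f) +
      efun R v (ts s y) *v (efun R v (tz s x) *v p + efun R v (tc s x) *v f)"
    unfolding e by (simp add: matrix_vector_right_distrib efun_mult_vec flip: efun_add_vec)
  show "efun R v (tz s (x + y)) *v p + efun R v (tc s (x + y)) *v f =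
      efun R v (tz s y) *v (efun R v (tc s x) *v p + efun R v (ts s x) *v f) +
      efun R v (tc s y) *v (efun R v (tz s x) *v p + efun R v (tc s x) *v f)"
    unfolding e(3) e' by (simp add: matrix_vector_right_distrib efun_mult_vec flip: efun_add_vec)
qed

lemma prune_simps [simp]:
  "base (prune R D) = base R" "parent (prune R D) = parent R" "elen (prune R D) = elen R"
  "nodes (prune R D) = nodes R - D" "efun (prune R D) = efun R"
  by (simp_all add: prune_def efun_def fun_eq_iff)

lemma trim_simps [simp]:
  "base (trim R i x) = base R" "parent (trim R i x) = parent R" "elen (trim R i x) = (elen R)(i := elen R i - x)"
  "nodes (trim R i x) = nodes R" "efun (trim R i x) = efun R" "vel1 (trim R i x) = vel1 R" "vel2 (trim R i x) = vel2 R"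
  by (simp_all add: trim_def efun_def fun_eq_iff)

lemma top_prune [simp]: "top_value (prune R D) = top_value R" "top_force (prune R D) = top_force R"
  by (simp_all add: top_value_def top_force_def fun_eq_iff)

lemma edges_prune [simp]: "edges (prune R D) = edges R - D"
  by (auto simp: edges_def)

lemma children_prune [simp]: "children (prune R D) v = children R v - D"
  by (auto simp: children_def)

lemma edges_trim [simp]: "edges (trim R i x) = edges R"
  by (simp add: edges_def)

lemma children_trim [simp]: "children (trim R i x) v = children R v"
  by (simp add: children_def)

lemma leaves_trim [simp]: "leaves (trim R i x) = leaves R"
  by (simp add: leaves_def)

lemma net_trim: "net R \<Longrightarrow> x < elen R i \<Longrightarrow> net (trim R i x)"
  by (simp add: net_def)

lemma single_root_trim: "single_root R \<Longrightarrow> single_root (trim R i x)"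
  by (simp add: single_root_def)

lemma leaves_edges: "leaves R \<subseteq> edges R"
  by (auto simp: leaves_def)

lemma parent_not_leaf: "v \<in> edges R \<Longrightarrow> parent R v \<notin> leaves R"
  by (auto simp: leaves_def children_def)

lemma net_prune:
  assumes "net R" "D \<subseteq> leaves R"
  shows "net (prune R D)"
proof -
  have "vel1 (prune R D) = vel1 R" "vel2 (prune R D) = vel2 R"
    by (simp_all add: prune_def)
  moreover have "base R \<notin> D"
    using assms(2) leaves_edges[of R] by (auto simp: edges_def)
  moreover have "parent R v \<notin> D" if "v \<in> edges R" for v
    using parent_not_leaf[OF that] assms(2) by blast
  ultimately show ?thesis
    using assms(1) unfolding net_def by (auto simp: image_subset_iff)
qed

lemma leaves_prune: "D \<subseteq> leaves R \<Longrightarrow> leaves (prune R D) \<subseteq> leaves R - D \<union> parent R ` D"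
  by (auto simp: leaves_def children_def)

lemma single_root_prune: "single_root R \<Longrightarrow> single_root (prune R D)"
  by (simp add: single_root_def)

lemma ext_force_prune:
  assumes "net R"
  shows "ext_force (prune R D) s p f v = ext_force R s p f v + (\<Sum>w\<in>children R v \<inter> D. top_force R s p f w)"
  using sum.Int_Diff[OF finite_children[OF assms], of "top_force R s p f" v D]
  by (simp add: ext_force_def)

text \<open>The removed edges now act on their upper ends as external forces, so these ends join the
  boundary.\<close>

lemma sol_prune:
  assumes "net R" "sol R B s p f" "D \<subseteq> leaves R"
  shows "sol (prune R D) (B - D \<union> parent R ` D) s p f"
  unfolding sol_def
proof (intro conjI ballI)
  fix v assume "v \<in> edges (prune R D) - (B - D \<union> parent R ` D)"
  then have v: "v \<in> edges R" "v \<notin> B" "children R v \<inter> D = {}"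
    by (auto simp: children_def)
  then show "ext_force (prune R D) s p f v = 0"
    using assms(2) by (simp add: ext_force_prune[OF assms(1)] sol_def)
qed (use assms(2) in \<open>simp add: sol_def\<close>)

text \<open>The removed edges are solved from their upper ends, where the displacement is known. Any
  forces there are admissible as long as their sum at each vertex is the external force to be
  absorbed.\<close>

lemma sol_extend:
  assumes R: "net R" "D \<subseteq> leaves R" "parent R ` D \<subseteq> edges R - B"
    and S: "sol (prune R D) (B - D \<union> parent R ` D) s p1 f1"
  shows "\<exists>p f. sol R (B \<union> D) s p f \<and> (\<forall>v. v \<notin> D \<longrightarrow> p v = p1 v \<and> f v = f1 v)"
proof -
  \<comment> \<open>One chosen edge at each parent absorbs the whole external force; its siblings
    get zero force at the top.\<close>
  define G where "G w = (if w = (SOME u. u \<in> D \<and> parent R u = parent R w)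
      then ext_force (prune R D) s p1 f1 (parent R w) else 0)" for w
  define p where "p v = (if v \<in> D then efun R v (tc s (elen R v)) *v p1 (parent R v) - efun R v (ts s (elen R v)) *v G v else p1 v)" for v
  define f where "f v = (if v \<in> D then efun R v (tc s (elen R v)) *v G v - efun R v (tz s (elen R v)) *v p1 (parent R v) else f1 v)" for v
  have De: "D \<subseteq> edges R"
    using R(2) leaves_edges[of R] by blast
  have top: "top_value R s p f w = p1 (parent R w)" "top_force R s p f w = G w" if "w \<in> D" for w
    using transfer_inverse[OF R(1), of w] De that by (auto simp: top_value_def top_force_def p_def f_def)
  have other: "top_value R s p f w = top_value R s p1 f1 w" "top_force R s p f w = top_force R s p1 f1 w" if "w \<notin> D" for w
    using that by (auto intro!: top_cong simp: p_def f_def)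
  have pD: "parent R v \<notin> D" if "v \<in> edges R" for v
    using parent_not_leaf[OF that] R(2) by blast
  have nb: "parent R v \<noteq> base R" if "v \<in> D" for v
    using R(3) that base_notin_edges[of R] by force
  have "sol R (B \<union> D) s p f"
    unfolding sol_def
  proof (intro conjI ballI)
    fix v assume v: "v \<in> edges R"
    show "top_value R s p f v = (if parent R v = base R then 0 else p (parent R v))"
    proof (cases "v \<in> D")
      case True
      then show ?thesis
        using top pD[OF v] nb by (simp add: p_def)
    next
      case False
      then show ?thesis
        using other(1)[OF False] S v pD[OF v] by (simp add: sol_def p_def)
    qed
  next
    fix v assume v: "v \<in> edges R - (B \<union> D)"
    have fv: "f v = f1 v"
      using v by (simp add: f_def)
    have e1: "ext_force R s p f v = ext_force (prune R D) s p f v - (\<Sum>w\<in>children R v \<inter> D. G w)"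
      using top(2) by (simp add: ext_force_prune[OF R(1)])
    have e2: "ext_force (prune R D) s p f v = ext_force (prune R D) s p1 f1 v"
      using other(2) fv by (simp add: ext_force_def)
    show "ext_force R s p f v = 0"
    proof (cases "v \<in> parent R ` D")
      case False
      then have "children R v \<inter> D = {}"
        by (auto simp: children_def)
      then show ?thesis
        using S v False e1 e2 by (simp add: sol_def)
    next
      case True
      define r where "r = (SOME u. u \<in> D \<and> parent R u = v)"
      have r: "r \<in> D" "parent R r = v"
        using someI_ex[of "\<lambda>u. u \<in> D \<and> parent R u = v"] True by (auto simp: r_def)
      have "(\<Sum>w\<in>children R v \<inter> D. G w) = (\<Sum>w\<in>children R v \<inter> D. if w = r then ext_force (prune R D) s p1 f1 v else 0)"
        by (rule sum.cong) (auto simp: children_def G_def r_def)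
      also have "\<dots> = ext_force (prune R D) s p1 f1 v"
        using r De R(1) by (subst sum.delta) (auto simp: children_def)
      finally show ?thesis
        using e1 e2 by simp
    qed
  qed
  then show ?thesis
    by (intro exI[of _ p] exI[of _ f]) (auto simp: p_def f_def)
qed

text \<open>The inverse transfer continues the solution through the piece of length \<open>x\<close>
  that was cut off.\<close>

lemma sol_untrim:
  assumes R: "net R" "i \<in> leaves R" and S: "sol (trim R i x) (leaves R) s p2 f2"
  shows "\<exists>p f. sol R (leaves R) s p f \<and> (\<forall>v. v \<noteq> i \<longrightarrow> p v = p2 v \<and> f v = f2 v) \<and>
    p2 i = efun R i (tc s x) *v p i + efun R i (ts s x) *v f i \<and>
    f2 i = efun R i (tz s x) *v p i + efun R i (tc s x) *v f i"
proof -
  define p where "p = p2(i := efun R i (tc s x) *v p2 i - efun R i (ts s x) *v f2 i)"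
  define f where "f = f2(i := efun R i (tc s x) *v f2 i - efun R i (tz s x) *v p2 i)"
  have ie: "i \<in> edges R"
    using R(2) leaves_edges[of R] by blast
  have i: "p2 i = efun R i (tc s x) *v p i + efun R i (ts s x) *v f i"
    "f2 i = efun R i (tz s x) *v p i + efun R i (tc s x) *v f i"
    using transfer_inverse[OF R(1) ie, of s x] by (simp_all add: p_def f_def)
  have top: "top_value R s p f v = top_value (trim R i x) s p2 f2 v"
    "top_force R s p f v = top_force (trim R i x) s p2 f2 v" if "v \<in> edges R" for v
  proof -
    have "top_value R s p f v = top_value (trim R i x) s p2 f2 v \<and> top_force R s p f v = top_force (trim R i x) s p2 f2 v"
    proof (cases "v = i")
      case True
      then show ?thesis
        using transfer_compose[OF R(1) ie, of s x "elen R i - x" "p i" "f i"]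
        by (simp add: top_value_def top_force_def flip: i)
    next
      case False
      then show ?thesis
        by (simp add: top_value_def top_force_def p_def f_def)
    qed
    then show "top_value R s p f v = top_value (trim R i x) s p2 f2 v"
      "top_force R s p f v = top_force (trim R i x) s p2 f2 v"
      by auto
  qed
  have "sol R (leaves R) s p f"
    unfolding sol_def
  proof (intro conjI ballI)
    fix v assume v: "v \<in> edges R"
    have "parent R v \<noteq> i"
      using parent_not_leaf[OF v] R(2) by blast
    then show "top_value R s p f v = (if parent R v = base R then 0 else p (parent R v))"
      using S v top[OF v] by (simp add: sol_def p_def)
  next
    fix v assume v: "v \<in> edges R - leaves R"
    have "v \<noteq> i"
      using v R(2) by blast
    then have "ext_force R s p f v = ext_force (trim R i x) s p2 f2 v"
      using top(2) by (simp add: ext_force_def f_def children_edges)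
    then show "ext_force R s p f v = 0"
      using S v by (simp add: sol_def)
  qed
  moreover have "\<forall>v. v \<noteq> i \<longrightarrow> p v = p2 v \<and> f v = f2 v"
    by (simp add: p_def f_def)
  ultimately show ?thesis
    using i by blast
qed

section \<open>Edges with conjugate stiffness\<close>

lemma turned_same: "turned \<theta> a a = mat a"
proof -
  define c s where cs: "c = complex_of_real (cos \<theta>)" "s = complex_of_real (sin \<theta>)"
  have "c * c + s * s = 1"
    unfolding cs of_real_mult[symmetric] of_real_add[symmetric] using sin_cos_squared_add3[of \<theta>] by simp
  then have cc: "(c * c + s * s) * a = a"
    by simp
  have "turned \<theta> a a = mat ((c * c + s * s) * a)"
    by (simp add: turned_def rot_def diag2_def mat2_simps flip: cs) (simp add: algebra_simps)
  then show ?thesis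
    unfolding cc .
qed

lemma turned_trace: "turned \<theta> a b $ 1 $ 1 + turned \<theta> a b $ 2 $ 2 = a + b"
proof -
  define c s where cs: "c = complex_of_real (cos \<theta>)" "s = complex_of_real (sin \<theta>)"
  have "c * c + s * s = 1"
    unfolding cs of_real_mult[symmetric] of_real_add[symmetric] using sin_cos_squared_add3[of \<theta>] by simp
  moreover have "turned \<theta> a b $ 1 $ 1 + turned \<theta> a b $ 2 $ 2 = (c * c + s * s) * (a + b)"
    by (simp add: turned_def rot_def diag2_def mat2_simps flip: cs) (simp add: algebra_simps)
  ultimately show ?thesis
    by simp
qed

text \<open>The trace of a power gives the eigenvalues, and on them every \<open>g\<close> is an affine function.\<close>

lemma turned_functional_calculus:
  fixes a b c d :: real
  assumes "turned \<theta> (of_real a) (of_real b) = turned \<phi> (of_real c) (of_real d)"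
  shows "turned \<theta> (g a) (g b) = turned \<phi> (g c) (g d)"
proof -
  have tr1: "complex_of_real a + of_real b = of_real c + of_real d"
    using assms turned_trace by metis
  have "turned \<theta> (of_real a * of_real a) (of_real b * of_real b) =
      turned \<phi> (of_real c * of_real c) (of_real d * of_real d)"
    using assms turned_mult by metis
  then have tr2: "complex_of_real a * of_real a + of_real b * of_real b = of_real c * of_real c + of_real d * of_real d"
    using turned_trace by metis
  have e: "a + b = c + d" "a * a + b * b = c * c + d * d"
    using tr1 tr2 by (simp_all flip: of_real_add of_real_mult)
  have "(a - c) * (a - d) = 0"
  proof -
    have "b = c + d - a"
      using e by simp
    with e(2) show ?thesis
      by (simp add: algebra_simps)
  qed
  then have cases: "a = c \<and> b = d \<or> a = d \<and> b = c"
    using e(1) by auto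
  show ?thesis
  proof (cases "a = b")
    case True
    then show ?thesis
      using cases by (auto simp: turned_same)
  next
    case False
    define \<beta> where "\<beta> = (g a - g b) / (of_real a - of_real b)"
    define \<alpha> where "\<alpha> = g a - \<beta> * of_real a"
    have "\<beta> * (of_real a - of_real b) = g a - g b"
      using False by (simp add: \<beta>_def)
    then have ab: "g a = \<alpha> + \<beta> * of_real a" "g b = \<alpha> + \<beta> * of_real b"
      by (simp_all add: \<alpha>_def algebra_simps)
    then have cd: "g c = \<alpha> + \<beta> * of_real c" "g d = \<alpha> + \<beta> * of_real d"
      using cases by auto
    have aff: "turned \<theta> (\<alpha> + \<beta> * x) (\<alpha> + \<beta> * y) = mat \<alpha> + mat \<beta> ** turned \<theta> x y" for \<theta> x y
      unfolding turned_same[of \<theta>, symmetric] turned_mult turned_add ..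
    show ?thesis
      unfolding ab cd aff assms ..
  qed
qed

text \<open>Conjugate impedances have the same spectrum and corresponding eigenspaces, so the
  rotation intertwines all functions of the velocities, the transfer matrices among them.\<close>

lemma efun_conj:
  assumes "\<And>a. rot q *v (efun R v of_real *v a) = efun R' v' of_real *v (rot q *v a)"
  shows "rot q *v (efun R v g *v a) = efun R' v' g *v (rot q *v a)"
proof -
  have "efun R' v' of_real *v x = turned (q + frame R v) (of_real (vel1 R v)) (of_real (vel2 R v)) *v x" for x
    using assms[of "rot (- q) *v x"] by (simp add: efun_def rot_turned_vec)
  then have "turned (frame R' v') (of_real (vel1 R' v')) (of_real (vel2 R' v')) =
      turned (q + frame R v) (of_real (vel1 R v)) (of_real (vel2 R v))"
    unfolding matrix_eq efun_def by blast
  then show ?thesis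
    unfolding efun_def rot_turned_vec by (metis turned_functional_calculus)
qed

lemma top_conj:
  assumes "\<And>a. rot q *v (efun R v of_real *v a) = efun R' v' of_real *v (rot q *v a)"
    and "elen R' v' = elen R v" "p' v' = rot q *v p v" "f' v' = rot q *v f v"
  shows "top_value R' s p' f' v' = rot q *v top_value R s p f v"
    and "top_force R' s p' f' v' = rot q *v top_force R s p f v"
  using assms(2-) by (simp_all add: top_value_def top_force_def matrix_vector_right_distrib efun_conj[OF assms(1)])

section \<open>Networks with the same boundary data are isomorphic\<close>

text \<open>A vertex with exactly one child has degree two. Comparing the impedances in the fixed
  frame of the plane includes the angle between the edges.\<close>

definition no_fictitious :: "'a rooted_net \<Rightarrow> bool" where
  "no_fictitious R \<longleftrightarrow> (\<forall>v\<in>edges R. \<forall>w. children R v = {w} \<longrightarrow> efun R w of_real \<noteq> efun R v of_real)"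

lemma bij_betw_replace:
  assumes "bij_betw \<phi> A A'" "C \<subseteq> A" "v \<notin> A - C" "v' \<notin> A' - \<phi> ` C"
  shows "bij_betw (\<phi>(v := v')) (insert v (A - C)) (insert v' (A' - \<phi> ` C))"
proof -
  have "\<phi> ` (A - C) = A' - \<phi> ` C"
    using assms(1,2) inj_on_image_set_diff[of \<phi> A A C] by (auto simp: bij_betw_def)
  then have 1: "bij_betw \<phi> (A - C) (A' - \<phi> ` C)"
    using assms(1) by (auto simp: bij_betw_def intro: inj_on_subset)
  have "\<phi> a = (\<phi>(v := v')) a" if "a \<in> A - C" for a
    using that assms(3) by auto
  from bij_betw_cong[THEN iffD1, OF this 1] have "bij_betw (\<phi>(v := v')) (A - C) (A' - \<phi> ` C)" .
  then show ?thesis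
    using notIn_Un_bij_betw[of v "A - C" "\<phi>(v := v')" "A' - \<phi> ` C"] assms(3,4) by simp
qed

text \<open>The angle \<open>q j\<close> turns the plane of the first tree into that of the second
  as seen from the leaf \<open>j\<close>; agreement of these angles is a conclusion, not an
  assumption.\<close>

locale paired_nets =
  fixes R :: "'a rooted_net" and R' :: "'b rooted_net" and \<phi> :: "'a \<Rightarrow> 'b" and q :: "'a \<Rightarrow> real"
  assumes R: "net R" "single_root R" "no_fictitious R"
    and R': "net R'" "single_root R'" "no_fictitious R'"
    and \<phi>: "bij_betw \<phi> (leaves R) (leaves R')"
    and data: "\<And>t. t \<ge> 0 \<Longrightarrow> rot_data R (leaves R) R' (leaves R') \<phi> q (of_real t)"
begin

lemma Re_square: "Re ((complex_of_real t)\<^sup>2) \<ge> 0"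
  by (simp flip: of_real_power)

lemma \<phi>_leaf: "i \<in> leaves R \<Longrightarrow> \<phi> i \<in> leaves R'"
  using \<phi> by (auto simp: bij_betw_def)

lemma leaf_edge: "i \<in> leaves R \<Longrightarrow> i \<in> edges R" "i' \<in> leaves R' \<Longrightarrow> i' \<in> edges R'"
  by (auto simp: leaves_def)

lemma paired_sym: "paired_nets R' R (inv_into (leaves R) \<phi>) (\<lambda>j. - q (inv_into (leaves R) \<phi> j))"
proof
  show "bij_betw (inv_into (leaves R) \<phi>) (leaves R') (leaves R)"
    using \<phi> by (rule bij_betw_inv_into)
  show "rot_data R' (leaves R') R (leaves R) (inv_into (leaves R) \<phi>) (\<lambda>j. - q (inv_into (leaves R) \<phi> j)) (of_real t)"
    if "t \<ge> 0" for t
    by (rule rot_data_sym[OF R(1) order_refl leaves_edges R'(1) order_refl leaves_edges \<phi> Re_square data[OF that]])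
      (use \<phi> in \<open>auto simp: bij_betw_def\<close>)
qed (use R R' in auto)

lemma leaf_conj:
  assumes "i \<in> leaves R"
  shows "rot (q i) *v (efun R i of_real *v a) = efun R' (\<phi> i) of_real *v (rot (q i) *v a)"
  by (rule same_data_conj[OF R(1) order_refl leaves_edges R'(1) order_refl leaves_edges \<phi> data assms \<phi>_leaf[OF assms]])

lemma forward:
  assumes "sol R (leaves R) (of_real t) p f" "t \<ge> 0"
  obtains p' f' where "sol R' (leaves R') (of_real t) p' f'"
    "\<And>j. j \<in> leaves R \<Longrightarrow> p' (\<phi> j) = rot (q j) *v p j"
    "\<And>j. j \<in> leaves R \<Longrightarrow> f' (\<phi> j) = rot (q j) *v f j"
proof -
  have "\<exists>p' f'. sol R' (leaves R') (of_real t) p' f' \<and>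
      (\<forall>j\<in>leaves R. p' (\<phi> j) = rot (q j) *v p j \<and>
        ext_force R' (of_real t) p' f' (\<phi> j) = rot (q j) *v ext_force R (of_real t) p f j)"
    using data[OF assms(2)] assms(1) unfolding same_data_def by blast
  then obtain p' f' where *: "sol R' (leaves R') (of_real t) p' f'"
    "\<And>j. j \<in> leaves R \<Longrightarrow> p' (\<phi> j) = rot (q j) *v p j"
    "\<And>j. j \<in> leaves R \<Longrightarrow> ext_force R' (of_real t) p' f' (\<phi> j) = rot (q j) *v ext_force R (of_real t) p f j"
    by blast
  have "f' (\<phi> j) = rot (q j) *v f j" if "j \<in> leaves R" for j
    using *(3)[OF that] that \<phi>_leaf[OF that] by (simp add: ext_force_def leaves_def)
  with * show ?thesis
    using that by blast
qed

text \<open>Remove the shorter edge completely and the same length from the longer one. The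
  shortened leaf \<open>i\<close> is then paired with the upper end \<open>y\<close> of the removed
  edge, and \<open>y\<close> turns out to be fictitious or at the base.\<close>

lemma leaf_length_not_less:
  assumes i: "i \<in> leaves R"
  shows "\<not> elen R' (\<phi> i) < elen R i"
proof
  assume less: "elen R' (\<phi> i) < elen R i"
  define i' where "i' = \<phi> i"
  define x where "x = elen R' i'"
  define R2 where "R2 = trim R i x"
  have i': "i' \<in> leaves R'" "i' \<in> edges R'" "i \<in> edges R"
    using i \<phi>_leaf leaf_edge by (auto simp: i'_def)
  have R2: "net R2" "single_root R2" "leaves R2 = leaves R"
    using R less by (simp_all add: R2_def x_def i'_def net_trim single_root_trim)
  \<comment> \<open>The impedances are conjugate under \<open>rot (q i)\<close>, so pieces of equal
    length have conjugate transfers: the state at the cut point of i is that at the top of the edge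
    of i'.\<close>
  have cut: "\<exists>p' f'. sol R' (leaves R') (of_real t) p' f' \<and>
      top_value R' (of_real t) p' f' i' = rot (q i) *v p2 i \<and>
      top_force R' (of_real t) p' f' i' = rot (q i) *v f2 i \<and>
      (\<forall>j\<in>leaves R - {i}. p' (\<phi> j) = rot (q j) *v p2 j \<and> f' (\<phi> j) = rot (q j) *v f2 j)"
    if S2: "sol R2 (leaves R) (of_real t) p2 f2" and t: "t \<ge> 0" for t p2 f2
  proof -
    obtain p f where S: "sol R (leaves R) (of_real t) p f" "\<And>v. v \<noteq> i \<Longrightarrow> p v = p2 v \<and> f v = f2 v"
      "p2 i = efun R i (tc (of_real t) x) *v p i + efun R i (ts (of_real t) x) *v f i"
      "f2 i = efun R i (tz (of_real t) x) *v p i + efun R i (tc (of_real t) x) *v f i"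
      using sol_untrim[OF R(1) i S2[unfolded R2_def]] by blast
    obtain p' f' where S': "sol R' (leaves R') (of_real t) p' f'"
      "\<And>j. j \<in> leaves R \<Longrightarrow> p' (\<phi> j) = rot (q j) *v p j"
      "\<And>j. j \<in> leaves R \<Longrightarrow> f' (\<phi> j) = rot (q j) *v f j"
      using forward[OF S(1) t] by blast
    note c = efun_conj[of "q i" R i R' i', OF leaf_conj[OF i, folded i'_def]]
    have "top_value R' (of_real t) p' f' i' = rot (q i) *v p2 i"
      "top_force R' (of_real t) p' f' i' = rot (q i) *v f2 i"
      using S'(2,3)[OF i, folded i'_def] unfolding S(3,4) top_value_def top_force_def x_def
      by (simp_all add: c matrix_vector_right_distrib)
    moreover have "\<forall>j\<in>leaves R - {i}. p' (\<phi> j) = rot (q j) *v p2 j \<and> f' (\<phi> j) = rot (q j) *v f2 j"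
      using S'(2,3) S(2) by simp
    ultimately show ?thesis
      using S'(1) by blast
  qed
  show False
  proof (cases "parent R' i' = base R'")
    \<comment> \<open>The cut point can be displaced at will, whereas the base is at rest.\<close>
    case True
    obtain p2 f2 where S2: "sol R2 (leaves R) (of_real 1) p2 f2" "\<forall>v\<in>leaves R. p2 v = (\<lambda>_. circ) v"
      using dirichlet_exists[OF R2(1) Re_square[of 1], of "leaves R" "\<lambda>_. circ"] leaves_edges[of R2] R2(3) by auto
    have "1 \<ge> (0::real)"
      by simp
    then obtain p' f' where "sol R' (leaves R') (of_real 1) p' f'"
      "top_value R' (of_real 1) p' f' i' = rot (q i) *v p2 i"
      using cut[OF S2(1)] by blast
    then have "rot (q i) *v circ = 0"
      using True i' i S2(2) by (simp add: sol_def)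
    then show False
      using circ_nonzero rot_cancel(2)[of "q i" circ] by simp
  next
    case False
    define y where "y = parent R' i'"
    define R1 where "R1 = prune R' {i'}"
    define B1 where "B1 = insert y (leaves R' - {i'})"
    define \<phi>1 where "\<phi>1 = \<phi>(i := y)"
    have y: "y \<in> edges R'" "y \<notin> leaves R'" "i' \<in> children R' y"
      using net_parent[OF R'(1) i'(2) False] parent_not_leaf[OF i'(2)] i'(2)
      by (auto simp: y_def children_def)
    have R1: "net R1" "leaves R1 \<subseteq> B1" "B1 \<subseteq> edges R1"
      using net_prune[OF R'(1), of "{i'}"] leaves_prune[of "{i'}" R'] i' y leaves_edges[of R']
      by (auto simp: R1_def B1_def y_def)
    have b: "bij_betw \<phi>1 (leaves R2) B1"
    proof -
      have "\<phi> ` {i} = {i'}" "insert i (leaves R - {i}) = leaves R2"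
        using i R2 by (auto simp: i'_def)
      then show ?thesis
        using bij_betw_replace[OF \<phi>, of "{i}" i y] i y by (simp add: B1_def \<phi>1_def)
    qed
    have d: "rot_data R2 (leaves R2) R1 B1 \<phi>1 q (of_real t)" if t: "t \<ge> 0" for t
      unfolding same_data_def
    proof (intro allI impI)
      fix p2 f2 assume "sol R2 (leaves R2) (of_real t) p2 f2"
      then have S2: "sol R2 (leaves R) (of_real t) p2 f2"
        by (simp add: R2)
      obtain p' f' where S': "sol R' (leaves R') (of_real t) p' f'"
        "top_value R' (of_real t) p' f' i' = rot (q i) *v p2 i"
        "top_force R' (of_real t) p' f' i' = rot (q i) *v f2 i"
        "\<And>j. j \<in> leaves R - {i} \<Longrightarrow> p' (\<phi> j) = rot (q j) *v p2 j \<and> f' (\<phi> j) = rot (q j) *v f2 j"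
        using cut[OF S2 t] by blast
      have S1: "sol R1 B1 (of_real t) p' f'"
        using sol_prune[OF R'(1) S'(1), of "{i'}"] i' by (simp add: R1_def B1_def y_def)
      have f2: "ext_force R2 (of_real t) p2 f2 j = f2 j" if "j \<in> leaves R2" for j
        using that by (simp add: ext_force_def leaves_def)
      have py: "p' y = rot (q i) *v p2 i"
        using sol_child[OF S'(1) y(3,1)] S'(2) by simp
      have "children R' y \<inter> {i'} = {i'}"
        using y(3) by blast
      then have fy: "ext_force R1 (of_real t) p' f' y = rot (q i) *v f2 i"
        using S'(1,3) y unfolding R1_def ext_force_prune[OF R'(1)] by (simp add: sol_def)
      have fj: "ext_force R1 (of_real t) p' f' (\<phi> j) = f' (\<phi> j)" if "j \<in> leaves R" for j
        using \<phi>_leaf[OF that] by (simp add: ext_force_def leaves_def R1_def)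
      show "\<exists>p' f'. sol R1 B1 (of_real t) p' f' \<and>
        (\<forall>j\<in>leaves R2. p' (\<phi>1 j) = rot (q j) *v p2 j \<and>
          ext_force R1 (of_real t) p' f' (\<phi>1 j) = rot (q j) *v ext_force R2 (of_real t) p2 f2 j)"
      proof (intro exI conjI ballI)
        show "sol R1 B1 (of_real t) p' f'"
          by (rule S1)
        fix j assume j: "j \<in> leaves R2"
        show "p' (\<phi>1 j) = rot (q j) *v p2 j"
          using py S'(4)[of j] j R2(3) by (auto simp: \<phi>1_def)
        show "ext_force R1 (of_real t) p' f' (\<phi>1 j) = rot (q j) *v ext_force R2 (of_real t) p2 f2 j"
          unfolding f2[OF j] using fy fj[of j] S'(4)[of j] j R2(3) by (auto simp: \<phi>1_def)
      qed
    qed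
    \<comment> \<open>So y had no child except i'. The edge above y then has the impedance of i up
      to the rotation \<open>rot (q i)\<close>, and so does the edge of i'.\<close>
    have "children R1 (\<phi>1 i) = {}"
      by (rule leaf_not_inner[OF R2(1,2) R1 b d]) (use i R2 in auto)
    then have ch: "children R' y = {i'}" and yl: "y \<in> leaves R1"
      using y i' R1 by (auto simp: \<phi>1_def R1_def leaves_def)
    have "rot (q i) *v (efun R2 i of_real *v a) = efun R1 (\<phi>1 i) of_real *v (rot (q i) *v a)" for a
      by (rule same_data_conj[OF R2(1) order_refl leaves_edges R1 b d]) (use i R2 yl in \<open>auto simp: \<phi>1_def\<close>)
    then have "efun R' y of_real *v (rot (q i) *v a) = efun R' i' of_real *v (rot (q i) *v a)" for a
      using leaf_conj[OF i] by (simp add: R2_def R1_def \<phi>1_def i'_def)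
    then have "efun R' y of_real *v a = efun R' i' of_real *v a" for a
      using rot_cancel(1)[of "q i" a] by metis
    then have "efun R' y of_real = efun R' i' of_real"
      unfolding matrix_eq by blast
    then show False
      using R'(3) y ch unfolding no_fictitious_def by metis
  qed
qed

lemma leaf_length: "i \<in> leaves R \<Longrightarrow> elen R' (\<phi> i) = elen R i"
proof -
  assume i: "i \<in> leaves R"
  interpret sym: paired_nets R' R "inv_into (leaves R) \<phi>" "\<lambda>j. - q (inv_into (leaves R) \<phi> j)"
    by (rule paired_sym)
  have "inv_into (leaves R) \<phi> (\<phi> i) = i"
    using i \<phi> by (simp add: bij_betw_def)
  then show ?thesis
    using leaf_length_not_less[OF i] sym.leaf_length_not_less[OF \<phi>_leaf[OF i]] by simp
qed

lemma forward_top: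
  assumes "sol R (leaves R) (of_real t) p f" "t \<ge> 0"
  obtains p' f' where "sol R' (leaves R') (of_real t) p' f'"
    "\<And>j. j \<in> leaves R \<Longrightarrow> p' (\<phi> j) = rot (q j) *v p j"
    "\<And>j. j \<in> leaves R \<Longrightarrow> f' (\<phi> j) = rot (q j) *v f j"
    "\<And>j. j \<in> leaves R \<Longrightarrow> top_value R' (of_real t) p' f' (\<phi> j) = rot (q j) *v top_value R (of_real t) p f j"
    "\<And>j. j \<in> leaves R \<Longrightarrow> top_force R' (of_real t) p' f' (\<phi> j) = rot (q j) *v top_force R (of_real t) p f j"
proof -
  obtain p' f' where S: "sol R' (leaves R') (of_real t) p' f'"
    "\<And>j. j \<in> leaves R \<Longrightarrow> p' (\<phi> j) = rot (q j) *v p j"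
    "\<And>j. j \<in> leaves R \<Longrightarrow> f' (\<phi> j) = rot (q j) *v f j"
    using forward[OF assms] by blast
  have "top_value R' (of_real t) p' f' (\<phi> j) = rot (q j) *v top_value R (of_real t) p f j"
    "top_force R' (of_real t) p' f' (\<phi> j) = rot (q j) *v top_force R (of_real t) p f j" if j: "j \<in> leaves R" for j
    using top_conj[of "q j" R j R' "\<phi> j" p' p f' f, OF leaf_conj[OF j] leaf_length[OF j] S(2)[OF j] S(3)[OF j]] by auto
  then show ?thesis
    using that[OF S] by blast
qed

text \<open>Without the edges in \<open>D\<close> their upper ends are boundary vertices and can be
  displaced at will; the edges are then put back by \<open>sol_extend\<close>.\<close>

lemma prescribe_inner:
  assumes "D \<subseteq> leaves R" "parent R ` D \<subseteq> edges R"
  obtains p f where "sol R (leaves R) (of_real 1) p f" "\<And>v. v \<in> parent R ` D \<Longrightarrow> p v = b v"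
proof -
  have pd: "parent R ` D \<inter> leaves R = {}"
    using assms(1) leaves_edges[of R] parent_not_leaf[of _ R] by blast
  have "\<exists>p f. sol (prune R D) (leaves R - D \<union> parent R ` D) (of_real 1) p f \<and>
      (\<forall>v\<in>leaves R - D \<union> parent R ` D. p v = b v)"
    by (rule dirichlet_exists[OF net_prune[OF R(1) assms(1)] Re_square leaves_prune[OF assms(1)]])
      (use assms pd leaves_edges[of R] in auto)
  then obtain p1 f1 where S1: "sol (prune R D) (leaves R - D \<union> parent R ` D) (of_real 1) p1 f1"
    "\<And>v. v \<in> parent R ` D \<Longrightarrow> p1 v = b v"
    by blast
  have "parent R ` D \<subseteq> edges R - leaves R"
    using assms(2) pd by blast
  from sol_extend[OF R(1) assms(1) this S1(1)]
  obtain p f where S: "sol R (leaves R \<union> D) (of_real 1) p f" "\<And>v. v \<notin> D \<Longrightarrow> p v = p1 v"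
    by blast
  have LD: "leaves R \<union> D = leaves R"
    using assms(1) by blast
  have b: "p v = b v" if v: "v \<in> parent R ` D" for v
  proof -
    have "v \<notin> D"
      using v pd assms(1) by blast
    then show ?thesis
      using S(2)[of v] S1(2)[OF v] by simp
  qed
  show ?thesis
    by (rule that[OF S(1)[unfolded LD] b])
qed

text \<open>The parent of \<open>i\<close> can be displaced, the base cannot, and the states at the
  tops of paired edges agree up to a rotation.\<close>

lemma parent_not_base:
  assumes i: "i \<in> leaves R" "parent R i \<noteq> base R"
  shows "parent R' (\<phi> i) \<noteq> base R'"
proof
  assume *: "parent R' (\<phi> i) = base R'"
  have ie: "i \<in> edges R" "parent R i \<in> edges R"
    using i leaf_edge net_parent[OF R(1)] by blast+
  obtain p f where S: "sol R (leaves R) (of_real 1) p f" "p (parent R i) = circ"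
    using prescribe_inner[of "{i}" "\<lambda>_. circ"] i ie by auto
  obtain p' f' where S': "sol R' (leaves R') (of_real 1) p' f'"
    "top_value R' (of_real 1) p' f' (\<phi> i) = rot (q i) *v top_value R (of_real 1) p f i"
    using forward_top[OF S(1)] i(1) by (metis zero_le_one)
  have "top_value R (of_real 1) p f i = circ"
    using S ie i(2) by (simp add: sol_def)
  moreover have "top_value R' (of_real 1) p' f' (\<phi> i) = 0"
    using S'(1) * leaf_edge(2)[OF \<phi>_leaf[OF i(1)]] by (simp add: sol_def)
  ultimately show False
    using S'(2) circ_nonzero rot_cancel(2)[of "q i" circ] by simp
qed

text \<open>At the common parent in the second tree the two paired edges have the same displacement.
  Displacing only one of two different parents in the first tree would violate this; with a common
  parent, its arbitrary displacement shows that both rotations agree.\<close>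

lemma siblings:
  assumes ij: "i \<in> leaves R" "j \<in> leaves R" "parent R i \<noteq> base R" "parent R' (\<phi> i) = parent R' (\<phi> j)"
  shows "parent R i = parent R j" "rot (q i) = rot (q j)"
proof -
  interpret sym: paired_nets R' R "inv_into (leaves R) \<phi>" "\<lambda>j. - q (inv_into (leaves R) \<phi> j)"
    by (rule paired_sym)
  have inv: "inv_into (leaves R) \<phi> (\<phi> k) = k" if "k \<in> leaves R" for k
    using that \<phi> by (simp add: bij_betw_def)
  have "parent R' (\<phi> j) \<noteq> base R'"
    using parent_not_base[OF ij(1,3)] ij(4) by simp
  then have pj: "parent R j \<noteq> base R"
    using sym.parent_not_base[OF \<phi>_leaf[OF ij(2)]] inv[OF ij(2)] by simp
  have e: "i \<in> edges R" "j \<in> edges R" "parent R i \<in> edges R" "parent R j \<in> edges R"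
    using ij(1-3) pj leaf_edge(1) net_parent[OF R(1)] by blast+
  have key: "rot (q i) *v b (parent R i) = rot (q j) *v b (parent R j)" for b
  proof -
    obtain p f where S: "sol R (leaves R) (of_real 1) p f" "p (parent R i) = b (parent R i)" "p (parent R j) = b (parent R j)"
    proof (rule prescribe_inner[of "{i, j}" b])
      show "{i, j} \<subseteq> leaves R" "parent R ` {i, j} \<subseteq> edges R"
        using ij e by auto
    qed (use that in auto)
    obtain p' f' where S': "sol R' (leaves R') (of_real 1) p' f'"
      "\<And>j. j \<in> leaves R \<Longrightarrow> top_value R' (of_real 1) p' f' (\<phi> j) = rot (q j) *v top_value R (of_real 1) p f j"
      using forward_top[OF S(1)] by (metis zero_le_one)
    have "top_value R' (of_real 1) p' f' (\<phi> i) = top_value R' (of_real 1) p' f' (\<phi> j)"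
      using S'(1) ij(4) leaf_edge(2)[OF \<phi>_leaf] ij(1,2) by (simp add: sol_def)
    moreover have "top_value R (of_real 1) p f i = b (parent R i)" "top_value R (of_real 1) p f j = b (parent R j)"
      using S e ij(3) pj by (simp_all add: sol_def)
    ultimately show ?thesis
      using S'(2)[OF ij(1)] S'(2)[OF ij(2)] by simp
  qed
  show eq: "parent R i = parent R j"
  proof (rule ccontr)
    assume "parent R i \<noteq> parent R j"
    then have "rot (q i) *v circ = 0"
      using key[of "\<lambda>v. if v = parent R i then circ else 0"] by simp
    then show False
      using circ_nonzero rot_cancel(2)[of "q i" circ] by simp
  qed
  show "rot (q i) = rot (q j)"
    unfolding matrix_eq
  proof
    fix x show "rot (q i) *v x = rot (q j) *v x"
      using key[of "\<lambda>_. x"] by simp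
  qed
qed

end

section \<open>From the leaves to the whole tree\<close>

text \<open>A single rotation by \<open>c\<close> now relates the two planes. The angles
  \<open>q v\<close> equal \<open>c\<close> only modulo full turns, hence the comparison of rotation
  matrices.\<close>

definition isomorphic_nets where
  "isomorphic_nets R R' \<phi> q F c \<longleftrightarrow> bij_betw F (edges R) (edges R') \<and>
     (\<forall>v\<in>leaves R. F v = \<phi> v \<and> rot (q v) = rot c) \<and>
     (\<forall>v\<in>edges R. (if parent R v = base R then parent R' (F v) = base R' else parent R' (F v) = F (parent R v)) \<and>
        elen R' (F v) = elen R v \<and>
        (\<forall>a. rot c *v (efun R v of_real *v a) = efun R' (F v) of_real *v (rot c *v a)))"

lemma cherry_exists:
  assumes "net R" "v \<in> edges R" "v \<notin> leaves R"
  shows "\<exists>u\<in>edges R. children R u \<noteq> {} \<and> children R u \<subseteq> leaves R"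
  using assms
proof (induction v rule: net_induct_up)
  case (step v)
  show ?case
  proof (cases "children R v \<subseteq> leaves R")
    case True
    then show ?thesis
      using step by (auto simp: leaves_def)
  next
    case False
    then show ?thesis
      using step(2) by blast
  qed
qed

lemma single_edge:
  assumes "net R" "single_root R" "i \<in> leaves R" "parent R i = base R"
  shows "edges R = {i}"
proof -
  have "v = i" if v: "v \<in> edges R" for v
  proof -
    have "i \<in> children R (base R)"
      using assms(3,4) by (auto simp: leaves_def children_def)
    then have "v \<in> subtree R i"
      using top_ancestor[OF assms(1) v] assms(2) by (auto simp: single_root_def)
    then show ?thesis
      using subtree_child_exists[of v R i] assms(3) by (auto simp: leaves_def)
  qed
  then show ?thesis
    using assms(3) by (auto simp: leaves_def)
qed

lemma isomorphism_exists:
  assumes "paired_nets R R' \<phi> q" "edges R \<noteq> {}"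
  shows "\<exists>F c. isomorphic_nets R R' \<phi> q F c"
  using assms
proof (induction "card (edges R)" arbitrary: R R' \<phi> q rule: less_induct)
  case less
  interpret paired_nets R R' \<phi> q
    by (rule less.prems)
  interpret sym: paired_nets R' R "inv_into (leaves R) \<phi>" "\<lambda>j. - q (inv_into (leaves R) \<phi> j)"
    by (rule paired_sym)
  have inv: "inv_into (leaves R) \<phi> (\<phi> k) = k" if "k \<in> leaves R" for k
    using that \<phi> by (simp add: bij_betw_def)
  show ?case
  proof (cases "\<exists>i\<in>leaves R. parent R i = base R")
    case True
    then obtain i where i: "i \<in> leaves R" "parent R i = base R"
      by blast
    have p: "parent R' (\<phi> i) = base R'"
      using sym.parent_not_base[OF \<phi>_leaf[OF i(1)]] inv[OF i(1)] i(2) by auto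
    have E: "edges R = {i}" "edges R' = {\<phi> i}"
      using single_edge[OF R(1,2) i] single_edge[OF R'(1,2) \<phi>_leaf[OF i(1)] p] by auto
    then have "leaves R = {i}"
      using i(1) leaves_edges[of R] by blast
    then have "isomorphic_nets R R' \<phi> q \<phi> (q i)"
      using E i p leaf_length[OF i(1)] leaf_conj[OF i(1)]
      by (simp add: isomorphic_nets_def bij_betw_def)
    then show ?thesis
      by blast
  next
    case False
    obtain x where x: "x \<in> edges R"
      using less.prems(2) by blast
    obtain b where b: "b \<in> children R (base R)"
      using top_ancestor[OF R(1) x] by blast
    then have "b \<in> edges R" "b \<notin> leaves R"
      using False by (auto simp: children_def)
    then obtain v where v: "v \<in> edges R" "children R v \<noteq> {}" "children R v \<subseteq> leaves R"
      using cherry_exists[OF R(1)] by blast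
    define C where "C = children R v"
    obtain i where iC: "i \<in> C"
      using v(2) by (auto simp: C_def)
    have C: "C \<subseteq> leaves R" "C \<subseteq> edges R" "\<And>j. j \<in> C \<Longrightarrow> parent R j = v" "\<And>j. j \<in> edges R \<Longrightarrow> parent R j = v \<Longrightarrow> j \<in> C"
      using v leaves_edges[of R] by (auto simp: C_def children_def)
    have vb: "v \<noteq> base R" and vl: "v \<notin> leaves R" and vC: "v \<notin> C"
      using v C(1) base_notin_edges[of R] by (auto simp: leaves_def)
    have il: "i \<in> leaves R" and jl: "\<And>j. j \<in> C \<Longrightarrow> j \<in> leaves R"
      using iC C(1) by auto
    define C' where "C' = \<phi> ` C"
    define v' where "v' = parent R' (\<phi> i)"
    \<comment> \<open>Siblings are compared in both directions: the reversed pairing gives the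
      common parent in the second tree, the original one gives the equal rotations.\<close>
    have pj: "parent R' (\<phi> j) = v'" "rot (q j) = rot (q i)" if j: "j \<in> C" for j
    proof -
      have nb: "parent R j \<noteq> base R" "parent R i \<noteq> base R"
        using C(3) j iC vb by auto
      show eq: "parent R' (\<phi> j) = v'"
        unfolding v'_def
        by (rule sym.siblings(1)[OF \<phi>_leaf[OF jl[OF j]] \<phi>_leaf[OF il] parent_not_base[OF jl[OF j] nb(1)]])
          (simp add: inv jl[OF j] il C(3) j iC)
      show "rot (q j) = rot (q i)"
        by (rule siblings(2)[OF jl[OF j] il nb(1)]) (use eq in \<open>simp add: v'_def\<close>)
    qed
    have "v' \<noteq> base R'"
      using parent_not_base[OF il] C(3)[OF iC] vb by (simp add: v'_def)
    then have v': "v' \<in> edges R'" "v' \<notin> leaves R'"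
      using net_parent[OF R'(1) leaf_edge(2)[OF \<phi>_leaf[OF il]]] parent_not_leaf[OF leaf_edge(2)[OF \<phi>_leaf[OF il]]]
      by (auto simp: v'_def)
    have C': "C' \<subseteq> leaves R'" "C' \<subseteq> edges R'" "parent R' ` C' = {v'}" "children R' v' \<inter> C' = C'" "v' \<notin> C'"
    proof -
      show 1: "C' \<subseteq> leaves R'"
        using \<phi>_leaf jl by (auto simp: C'_def)
      then show 2: "C' \<subseteq> edges R'"
        using leaves_edges[of R'] by blast
      show "parent R' ` C' = {v'}"
        using pj(1) iC by (auto simp: C'_def image_image)
      show "children R' v' \<inter> C' = C'"
        using pj(1) 2 by (auto simp: C'_def children_def)
      show "v' \<notin> C'"
        using v' 1 by blast
    qed
    have pC: "parent R ` C = {v}"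
      using C(3) iC by auto
    define R1 where "R1 = prune R C"
    define R1' where "R1' = prune R' C'"
    \<comment> \<open>After removal of C the vertex v is a leaf paired with v', and its angle is the
      common angle of the removed leaves.\<close>
    define \<phi>1 where "\<phi>1 = \<phi>(v := v')"
    define q1 where "q1 = q(v := q i)"
    define B' where "B' = insert v' (leaves R' - C')"
    have ch1: "children R1 u = (if u = v then {} else children R u)" for u
      using C(3) by (auto simp: R1_def C_def children_def)
    have L1: "leaves R1 = insert v (leaves R - C)"
      using v vC ch1 by (auto simp: leaves_def R1_def)
    have R1: "net R1" "single_root R1"
      using net_prune[OF R(1) C(1)] single_root_prune[OF R(2)] by (simp_all add: R1_def)
    have R1': "net R1'" "single_root R1'" "leaves R1' \<subseteq> B'" "B' \<subseteq> edges R1'"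
      using net_prune[OF R'(1) C'(1)] single_root_prune[OF R'(2)] leaves_prune[OF C'(1)] C' v' leaves_edges[of R']
      by (auto simp: R1'_def B'_def)
    have b1: "bij_betw \<phi>1 (leaves R1) B'"
      unfolding L1 B'_def \<phi>1_def C'_def
      by (rule bij_betw_replace[OF \<phi> C(1)]) (use vl v' in auto)
    \<comment> \<open>A solution on the pruned tree is extended through C, carried to the second
      tree and pruned there. The forces from C are all turned by the same rotation, so their sum at
      v matches the external force at v'.\<close>
    have d: "rot_data R1 (leaves R1) R1' B' \<phi>1 q1 (of_real t)" if t: "t \<ge> 0" for t
      unfolding same_data_def
    proof (intro allI impI)
      fix p1 f1 assume S1: "sol R1 (leaves R1) (of_real t) p1 f1"
      have "leaves R - C \<union> parent R ` C = leaves R1"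
        using pC L1 by auto
      then have "\<exists>p f. sol R (leaves R \<union> C) (of_real t) p f \<and> (\<forall>v. v \<notin> C \<longrightarrow> p v = p1 v \<and> f v = f1 v)"
        using S1 v(1) vl pC by (intro sol_extend[OF R(1) C(1)]) (auto simp: R1_def)
      moreover have "leaves R \<union> C = leaves R"
        using C(1) by blast
      ultimately obtain p f where S: "sol R (leaves R) (of_real t) p f" "\<And>v. v \<notin> C \<Longrightarrow> p v = p1 v \<and> f v = f1 v"
        by auto
      obtain p' f' where S': "sol R' (leaves R') (of_real t) p' f'"
        "\<And>j. j \<in> leaves R \<Longrightarrow> p' (\<phi> j) = rot (q j) *v p j"
        "\<And>j. j \<in> leaves R \<Longrightarrow> f' (\<phi> j) = rot (q j) *v f j"
        "\<And>j. j \<in> leaves R \<Longrightarrow> top_value R' (of_real t) p' f' (\<phi> j) = rot (q j) *v top_value R (of_real t) p f j"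
        "\<And>j. j \<in> leaves R \<Longrightarrow> top_force R' (of_real t) p' f' (\<phi> j) = rot (q j) *v top_force R (of_real t) p f j"
        using forward_top[OF S(1) t] by blast
      have "leaves R' - C' \<union> parent R' ` C' = B'"
        using C'(3) by (auto simp: B'_def)
      then have S1': "sol R1' B' (of_real t) p' f'"
        using sol_prune[OF R'(1) S'(1) C'(1)] by (simp add: R1'_def)
      have "\<phi> i \<in> children R' v'"
        using C'(4) iC by (auto simp: C'_def)
      then have pv: "p' v' = rot (q i) *v p1 v"
        using sol_child[OF S'(1) _ v'(1), of "\<phi> i"] S'(4)[OF il] sol_child[OF S(1) _ v(1), of i] iC S(2)[OF vC]
        by (simp add: C_def)
      have "f' v' - (\<Sum>w\<in>children R' v'. top_force R' (of_real t) p' f' w) = 0"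
        using sol_balance[OF S'(1) v'] by simp
      then have "ext_force R1' (of_real t) p' f' v' = (\<Sum>w\<in>C'. top_force R' (of_real t) p' f' w)"
        unfolding R1'_def ext_force_prune[OF R'(1)] C'(4) by (simp add: ext_force_def)
      also have "\<dots> = (\<Sum>j\<in>C. top_force R' (of_real t) p' f' (\<phi> j))"
        unfolding C'_def by (rule sum.reindex_cong[of \<phi> C]) (use \<phi> C(1) in \<open>auto simp: bij_betw_def intro: inj_on_subset\<close>)
      also have "\<dots> = (\<Sum>j\<in>C. rot (q i) *v top_force R (of_real t) p f j)"
        by (rule sum.cong) (simp_all add: S'(5) jl pj(2))
      also have "\<dots> = rot (q i) *v (\<Sum>j\<in>C. top_force R (of_real t) p f j)"
        by (simp add: linear_sum[OF matrix_vector_mul_linear])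
      also have "(\<Sum>j\<in>C. top_force R (of_real t) p f j) = f1 v"
        using sol_balance[OF S(1) v(1) vl] S(2)[OF vC] by (simp add: C_def)
      finally have fv: "ext_force R1' (of_real t) p' f' v' = rot (q i) *v f1 v" .
      show "\<exists>p' f'. sol R1' B' (of_real t) p' f' \<and>
        (\<forall>j\<in>leaves R1. p' (\<phi>1 j) = rot (q1 j) *v p1 j \<and>
          ext_force R1' (of_real t) p' f' (\<phi>1 j) = rot (q1 j) *v ext_force R1 (of_real t) p1 f1 j)"
      proof (intro exI conjI ballI)
        show "sol R1' B' (of_real t) p' f'"
          by (rule S1')
        fix j assume j: "j \<in> leaves R1"
        then have ej: "ext_force R1 (of_real t) p1 f1 j = f1 j"
          by (simp add: ext_force_def leaves_def)
        have "p' (\<phi>1 j) = rot (q1 j) *v p1 j \<and> ext_force R1' (of_real t) p' f' (\<phi>1 j) = rot (q1 j) *v f1 j"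
        proof (cases "j = v")
          case True
          then show ?thesis
            using pv fv by (simp add: \<phi>1_def q1_def)
        next
          case False
          then have jR: "j \<in> leaves R" "j \<notin> C"
            using j L1 by auto
          have "ext_force R1' (of_real t) p' f' (\<phi> j) = f' (\<phi> j)"
            using \<phi>_leaf[OF jR(1)] by (simp add: ext_force_def leaves_def R1'_def)
          then show ?thesis
            using S'(2,3)[OF jR(1)] S(2)[OF jR(2)] False by (simp add: \<phi>1_def q1_def)
        qed
        then show "p' (\<phi>1 j) = rot (q1 j) *v p1 j"
          "ext_force R1' (of_real t) p' f' (\<phi>1 j) = rot (q1 j) *v ext_force R1 (of_real t) p1 f1 j"
          unfolding ej by auto
      qed
    qed
    \<comment> \<open>Up to here v' might have had children outside C'; a leaf cannot be paired with
      such an inner vertex.\<close>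
    have "children R1' (\<phi>1 v) = {}"
      by (rule leaf_not_inner[OF R1 R1'(1,3,4) b1 d]) (auto simp: L1)
    then have chv': "children R1' v' = {}"
      by (simp add: \<phi>1_def)
    have ch1': "children R1' u = (if u = v' then {} else children R' u)" for u
      using chv' C'(3) by (auto simp: R1'_def children_def)
    have L1': "leaves R1' = B'"
      using R1'(3) ch1' C' v' by (auto simp: B'_def leaves_def R1'_def)
    \<comment> \<open>Only v and v' lose children, and they lose all of them, so no new vertex of
      degree two appears.\<close>
    have nf: "no_fictitious R1" "no_fictitious R1'"
      using R(3) R'(3) ch1 ch1' by (auto simp: no_fictitious_def R1_def R1'_def split: if_splits)
    have pn: "paired_nets R1 R1' \<phi>1 q1"
      by unfold_locales (use R1 R1' nf b1 d L1' in auto)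
    have "card (edges R1) < card (edges R)"
      unfolding R1_def edges_prune by (rule psubset_card_mono) (use R(1) C(2) iC in auto)
    moreover have "edges R1 \<noteq> {}"
      using v(1) vC by (auto simp: R1_def)
    ultimately obtain F1 c where F1: "isomorphic_nets R1 R1' \<phi>1 q1 F1 c"
      using less.hyps[OF _ pn] by blast
    have F1b: "bij_betw F1 (edges R - C) (edges R' - C')"
      using F1 by (simp add: isomorphic_nets_def R1_def R1'_def)
    have F1l: "F1 u = \<phi>1 u" "rot (q1 u) = rot c" if "u \<in> leaves R1" for u
      using F1 that by (auto simp: isomorphic_nets_def)
    have F1e: "if parent R u = base R then parent R' (F1 u) = base R' else parent R' (F1 u) = F1 (parent R u)"
      "elen R' (F1 u) = elen R u" "rot c *v (efun R u of_real *v a) = efun R' (F1 u) of_real *v (rot c *v a)"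
      if "u \<in> edges R" "u \<notin> C" for u a
    proof -
      have "edges R1 = edges R - C" "parent R1 = parent R" "base R1 = base R" "elen R1 = elen R" "efun R1 = efun R"
        "parent R1' = parent R'" "base R1' = base R'" "elen R1' = elen R'" "efun R1' = efun R'"
        by (simp_all add: R1_def R1'_def)
      note * = F1[unfolded isomorphic_nets_def this]
      show "if parent R u = base R then parent R' (F1 u) = base R' else parent R' (F1 u) = F1 (parent R u)"
        "elen R' (F1 u) = elen R u" "rot c *v (efun R u of_real *v a) = efun R' (F1 u) of_real *v (rot c *v a)"
        using * that by blast+
    qed
    have Fv: "F1 v = v'" "rot (q i) = rot c"
      using F1l[of v] L1 by (simp_all add: \<phi>1_def q1_def)
    define F where "F u = (if u \<in> C then \<phi> u else F1 u)" for u
    have "isomorphic_nets R R' \<phi> q F c"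
      unfolding isomorphic_nets_def
    proof (intro conjI ballI allI)
      have "bij_betw \<phi> C C'"
        using \<phi> C(1) by (auto simp: C'_def bij_betw_def intro: inj_on_subset)
      then have 1: "bij_betw F C C'"
        by (rule bij_betw_cong[THEN iffD1, rotated]) (simp add: F_def)
      have 2: "bij_betw F (edges R - C) (edges R' - C')"
        using F1b by (rule bij_betw_cong[THEN iffD1, rotated]) (simp add: F_def)
      have "bij_betw F (C \<union> (edges R - C)) (C' \<union> (edges R' - C'))"
        by (rule bij_betw_combine[OF 1 2]) blast
      moreover have "C \<union> (edges R - C) = edges R" "C' \<union> (edges R' - C') = edges R'"
        using C(2) C'(2) by auto
      ultimately show "bij_betw F (edges R) (edges R')"
        by simp
    next
      fix u assume u: "u \<in> leaves R"
      have "F u = \<phi> u \<and> rot (q u) = rot c"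
      proof (cases "u \<in> C")
        case True
        then show ?thesis
          using pj(2)[OF True] Fv by (simp add: F_def)
      next
        case False
        then have "u \<in> leaves R1" "u \<noteq> v"
          using u L1 vl by auto
        then show ?thesis
          using F1l[of u] False by (simp add: F_def \<phi>1_def q1_def)
      qed
      then show "F u = \<phi> u" "rot (q u) = rot c"
        by auto
    next
      fix u assume u: "u \<in> edges R"
      have pu: "parent R u \<notin> C"
        using parent_not_leaf[OF u] C(1) by blast
      show "if parent R u = base R then parent R' (F u) = base R' else parent R' (F u) = F (parent R u)"
      proof (cases "u \<in> C")
        case True
        then show ?thesis
          using C(3)[OF True] vb vC pj(1)[OF True] Fv(1) by (simp add: F_def)
      next
        case False
        then show ?thesis
          using F1e(1)[OF u False] pu by (simp add: F_def)
      qed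
      show "elen R' (F u) = elen R u"
        using leaf_length[OF jl, of u] F1e(2)[OF u] by (simp add: F_def)
      fix a
      show "rot c *v (efun R u of_real *v a) = efun R' (F u) of_real *v (rot c *v a)"
      proof (cases "u \<in> C")
        case True
        then show ?thesis
          using leaf_conj[OF jl[OF True], of a] pj(2)[OF True] Fv(2) by (simp add: F_def)
      next
        case False
        then show ?thesis
          using F1e(3)[OF u False] by (simp add: F_def)
      qed
    qed
    then show ?thesis
      by blast
  qed
qed

section \<open>Rooting an undirected tree\<close>

text \<open>Following outgoing arcs forever must revisit one of the finitely many vertices, and a
  closed walk of positive length contains a cycle.\<close>

lemma (in fin_digraph) not_forest_if_arcs_out:
  assumes "verts G \<noteq> {}" "\<And>u. u \<in> verts G \<Longrightarrow> \<exists>e\<in>arcs G. tail G e = u"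
  shows "\<not> forest G"
proof -
  obtain out where out: "\<And>u. u \<in> verts G \<Longrightarrow> out u \<in> arcs G \<and> tail G (out u) = u"
    using assms(2) by metis
  obtain u0 where u0: "u0 \<in> verts G"
    using assms(1) by blast
  define s where "s n = ((\<lambda>u. head G (out u)) ^^ n) u0" for n
  have s: "s n \<in> verts G" for n
    by (induction n) (use u0 out in \<open>auto simp: s_def\<close>)
  have sS: "s (Suc n) = head G (out (s n))" for n
    by (simp add: s_def)
  have walk: "\<exists>p. awalk (s n) p (s (n + k)) \<and> length p = k" for n k
  proof (induction k)
    case 0
    then show ?case
      using s[of n] by (intro exI[of _ "[]"]) (simp add: awalk_Nil_iff)
  next
    case (Suc k)
    then obtain p where p: "awalk (s n) p (s (n + k))" "length p = k"
      by blast
    have "awalk (s (n + k)) [out (s (n + k))] (s (n + Suc k))"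
      using out[OF s[of "n + k"]] s[of "n + Suc k"] by (simp add: awalk_simps sS)
    then show ?case
      using p by (intro exI[of _ "p @ [out (s (n + k))]"]) (auto intro: awalk_appendI)
  qed
  have "finite (range s)"
    by (rule finite_subset[of _ "verts G"]) (use s in auto)
  then have "\<not> inj s"
    using finite_imageD infinite_UNIV_nat by blast
  then obtain i j where ij: "i < j" "s i = s j"
    by (metis injI nat_neq_iff)
  obtain p where "awalk (s i) p (s (i + (j - i)))" "length p = j - i"
    using walk by blast
  then have "awalk (s i) p (s i)" "0 < length p"
    using ij by simp_all
  then show ?thesis
    using closed_w_imp_cycle by (auto simp: forest_def closed_w_def)
qed

text \<open>
  Parents are neighbours closer to the root. Were there an arc \<open>e\<close> besides those to the parents,
  orient the arcs on the path from one end \<open>a\<close> of \<open>e\<close> to the root downwards, all other arcs to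
  parents upwards, and let \<open>e\<close> start at \<open>a\<close>: then every vertex has an outgoing arc.
\<close>

lemma parents_exist:
  assumes fin: "fin_digraph G" and tree: "undirected_tree G" and r: "r \<in> verts G"
  shows "\<exists>par pe (h :: 'v \<Rightarrow> nat). (\<forall>v\<in>verts G - {r}. pe v \<in> arcs G \<and> {tail G (pe v), head G (pe v)} = {v, par v} \<and>
     par v \<in> verts G \<and> h (par v) < h v) \<and> bij_betw pe (verts G - {r}) (arcs G)"
proof -
  interpret fin_digraph G
    by (rule fin)
  define E where "E = {(a, b). \<exists>e\<in>arcs G. {tail G e, head G e} = {a, b}}"
  \<comment> \<open>The distance to the root, ignoring orientation.\<close>
  define h where "h v = (LEAST n. (v, r) \<in> E ^^ n)" for v
  have reach: "(v, r) \<in> E\<^sup>*" if "v \<in> verts G" for v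
  proof -
    have "v \<rightarrow>\<^sup>*\<^bsub>with_proj (mk_symmetric G)\<^esub> r"
      using tree r that by (simp add: undirected_tree_def Digraph_Component.connected_def strongly_connected_def)
    then have "(v, r) \<in> (parcs (mk_symmetric G))\<^sup>*"
      using reachable_rtranclI by fastforce
    moreover have "parcs (mk_symmetric G) \<subseteq> E"
      by (auto simp: mk_symmetric_def E_def)
    ultimately show ?thesis
      using rtrancl_mono by blast
  qed
  have closer: "\<exists>w e. e \<in> arcs G \<and> {tail G e, head G e} = {v, w} \<and> w \<in> verts G \<and> h w < h v"
    if v: "v \<in> verts G - {r}" for v
  proof -
    have "\<exists>n. (v, r) \<in> E ^^ n"
      using reach v by (simp add: rtrancl_power)
    then have hv: "(v, r) \<in> E ^^ h v"
      unfolding h_def by (rule LeastI_ex)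
    then obtain k where k: "h v = Suc k"
      using v by (cases "h v") auto
    then obtain w where w: "(v, w) \<in> E" "(w, r) \<in> E ^^ k"
      using hv by (metis relpow_Suc_D2)
    then have "h w \<le> k"
      unfolding h_def by (intro Least_le)
    moreover obtain e where e: "e \<in> arcs G" "{tail G e, head G e} = {v, w}"
      using w(1) by (auto simp: E_def)
    moreover from e have "w \<in> verts G"
      using tail_in_verts[OF e(1)] head_in_verts[OF e(1)] by (auto simp: doubleton_eq_iff)
    ultimately show ?thesis
      using k by (metis le_imp_less_Suc)
  qed
  obtain par pe where pp: "\<And>v. v \<in> verts G - {r} \<Longrightarrow> pe v \<in> arcs G \<and> {tail G (pe v), head G (pe v)} = {v, par v} \<and>
     par v \<in> verts G \<and> h (par v) < h v"
    using closer by metis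
  have inj: "inj_on pe (verts G - {r})"
  proof (rule inj_onI)
    fix v w assume vw: "v \<in> verts G - {r}" "w \<in> verts G - {r}" "pe v = pe w"
    then have "{v, par v} = {w, par w}"
      using pp[of v] pp[of w] by metis
    then show "v = w"
      using pp[of v] pp[of w] vw by (auto simp: doubleton_eq_iff)
  qed
  have surj: "arcs G \<subseteq> pe ` (verts G - {r})"
  proof (rule ccontr)
    assume "\<not> arcs G \<subseteq> pe ` (verts G - {r})"
    then obtain e where e: "e \<in> arcs G" "e \<notin> pe ` (verts G - {r})"
      by blast
    define a where "a = tail G e"
    \<comment> \<open>The path from a to the root. Below, \<open>top x\<close> is the vertex whose
      arc to its parent is x.\<close>
    define A where "A = {u. (a, u) \<in> {(x, par x) | x. x \<in> verts G - {r}}\<^sup>*}"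
    define top where "top x = (THE v. v \<in> verts G - {r} \<and> pe v = x)" for x
    have top: "top (pe v) = v" if "v \<in> verts G - {r}" for v
      unfolding top_def using that inj by (intro the_equality) (auto dest: inj_onD)
    define t where "t x = (if x \<in> pe ` (verts G - {r}) then (if top x \<in> A then par (top x) else top x) else tail G x)" for x
    define d where "d x = (if x \<in> pe ` (verts G - {r}) then (if top x \<in> A then top x else par (top x)) else head G x)" for x
    define H where "H = G\<lparr>tail := t, head := d\<rparr>"
    have ends: "{t x, d x} = {tail G x, head G x}" if "x \<in> arcs G" for x
    proof (cases "x \<in> pe ` (verts G - {r})")
      case True
      then obtain v where v: "v \<in> verts G - {r}" "x = pe v"
        by blast
      then have "x \<in> pe ` (verts G - {r})"
        by blast
      then have "{t x, d x} = {v, par v}"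
        using top[OF v(1)] v(2) by (auto simp: t_def d_def)
      then show ?thesis
        using pp[OF v(1)] v(2) by simp
    qed (simp add: t_def d_def)
    have "reorientation G H"
      using ends by (simp add: reorientation_def H_def)
    then have "forest H"
      using tree by (simp add: undirected_tree_def)
    moreover have "fin_digraph H"
    proof
      fix x assume "x \<in> arcs H"
      then have "x \<in> arcs G"
        by (simp add: H_def)
      then have "{t x, d x} \<subseteq> verts G"
        using ends by simp
      then show "tail H x \<in> verts H" "head H x \<in> verts H"
        by (simp_all add: H_def)
    qed (simp_all add: H_def)
    moreover have "\<exists>x\<in>arcs H. tail H x = u" if "u \<in> verts H" for u
    proof -
      have u: "u \<in> verts G"
        using that by (simp add: H_def)
      have rA: "r \<in> A"
      proof -
        have "(x, r) \<in> {(x, par x) | x. x \<in> verts G - {r}}\<^sup>*" if "x \<in> verts G" for x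
          using that
        proof (induction "h x" arbitrary: x rule: less_induct)
          case less
          show ?case
          proof (cases "x = r")
            case False
            then have "(par x, r) \<in> {(x, par x) | x. x \<in> verts G - {r}}\<^sup>*"
              using less pp[of x] by simp
            then show ?thesis
              using False less.prems by (auto intro: converse_rtrancl_into_rtrancl)
          qed simp
        qed
        then show ?thesis
          using e(1) by (simp add: A_def a_def)
      qed
      have "\<exists>x\<in>arcs G. t x = u"
      proof (cases "u \<in> A")
        case False
        then have "u \<in> verts G - {r}"
          using u rA by auto
        then show ?thesis
          using pp[of u] top[of u] False by (intro bexI[of _ "pe u"]) (auto simp: t_def)
      next
        case True
        show ?thesis
        proof (cases "u = a")
          case True
          then show ?thesis
            using e by (intro bexI[of _ e]) (simp_all add: t_def a_def)
        next
          case False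
          then obtain v where "(a, v) \<in> {(x, par x) | x. x \<in> verts G - {r}}\<^sup>*" "(v, u) \<in> {(x, par x) | x. x \<in> verts G - {r}}"
            using True unfolding A_def by (auto elim: rtranclE)
          then have v: "v \<in> A" "v \<in> verts G - {r}" "par v = u"
            by (auto simp: A_def)
          then show ?thesis
            using pp[of v] top[of v] by (intro bexI[of _ "pe v"]) (auto simp: t_def)
        qed
      qed
      then show ?thesis
        by (simp add: H_def)
    qed
    moreover have "verts H \<noteq> {}"
      using r by (auto simp: H_def)
    ultimately show False
      using fin_digraph.not_forest_if_arcs_out by blast
  qed
  have "bij_betw pe (verts G - {r}) (arcs G)"
    using inj surj pp by (auto simp: bij_betw_def)
  then show ?thesis
    using pp by (intro exI[of _ par] exI[of _ pe] exI[of _ h]) blast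
qed

section \<open>The rooted network of a string network\<close>

locale rooted_string_tree =
  fixes N :: "('v, 'e) string_network" and m :: nat and r :: 'v
    and par :: "'v \<Rightarrow> 'v" and pe :: "'v \<Rightarrow> 'e" and h :: "'v \<Rightarrow> nat"
  assumes N: "elastic_tree m N" and r: "r \<in> verts (graph N)"
    and pe: "\<And>v. v \<in> verts (graph N) - {r} \<Longrightarrow> pe v \<in> arcs (graph N) \<and>
        {tail (graph N) (pe v), head (graph N) (pe v)} = {v, par v} \<and> par v \<in> verts (graph N) \<and> h (par v) < h v"
    and bij: "bij_betw pe (verts (graph N) - {r}) (arcs (graph N))"
begin

definition R :: "'v rooted_net" where
  "R = \<lparr>nodes = verts (graph N), base = r, parent = par, elen = \<lambda>v. len N (pe v),
     vel1 = \<lambda>v. k1 N (pe v), vel2 = \<lambda>v. k2 N (pe v), frame = \<lambda>v. dir N (pe v)\<rparr>"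

lemma R_simps [simp]:
  "nodes R = verts (graph N)" "base R = r" "parent R = par" "elen R v = len N (pe v)"
  "vel1 R v = k1 N (pe v)" "vel2 R v = k2 N (pe v)" "frame R v = dir N (pe v)"
  by (simp_all add: R_def)

lemma edges_R: "edges R = verts (graph N) - {r}"
  by (simp add: edges_def)

lemma pos: "e \<in> arcs (graph N) \<Longrightarrow> len N e > 0 \<and> k1 N e > 0 \<and> k2 N e > 0"
  using N by (simp add: elastic_tree_def)

lemma pe_arc: "v \<in> edges R \<Longrightarrow> pe v \<in> arcs (graph N)"
  using pe by (simp add: edges_R)

lemma pe_inj: "v \<in> edges R \<Longrightarrow> w \<in> edges R \<Longrightarrow> pe v = pe w \<longleftrightarrow> v = w"
  using bij by (auto simp: bij_betw_def edges_R dest: inj_onD)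

lemma arc_pe: "e \<in> arcs (graph N) \<Longrightarrow> \<exists>v\<in>edges R. e = pe v"
  using bij by (auto simp: bij_betw_def edges_R)

lemma ends: "v \<in> edges R \<Longrightarrow> {tail (graph N) (pe v), head (graph N) (pe v)} = {v, par v}"
  using pe by (simp add: edges_R)

lemma par_ne: "v \<in> edges R \<Longrightarrow> par v \<noteq> v"
  using pe[of v] unfolding edges_R by (metis less_irrefl)

lemma net_R: "net R"
  unfolding net_def
proof (intro conjI)
  show "finite (nodes R)"
    using N by (auto simp: elastic_tree_def fin_digraph_def fin_digraph_axioms_def)
  show "\<exists>h::'v \<Rightarrow> nat. \<forall>v\<in>edges R. h (parent R v) < h v"
    using pe by (intro exI[of _ h]) (simp add: edges_R)
  show "parent R ` edges R \<subseteq> nodes R"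
    using pe by (auto simp: edges_R)
  show "base R \<in> nodes R"
    using r by simp
  show "\<forall>v\<in>edges R. 0 < elen R v \<and> 0 < vel1 R v \<and> 0 < vel2 R v"
    using pos pe_arc by simp
qed

lemma edges_at_iff: "e \<in> edges_at N v \<longleftrightarrow> (\<exists>w\<in>edges R. e = pe w \<and> (v = w \<or> v = par w))"
proof -
  have "e \<in> edges_at N v \<longleftrightarrow> e \<in> arcs (graph N) \<and> v \<in> {tail (graph N) e, head (graph N) e}"
    by (auto simp: edges_at_def)
  also have "\<dots> \<longleftrightarrow> (\<exists>w\<in>edges R. e = pe w \<and> v \<in> {tail (graph N) (pe w), head (graph N) (pe w)})"
    using arc_pe pe_arc by blast
  finally show ?thesis
    using ends by simp
qed

lemma edges_at_inner: "v \<in> edges R \<Longrightarrow> edges_at N v = insert (pe v) (pe ` children R v)"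
  by (auto simp: edges_at_iff children_def)

lemma edges_at_root: "edges_at N r = pe ` children R r"
proof (intro set_eqI iffI)
  fix e assume "e \<in> edges_at N r"
  then obtain w where w: "w \<in> edges R" "e = pe w" "r = w \<or> r = par w"
    using edges_at_iff by blast
  then have "w \<in> children R r"
    using edges_R by (simp add: children_def) blast
  then show "e \<in> pe ` children R r"
    using w(2) by blast
qed (auto simp: edges_at_iff children_def)

lemma pe_notin_children: "v \<in> edges R \<Longrightarrow> pe v \<notin> pe ` children R v"
  using pe_inj par_ne by (fastforce simp: children_def)

lemma pe_inj_children: "inj_on pe (children R v)"
  using pe_inj by (auto simp: inj_on_def children_def)

lemma boundary_iff:
  assumes "v \<in> edges R"
  shows "v \<in> boundary N \<longleftrightarrow> v \<in> leaves R"
proof -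
  have "card (edges_at N v) = Suc (card (children R v))"
    using pe_notin_children[OF assms] pe_inj_children finite_children[OF net_R]
    by (simp add: edges_at_inner[OF assms] card_image)
  then show ?thesis
    using assms finite_children[OF net_R, of v] by (auto simp: boundary_def leaves_def edges_R)
qed

lemma boundary_nonempty: "boundary N \<noteq> {}"
proof -
  obtain e where "e \<in> arcs (graph N)"
    using N by (auto simp: elastic_tree_def)
  then obtain v where "v \<in> edges R"
    using arc_pe by blast
  then obtain j where "j \<in> leaves R"
    using leaf_in_subtree[OF net_R] by blast
  then show ?thesis
    using boundary_iff leaves_edges[of R] by blast
qed

lemma single_root_R:
  assumes "r \<in> boundary N"
  shows "single_root R"
proof -
  have "card (children R r) = 1"
    using assms pe_inj_children by (simp add: boundary_def edges_at_root card_image)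
  then show ?thesis
    by (auto simp: single_root_def card_1_singleton_iff)
qed

end

text \<open>That \<open>m \<ge> 1\<close> has to be derived: rooting the tree at the tail of an
  arbitrary arc exhibits a boundary vertex, and only then is the last one available as root.\<close>

lemma rooted_string_tree_exists:
  assumes "elastic_tree m N"
  shows "\<exists>par pe h. rooted_string_tree N m (bvertex N m) par pe h \<and> bvertex N m \<in> boundary N \<and> m \<ge> 1"
proof -
  have G: "fin_digraph (graph N)" "undirected_tree (graph N)"
    using assms by (simp_all add: elastic_tree_def)
  have ex: "\<exists>par pe h. rooted_string_tree N m r par pe h" if rv: "r \<in> verts (graph N)" for r
  proof -
    obtain par pe h where "\<forall>v\<in>verts (graph N) - {r}. pe v \<in> arcs (graph N) \<and>
       {tail (graph N) (pe v), head (graph N) (pe v)} = {v, par v} \<and> par v \<in> verts (graph N) \<and> h (par v) < (h v :: nat)"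
       "bij_betw pe (verts (graph N) - {r}) (arcs (graph N))"
      using parents_exist[OF G rv] by blast
    then have "rooted_string_tree N m r par pe h"
      using assms rv by unfold_locales auto
    then show ?thesis
      by blast
  qed
  obtain e where e: "e \<in> arcs (graph N)"
    using assms by (auto simp: elastic_tree_def)
  have "tail (graph N) e \<in> verts (graph N)"
    using G(1) e by (simp add: fin_digraph_def wf_digraph_def)
  then obtain par pe h where "rooted_string_tree N m (tail (graph N) e) par pe h"
    using ex by blast
  then have "boundary N \<noteq> {}"
    by (rule rooted_string_tree.boundary_nonempty)
  moreover have bb: "bij_betw (bvertex N) {1..m} (boundary N)"
    using assms by (simp add: elastic_tree_def)
  ultimately have "m \<ge> 1"
    by (auto simp: bij_betw_def)
  then have "bvertex N m \<in> boundary N"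
    using bb by (auto simp: bij_betw_def)
  then show ?thesis
    using ex[of "bvertex N m"] \<open>m \<ge> 1\<close> by (auto simp: boundary_def)
qed

section \<open>Solutions of the spectral equations\<close>

text \<open>The combination u' + \<kappa> u satisfies the first-order equation g' = \<kappa> g, so
  multiplying it by exp (- \<kappa> x) gives a constant.\<close>

lemma oscillator_first_integral:
  fixes u u1 u2 :: "real \<Rightarrow> complex"
  assumes "l \<ge> 0"
    and "\<And>x. x \<in> {0..l} \<Longrightarrow> (u has_vector_derivative u1 x) (at x within {0..l})"
    and "\<And>x. x \<in> {0..l} \<Longrightarrow> (u1 has_vector_derivative u2 x) (at x within {0..l})"
    and "\<And>x. x \<in> {0..l} \<Longrightarrow> u2 x = \<kappa>\<^sup>2 * u x"
  shows "u1 l + \<kappa> * u l = exp (\<kappa> * of_real l) * (u1 0 + \<kappa> * u 0)"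
proof -
  define g where "g x = exp (- \<kappa> * of_real x) * (u1 x + \<kappa> * u x)" for x
  have "(g has_vector_derivative 0) (at x within {0..l})" if x: "x \<in> {0..l}" for x
  proof -
    have e: "((\<lambda>x. exp (- \<kappa> * of_real x)) has_vector_derivative - \<kappa> * exp (- \<kappa> * of_real x)) (at x within {0..l})"
      by (rule has_vector_derivative_real_field) (auto intro!: derivative_eq_intros)
    have "(g has_vector_derivative
        exp (- \<kappa> * of_real x) * (u2 x + \<kappa> * u1 x) + - \<kappa> * exp (- \<kappa> * of_real x) * (u1 x + \<kappa> * u x)) (at x within {0..l})"
      unfolding g_def
      by (intro has_vector_derivative_mult[OF e] has_vector_derivative_add has_vector_derivative_mult_right assms(2,3) x)
    moreover have "exp (- \<kappa> * of_real x) * (u2 x + \<kappa> * u1 x) + - \<kappa> * exp (- \<kappa> * of_real x) * (u1 x + \<kappa> * u x) = 0"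
      by (simp add: assms(4)[OF x] algebra_simps power2_eq_square)
    ultimately show ?thesis
      by simp
  qed
  then obtain c where "\<And>x. x \<in> {0..l} \<Longrightarrow> g x = c"
    using has_vector_derivative_zero_constant[of "{0..l}" g] by (metis convex_real_interval(5))
  then have "g l = g 0"
    using assms(1) by simp
  then show ?thesis
    by (simp add: g_def exp_minus field_simps)
qed

text \<open>The first integrals for \<kappa> and - \<kappa> are two linear equations for the value
  and the derivative at \<open>l\<close>.\<close>

lemma oscillator_end_values:
  fixes u u1 u2 :: "real \<Rightarrow> complex"
  assumes "l \<ge> 0" "k > 0" "s \<noteq> 0"
    and "\<And>x. x \<in> {0..l} \<Longrightarrow> (u has_vector_derivative u1 x) (at x within {0..l})"
    and "\<And>x. x \<in> {0..l} \<Longrightarrow> (u1 has_vector_derivative u2 x) (at x within {0..l})"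
    and "\<And>x. x \<in> {0..l} \<Longrightarrow> u2 x = (s / of_real k)\<^sup>2 * u x"
  shows "u l = tc s l k * u 0 + ts s l k * (of_real (k\<^sup>2) * u1 0)"
    and "of_real (k\<^sup>2) * u1 l = tz s l k * u 0 + tc s l k * (of_real (k\<^sup>2) * u1 0)"
proof -
  define \<kappa> where "\<kappa> = s / of_real k"
  have \<kappa>: "\<kappa> \<noteq> 0" "s = \<kappa> * of_real k"
    using assms by (auto simp: \<kappa>_def)
  define E E' where EE: "E = exp (\<kappa> * of_real l)" "E' = exp (- \<kappa> * of_real l)"
  have 1: "u1 l + \<kappa> * u l = E * (u1 0 + \<kappa> * u 0)"
    unfolding EE by (rule oscillator_first_integral[OF assms(1,4,5)]) (use assms(6) in \<open>auto simp: \<kappa>_def\<close>)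
  have 2: "u1 l + - \<kappa> * u l = E' * (u1 0 + - \<kappa> * u 0)"
    unfolding EE by (rule oscillator_first_integral[OF assms(1,4,5)]) (use assms(6) in \<open>auto simp: \<kappa>_def\<close>)
  have z: "s * of_real l / of_real k = \<kappa> * of_real l"
    by (simp add: \<kappa>_def)
  have ch: "cosh (\<kappa> * of_real l) = (E + E') / 2" "sinh (\<kappa> * of_real l) = (E - E') / 2"
    by (simp_all add: cosh_field_def sinh_field_def EE)
  have u1l: "u1 l = ((E * (u1 0 + \<kappa> * u 0)) + (E' * (u1 0 + - \<kappa> * u 0))) / 2"
    unfolding 1[symmetric] 2[symmetric] by simp
  have ul: "u l = ((E * (u1 0 + \<kappa> * u 0)) - (E' * (u1 0 + - \<kappa> * u 0))) / (2 * \<kappa>)"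
    unfolding 1[symmetric] 2[symmetric] using \<kappa>(1) by simp
  have k: "complex_of_real k \<noteq> 0"
    using assms(2) by simp
  show "u l = tc s l k * u 0 + ts s l k * (of_real (k\<^sup>2) * u1 0)"
    unfolding ul tc_def ts_def z ch using assms(3) \<kappa> k by (simp add: field_simps power2_eq_square)
  show "of_real (k\<^sup>2) * u1 l = tz s l k * u 0 + tc s l k * (of_real (k\<^sup>2) * u1 0)"
    unfolding u1l tc_def tz_def z ch by (simp add: \<kappa>(2) field_simps power2_eq_square)
qed

lemma diag2_vec: "(diag2 a b *v x) $ 1 = a * x $ 1" "(diag2 a b *v x) $ 2 = b * x $ 2"
  by (simp_all add: diag2_def matrix_vector_mult_def sum_2)

lemma stiffness_diag2: "stiffness N e = diag2 (of_real ((k1 N e)\<^sup>2)) (of_real ((k2 N e)\<^sup>2))"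
  by (simp add: stiffness_def diag2_def)

definition end_deriv where
  "end_deriv N U e x = vector_derivative (U e) (at x within {0..len N e})"

text \<open>The last two equations are the inverse transfer, needed on edges whose parametrisation
  starts at the parent.\<close>

lemma spectral_end_values:
  assumes "spectral_equations_on N (- (s\<^sup>2)) U e" "s \<noteq> 0" "len N e > 0" "k1 N e > 0" "k2 N e > 0"
  defines "l \<equiv> len N e"
  shows "U e l = diag2 (tc s l (k1 N e)) (tc s l (k2 N e)) *v U e 0 +
      diag2 (ts s l (k1 N e)) (ts s l (k2 N e)) *v (stiffness N e *v end_deriv N U e 0)"
    and "stiffness N e *v end_deriv N U e l = diag2 (tz s l (k1 N e)) (tz s l (k2 N e)) *v U e 0 +
      diag2 (tc s l (k1 N e)) (tc s l (k2 N e)) *v (stiffness N e *v end_deriv N U e 0)"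
    and "U e 0 = diag2 (tc s l (k1 N e)) (tc s l (k2 N e)) *v U e l -
      diag2 (ts s l (k1 N e)) (ts s l (k2 N e)) *v (stiffness N e *v end_deriv N U e l)"
    and "stiffness N e *v end_deriv N U e 0 = diag2 (tc s l (k1 N e)) (tc s l (k2 N e)) *v (stiffness N e *v end_deriv N U e l) -
      diag2 (tz s l (k1 N e)) (tz s l (k2 N e)) *v U e l"
proof -
  obtain U1 U2 where U12: "\<forall>x\<in>{0..l}. (U e has_vector_derivative U1 x) (at x within {0..l}) \<and>
      (U1 has_vector_derivative U2 x) (at x within {0..l}) \<and>
      - of_real ((k1 N e)\<^sup>2) * U2 x $ 1 = - (s\<^sup>2) * U e x $ 1 \<and>
      - of_real ((k2 N e)\<^sup>2) * U2 x $ 2 = - (s\<^sup>2) * U e x $ 2"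
    using assms(1) unfolding spectral_equations_on_def l_def by blast
  then have U: "\<And>x. x \<in> {0..l} \<Longrightarrow> (U e has_vector_derivative U1 x) (at x within {0..l})"
    "\<And>x. x \<in> {0..l} \<Longrightarrow> (U1 has_vector_derivative U2 x) (at x within {0..l})"
    by blast+
  have U2: "of_real ((k1 N e)\<^sup>2) * U2 x $ 1 = s\<^sup>2 * U e x $ 1"
    "of_real ((k2 N e)\<^sup>2) * U2 x $ 2 = s\<^sup>2 * U e x $ 2" if "x \<in> {0..l}" for x
    using U12 that by simp_all
  have d: "end_deriv N U e x = U1 x" if "x \<in> {0..l}" for x
    unfolding end_deriv_def
    using vector_derivative_within_cbox[of 0 l x "U e", unfolded box_real, OF _ that U(1)[OF that]] assms(3)
    by (simp add: l_def)
  have c1: "((\<lambda>x. U e x $ i) has_vector_derivative U1 x $ i) (at x within {0..l})"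
    and c2: "((\<lambda>x. U1 x $ i) has_vector_derivative U2 x $ i) (at x within {0..l})" if "x \<in> {0..l}" for x i
    using bounded_linear.has_vector_derivative[OF bounded_linear_vec_nth] U(1,2) that by blast+
  have e1: "U2 x $ 1 = (s / of_real (k1 N e))\<^sup>2 * U e x $ 1" and e2: "U2 x $ 2 = (s / of_real (k2 N e))\<^sup>2 * U e x $ 2"
    if "x \<in> {0..l}" for x
    using U2[OF that] assms(4,5) by (simp_all add: field_simps)
  have l: "l \<ge> 0" "l \<in> {0..l}" "0 \<in> {0..l}"
    using assms(3) by (auto simp: l_def)
  note o1 = oscillator_end_values[OF l(1) assms(4,2) c1 c2 e1]
  note o2 = oscillator_end_values[OF l(1) assms(5,2) c1 c2 e2]
  note D = d[OF l(2)] d[OF l(3)]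
  show *: "U e l = diag2 (tc s l (k1 N e)) (tc s l (k2 N e)) *v U e 0 +
      diag2 (ts s l (k1 N e)) (ts s l (k2 N e)) *v (stiffness N e *v end_deriv N U e 0)"
    "stiffness N e *v end_deriv N U e l = diag2 (tz s l (k1 N e)) (tz s l (k2 N e)) *v U e 0 +
      diag2 (tc s l (k1 N e)) (tc s l (k2 N e)) *v (stiffness N e *v end_deriv N U e 0)"
    using o1 o2 by (simp_all add: vec_eq_iff forall_2 diag2_vec stiffness_diag2 D)
  have inv: "p = c * (c * p + t * f) - t * (z * p + c * f)" "f = c * (z * p + c * f) - z * (c * p + t * f)"
    if "c * c - t * z = 1" for c t z p f :: complex
  proof -
    have "c * (c * p + t * f) - t * (z * p + c * f) = (c * c - t * z) * p"
      "c * (z * p + c * f) - z * (c * p + t * f) = (c * c - t * z) * f"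
      by (simp_all add: algebra_simps)
    then show "p = c * (c * p + t * f) - t * (z * p + c * f)" "f = c * (z * p + c * f) - z * (c * p + t * f)"
      unfolding that by simp_all
  qed
  show "U e 0 = diag2 (tc s l (k1 N e)) (tc s l (k2 N e)) *v U e l -
      diag2 (ts s l (k1 N e)) (ts s l (k2 N e)) *v (stiffness N e *v end_deriv N U e l)"
    unfolding * using inv(1)[OF tc_ts_tz[OF assms(4)]] inv(1)[OF tc_ts_tz[OF assms(5)]]
    by (simp add: vec_eq_iff forall_2 diag2_vec)
  show "stiffness N e *v end_deriv N U e 0 = diag2 (tc s l (k1 N e)) (tc s l (k2 N e)) *v (stiffness N e *v end_deriv N U e l) -
      diag2 (tz s l (k1 N e)) (tz s l (k2 N e)) *v U e l"
    unfolding * using inv(2)[OF tc_ts_tz[OF assms(4)]] inv(2)[OF tc_ts_tz[OF assms(5)]]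
    by (simp add: vec_eq_iff forall_2 diag2_vec)
qed

section \<open>Explicit solutions on an edge\<close>

lemma transfer_derivatives:
  assumes "k > 0" "s \<noteq> 0"
  shows "((\<lambda>x. tc s x k) has_vector_derivative tz s x k / of_real (k\<^sup>2)) (at x within A)"
    and "((\<lambda>x. ts s x k) has_vector_derivative tc s x k / of_real (k\<^sup>2)) (at x within A)"
    and "((\<lambda>x. tz s x k) has_vector_derivative s\<^sup>2 * tc s x k) (at x within A)"
proof -
  define \<kappa> where "\<kappa> = s / of_real k"
  have k: "complex_of_real k \<noteq> 0"
    using assms(1) by simp
  have z: "s * of_real x / of_real k = \<kappa> * of_real x" for x
    by (simp add: \<kappa>_def)
  have dc: "((\<lambda>x. cosh (\<kappa> * of_real x)) has_vector_derivative \<kappa> * sinh (\<kappa> * of_real x)) (at x within A)"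
    and ds: "((\<lambda>x. sinh (\<kappa> * of_real x)) has_vector_derivative \<kappa> * cosh (\<kappa> * of_real x)) (at x within A)" for x :: real
    by (rule has_vector_derivative_real_field, auto intro!: derivative_eq_intros)+
  have "tz s x k / of_real (k\<^sup>2) = \<kappa> * sinh (\<kappa> * of_real x)"
    unfolding tz_def z using k by (simp add: \<kappa>_def power2_eq_square)
  then show "((\<lambda>x. tc s x k) has_vector_derivative tz s x k / of_real (k\<^sup>2)) (at x within A)"
    using dc unfolding tc_def z by simp
  have "tc s x k / of_real (k\<^sup>2) = \<kappa> * cosh (\<kappa> * of_real x) / (s * of_real k)"
    unfolding tc_def z using k assms(2) by (simp add: \<kappa>_def power2_eq_square)
  then show "((\<lambda>x. ts s x k) has_vector_derivative tc s x k / of_real (k\<^sup>2)) (at x within A)"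
    using has_vector_derivative_divide[OF ds, of "s * of_real k" x] assms(2) unfolding ts_def z by simp
  have "s\<^sup>2 * tc s x k = s * of_real k * (\<kappa> * cosh (\<kappa> * of_real x))"
    unfolding tc_def z using k by (simp add: \<kappa>_def power2_eq_square)
  then show "((\<lambda>x. tz s x k) has_vector_derivative s\<^sup>2 * tc s x k) (at x within A)"
    using has_vector_derivative_mult_right[OF ds, of "s * of_real k" x] unfolding tz_def z by simp
qed

text \<open>The solution with displacement \<open>y\<close> and force \<open>f\<close> at parameter
  0, in the frame of the edge.\<close>

definition wave :: "('v, 'e) string_network \<Rightarrow> complex \<Rightarrow> 'e \<Rightarrow> complex^2 \<Rightarrow> complex^2 \<Rightarrow> real \<Rightarrow> complex^2" where
  "wave N s e y f x = diag2 (tc s x (k1 N e)) (tc s x (k2 N e)) *v y + diag2 (ts s x (k1 N e)) (ts s x (k2 N e)) *v f"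

definition wave_force :: "('v, 'e) string_network \<Rightarrow> complex \<Rightarrow> 'e \<Rightarrow> complex^2 \<Rightarrow> complex^2 \<Rightarrow> real \<Rightarrow> complex^2" where
  "wave_force N s e y f x = diag2 (tz s x (k1 N e)) (tz s x (k2 N e)) *v y + diag2 (tc s x (k1 N e)) (tc s x (k2 N e)) *v f"

definition compliance :: "('v, 'e) string_network \<Rightarrow> 'e \<Rightarrow> complex^2^2" where
  "compliance N e = diag2 (1 / of_real ((k1 N e)\<^sup>2)) (1 / of_real ((k2 N e)\<^sup>2))"

lemma has_vector_derivative_vec2:
  fixes u :: "real \<Rightarrow> complex^2"
  assumes "((\<lambda>x. u x $ 1) has_vector_derivative u' $ 1) F" "((\<lambda>x. u x $ 2) has_vector_derivative u' $ 2) F"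
  shows "(u has_vector_derivative u') F"
proof -
  have 1: "u = (\<lambda>x. axis 1 (u x $ 1) + axis 2 (u x $ 2))"
    by (simp add: fun_eq_iff vec_eq_iff forall_2 axis_def)
  have 2: "u' = axis 1 (u' $ 1) + axis 2 (u' $ 2)"
    by (simp add: vec_eq_iff forall_2 axis_def)
  have bl: "bounded_linear (axis i :: complex \<Rightarrow> complex^2)" for i
    by (rule linear_conv_bounded_linear[THEN iffD1]) (auto intro!: linearI simp: vec_eq_iff axis_def)
  show ?thesis
    by (subst 1, subst 2) (intro has_vector_derivative_add bounded_linear.has_vector_derivative[OF bl] assms)
qed

lemma wave_derivatives:
  assumes "k1 N e > 0" "k2 N e > 0" "s \<noteq> 0"
  shows "(wave N s e y f has_vector_derivative compliance N e *v wave_force N s e y f x) (at x within A)"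
    and "((\<lambda>x. compliance N e *v wave_force N s e y f x) has_vector_derivative compliance N e *v (s\<^sup>2 *s wave N s e y f x)) (at x within A)"
proof -
  note d1 = transfer_derivatives[OF assms(1,3), of x A] and d2 = transfer_derivatives[OF assms(2,3), of x A]
  show "(wave N s e y f has_vector_derivative compliance N e *v wave_force N s e y f x) (at x within A)"
  proof (rule has_vector_derivative_vec2)
    show "((\<lambda>x. wave N s e y f x $ 1) has_vector_derivative (compliance N e *v wave_force N s e y f x) $ 1) (at x within A)"
      using has_vector_derivative_add[OF has_vector_derivative_mult_left[OF d1(1), of "y $ 1"] has_vector_derivative_mult_left[OF d1(2), of "f $ 1"]]
      by (simp add: wave_def wave_force_def compliance_def diag2_vec add_divide_distrib)
    show "((\<lambda>x. wave N s e y f x $ 2) has_vector_derivative (compliance N e *v wave_force N s e y f x) $ 2) (at x within A)"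
      using has_vector_derivative_add[OF has_vector_derivative_mult_left[OF d2(1), of "y $ 2"] has_vector_derivative_mult_left[OF d2(2), of "f $ 2"]]
      by (simp add: wave_def wave_force_def compliance_def diag2_vec add_divide_distrib)
  qed
  show "((\<lambda>x. compliance N e *v wave_force N s e y f x) has_vector_derivative compliance N e *v (s\<^sup>2 *s wave N s e y f x)) (at x within A)"
  proof (rule has_vector_derivative_vec2)
    have 1: "((\<lambda>x. (1 / of_real ((k1 N e)\<^sup>2)) * (tz s x (k1 N e) * y $ 1 + tc s x (k1 N e) * f $ 1)) has_vector_derivative
        (1 / of_real ((k1 N e)\<^sup>2)) * (s\<^sup>2 * tc s x (k1 N e) * y $ 1 + tz s x (k1 N e) / of_real ((k1 N e)\<^sup>2) * f $ 1)) (at x within A)"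
      by (intro has_vector_derivative_mult_right has_vector_derivative_add has_vector_derivative_mult_left d1)
    have 2: "((\<lambda>x. (1 / of_real ((k2 N e)\<^sup>2)) * (tz s x (k2 N e) * y $ 2 + tc s x (k2 N e) * f $ 2)) has_vector_derivative
        (1 / of_real ((k2 N e)\<^sup>2)) * (s\<^sup>2 * tc s x (k2 N e) * y $ 2 + tz s x (k2 N e) / of_real ((k2 N e)\<^sup>2) * f $ 2)) (at x within A)"
      by (intro has_vector_derivative_mult_right has_vector_derivative_add has_vector_derivative_mult_left d2)
    have z: "tz s x k / of_real (k\<^sup>2) = s\<^sup>2 * ts s x k" if "k > 0" for k
      using that assms(3) by (simp add: tz_def ts_def power2_eq_square)
    show "((\<lambda>x. (compliance N e *v wave_force N s e y f x) $ 1) has_vector_derivative (compliance N e *v (s\<^sup>2 *s wave N s e y f x)) $ 1) (at x within A)"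
      using 1 unfolding z[OF assms(1)] compliance_def wave_force_def diag2_vec vector_add_component wave_def vector_smult_component
      by (simp only: distrib_left mult.assoc)
    show "((\<lambda>x. (compliance N e *v wave_force N s e y f x) $ 2) has_vector_derivative (compliance N e *v (s\<^sup>2 *s wave N s e y f x)) $ 2) (at x within A)"
      using 2 unfolding z[OF assms(2)] compliance_def wave_force_def diag2_vec vector_add_component wave_def vector_smult_component
      by (simp only: distrib_left mult.assoc)
  qed
qed

lemma wave_0: "wave N s e y f 0 = y" "wave_force N s e y f 0 = f"
proof -
  have "tc s 0 k = 1" "ts s 0 k = 0" "tz s 0 k = 0" for k
    by (simp_all add: tc_def ts_def tz_def)
  then show "wave N s e y f 0 = y" "wave_force N s e y f 0 = f"
    by (simp_all add: wave_def wave_force_def vec_eq_iff forall_2 diag2_vec)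
qed

lemma stiffness_compliance:
  assumes "k1 N e > 0" "k2 N e > 0"
  shows "stiffness N e *v (compliance N e *v x) = x" "compliance N e *v (stiffness N e *v x) = x"
  using assms by (simp_all add: stiffness_diag2 compliance_def vec_eq_iff forall_2 diag2_vec)

text \<open>The reversed wave serves the edges whose parameter 0 lies at the parent, where the state
  is prescribed at the end \<open>len N e\<close>.\<close>

lemma wave_spectral:
  assumes pos: "len N e > 0" "k1 N e > 0" "k2 N e > 0" "s \<noteq> 0"
  shows "spectral_equations_on N (- (s\<^sup>2)) (\<lambda>_. wave N s e y f) e"
    and "end_deriv N (\<lambda>_. wave N s e y f) e 0 = compliance N e *v f"
    and "spectral_equations_on N (- (s\<^sup>2)) (\<lambda>_ x. wave N s e y f (len N e - x)) e"
    and "end_deriv N (\<lambda>_ x. wave N s e y f (len N e - x)) e (len N e) = - (compliance N e *v f)"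
proof -
  let ?l = "len N e" and ?A = "{0..len N e}"
  let ?W = "wave N s e y f"
  let ?W1 = "\<lambda>x. compliance N e *v wave_force N s e y f x"
  let ?W2 = "\<lambda>x. compliance N e *v (s\<^sup>2 *s wave N s e y f x)"
  have eq: "- of_real ((k1 N e)\<^sup>2) * ?W2 x $ 1 = - (s\<^sup>2) * ?W x $ 1 \<and> - of_real ((k2 N e)\<^sup>2) * ?W2 x $ 2 = - (s\<^sup>2) * ?W x $ 2" for x
    using pos(2,3) by (simp add: compliance_def diag2_vec)
  note d = wave_derivatives[OF pos(2,3,4), of y f]
  have vd: "vector_derivative g (at x within ?A) = g'" if "(g has_vector_derivative g') (at x within ?A)" "x \<in> ?A" for g :: "real \<Rightarrow> complex^2" and g' x
    using vector_derivative_within_cbox[of 0 ?l x g, unfolded box_real, OF _ that(2,1)] pos(1) by simp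
  show "spectral_equations_on N (- (s\<^sup>2)) (\<lambda>_. ?W) e"
    unfolding spectral_equations_on_def
    by (rule exI[of _ ?W1], rule exI[of _ ?W2]) (use d eq in blast)
  show "end_deriv N (\<lambda>_. ?W) e 0 = compliance N e *v f"
    unfolding end_deriv_def using vd[OF d(1), of 0] pos(1) by (simp add: wave_0)
  have minus: "((\<lambda>x. g (?l - x)) has_vector_derivative - g' (?l - x)) (at x within ?A)"
    if "\<And>x. (g has_vector_derivative g' x) (at x)" for g g' :: "real \<Rightarrow> complex^2" and x
  proof -
    have "((\<lambda>x. ?l - x) has_vector_derivative - 1) (at x within ?A)"
      by (auto intro!: derivative_eq_intros)
    from vector_diff_chain_within[OF this has_vector_derivative_at_within[OF that]]
    show ?thesis
      by (simp add: o_def)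
  qed
  have m1: "((\<lambda>x. ?W (?l - x)) has_vector_derivative - ?W1 (?l - x)) (at x within ?A)"
    and m2: "((\<lambda>x. - ?W1 (?l - x)) has_vector_derivative ?W2 (?l - x)) (at x within ?A)" for x
    using minus[OF d(1)] has_vector_derivative_minus[OF minus[OF d(2)]] by simp_all
  show "spectral_equations_on N (- (s\<^sup>2)) (\<lambda>_ x. ?W (?l - x)) e"
    unfolding spectral_equations_on_def
    by (rule exI[of _ "\<lambda>x. - ?W1 (?l - x)"], rule exI[of _ "\<lambda>x. ?W2 (?l - x)"]) (use m1 m2 eq in blast)
  show "end_deriv N (\<lambda>_ x. ?W (?l - x)) e ?l = - (compliance N e *v f)"
    unfolding end_deriv_def using vd[OF m1, of ?l] pos(1) by (simp add: wave_0)
qed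

section \<open>The Titchmarsh-Weyl matrix of a rooted tree\<close>

definition gval where
  "gval N U e v = rot (dir N e) *v value_at N U e v"

text \<open>The derivative points from \<open>v\<close> into the edge. At the child end this is the
  direction of \<open>f\<close>; at the parent end it is opposite to that of
  \<open>top_force\<close>.\<close>

definition gforce where
  "gforce N U e v = rot (dir N e) *v (stiffness N e *v deriv_away N U e v)"

lemma rot_move: "x = rot (a - b) *v y \<longleftrightarrow> rot b *v x = rot a *v y"
proof -
  have "rot (a - b) *v y = rot (- b) *v (rot a *v y)"
    by (simp add: matrix_vector_mul_assoc rot_mult)
  then show ?thesis
    by (metis rot_cancel)
qed

lemma continuity_at_iff:
  "continuity_at N U v \<longleftrightarrow> (\<forall>e\<in>edges_at N v. \<forall>e'\<in>edges_at N v. gval N U e v = gval N U e' v)"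
  unfolding continuity_at_def angle_def gval_def rot_move by metis

text \<open>In the fixed frame the angles disappear and the condition becomes symmetric in the
  edges; every choice of the distinguished edge says the same.\<close>

lemma force_balance_at_iff:
  assumes "finite (edges_at N v)" "edges_at N v \<noteq> {}"
  shows "force_balance_at N U v \<longleftrightarrow> (\<Sum>e\<in>edges_at N v. gforce N U e v) = 0"
proof -
  have "stiffness N e *v deriv_toward N U e v =
        (\<Sum>e'\<in>edges_at N v - {e}. rot (angle N e e') *v (stiffness N e' *v deriv_away N U e' v)) \<longleftrightarrow>
      (\<Sum>e\<in>edges_at N v. gforce N U e v) = 0" if e: "e \<in> edges_at N v" for e
  proof -
    have "(\<Sum>e'\<in>edges_at N v - {e}. rot (angle N e e') *v (stiffness N e' *v deriv_away N U e' v)) =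
        rot (- dir N e) *v (\<Sum>e'\<in>edges_at N v - {e}. gforce N U e' v)"
      by (simp add: linear_sum[OF matrix_vector_mul_linear] gforce_def angle_def matrix_vector_mul_assoc matrix_mul_assoc rot_mult)
    moreover have "stiffness N e *v deriv_toward N U e v = rot (- dir N e) *v (- gforce N U e v)"
      by (simp add: deriv_toward_def gforce_def vec.neg)
    moreover have "rot (- dir N e) *v x = rot (- dir N e) *v y \<longleftrightarrow> x = y" for x y
      by (metis rot_cancel(1))
    ultimately show ?thesis
      using sum.remove[OF assms(1) e, of "\<lambda>e. gforce N U e v"] by (auto simp: neg_eq_iff_add_eq_0)
  qed
  then show ?thesis
    using assms(2) unfolding force_balance_at_def by blast
qed

lemma spectral_equations_on_cong:
  "U e = W e \<Longrightarrow> spectral_equations_on N lam U e \<longleftrightarrow> spectral_equations_on N lam W e"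
  by (simp add: spectral_equations_on_def)

lemma end_deriv_cong: "U e = W e \<Longrightarrow> end_deriv N U e x = end_deriv N W e x"
  by (simp add: end_deriv_def)

lemma deriv_away_end:
  "deriv_away N U e v = (if tail (graph N) e = v then end_deriv N U e 0 else - end_deriv N U e (len N e))"
  by (simp add: deriv_away_def end_deriv_def)

lemma sol_sum:
  assumes "\<And>i. i \<in> I \<Longrightarrow> sol R B s (p i) (f i)"
  shows "sol R B s (\<lambda>v. \<Sum>i\<in>I. p i v) (\<lambda>v. \<Sum>i\<in>I. f i v)"
proof (cases "finite I")
  case True
  then show ?thesis
    using assms
  proof (induction I)
    case empty
    then show ?case
      using sol_0 by simp
  next
    case (insert i I)
    then have "sol R B s (\<lambda>v. p i v + (\<Sum>i\<in>I. p i v)) (\<lambda>v. f i v + (\<Sum>i\<in>I. f i v))"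
      by (intro sol_add) auto
    then show ?case
      using insert.hyps by simp
  qed
next
  case False
  then show ?thesis
    using sol_0 by simp
qed

locale rooted_boundary_tree = rooted_string_tree +
  assumes r_eq: "r = bvertex N m" and r_boundary: "r \<in> boundary N" and m: "m \<ge> 1"
begin

lemma efun_rot:
  "efun R v g *v (rot (dir N (pe v)) *v x) = rot (dir N (pe v)) *v (diag2 (g (k1 N (pe v))) (g (k2 N (pe v))) *v x)"
  by (simp add: efun_def turned_def flip: matrix_vector_mul_assoc)

text \<open>Depending on which end is the tail, this is the transfer or its inverse. The sign of the
  force comes from measuring derivatives away from each end.\<close>

lemma edge_transfer:
  assumes s: "s \<noteq> 0" and v: "v \<in> edges R" and U: "spectral_equations_on N (- (s\<^sup>2)) U (pe v)"
  shows "gval N U (pe v) (par v) = top_value R s (\<lambda>v. gval N U (pe v) v) (\<lambda>v. gforce N U (pe v) v) v"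
    and "gforce N U (pe v) (par v) = - top_force R s (\<lambda>v. gval N U (pe v) v) (\<lambda>v. gforce N U (pe v) v) v"
proof -
  let ?e = "pe v"
  have p: "len N ?e > 0" "k1 N ?e > 0" "k2 N ?e > 0"
    using pos[OF pe_arc[OF v]] by auto
  note sv = spectral_end_values[OF U s p]
  have t: "tail (graph N) ?e = v \<and> tail (graph N) ?e \<noteq> par v \<or> tail (graph N) ?e \<noteq> v \<and> tail (graph N) ?e = par v"
    using ends[OF v] par_ne[OF v] by (auto simp: doubleton_eq_iff)
  then have "gval N U ?e (par v) = top_value R s (\<lambda>v. gval N U (pe v) v) (\<lambda>v. gforce N U (pe v) v) v \<and>
    gforce N U ?e (par v) = - top_force R s (\<lambda>v. gval N U (pe v) v) (\<lambda>v. gforce N U (pe v) v) v"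
  proof
    assume t: "tail (graph N) ?e = v \<and> tail (graph N) ?e \<noteq> par v"
    then show ?thesis
      using sv(1,2) par_ne[OF v, symmetric]
      by (simp add: gval_def gforce_def value_at_def deriv_away_end top_value_def top_force_def efun_rot
          matrix_vector_right_distrib matrix_vector_mult_diff_distrib vec.neg)
  next
    assume t: "tail (graph N) ?e \<noteq> v \<and> tail (graph N) ?e = par v"
    then show ?thesis
      unfolding gval_def gforce_def value_at_def deriv_away_end top_value_def top_force_def
      using par_ne[OF v]
      by (simp add: efun_rot matrix_vector_right_distrib vec.neg sv(3,4) matrix_vector_mult_diff_distrib)
  qed
  then show "gval N U ?e (par v) = top_value R s (\<lambda>v. gval N U (pe v) v) (\<lambda>v. gforce N U (pe v) v) v"
    "gforce N U ?e (par v) = - top_force R s (\<lambda>v. gval N U (pe v) v) (\<lambda>v. gforce N U (pe v) v) v"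
    by blast+
qed

lemma internal_iff: "v \<in> internal N \<longleftrightarrow> v \<in> edges R - leaves R"
  using boundary_iff r_boundary by (cases "v = r") (auto simp: internal_def edges_R)

lemma gforce_sum:
  assumes "v \<in> edges R" "\<And>w. w \<in> children R v \<Longrightarrow> gforce N U (pe w) v = - top_force R s p f w"
  shows "(\<Sum>e\<in>edges_at N v. gforce N U e v) = gforce N U (pe v) v - (\<Sum>w\<in>children R v. top_force R s p f w)"
proof -
  have "(\<Sum>e\<in>edges_at N v. gforce N U e v) = gforce N U (pe v) v + (\<Sum>e\<in>pe ` children R v. gforce N U e v)"
    using pe_notin_children[OF assms(1)] finite_children[OF net_R] by (simp add: edges_at_inner[OF assms(1)])
  also have "(\<Sum>e\<in>pe ` children R v. gforce N U e v) = (\<Sum>w\<in>children R v. - top_force R s p f w)"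
    using assms(2) by (simp add: sum.reindex[OF pe_inj_children])
  finally show ?thesis
    by (simp add: sum_negf)
qed

lemma finite_edges_at: "v \<in> edges R \<Longrightarrow> finite (edges_at N v) \<and> edges_at N v \<noteq> {}"
  using finite_children[OF net_R] by (simp add: edges_at_inner)

lemma child_par: "w \<in> children R v \<Longrightarrow> w \<in> edges R \<and> par w = v"
  by (simp add: children_def)

lemma spectral_imp_sol:
  assumes s: "s \<noteq> 0" and U: "spectral_solution N (- (s\<^sup>2)) U" and root: "\<And>e. e \<in> edges_at N r \<Longrightarrow> value_at N U e r = 0"
  shows "sol R (leaves R) s (\<lambda>v. gval N U (pe v) v) (\<lambda>v. gforce N U (pe v) v)"
  unfolding sol_def
proof (intro conjI ballI)
  have sp: "spectral_equations_on N (- (s\<^sup>2)) U (pe v)" if "v \<in> edges R" for v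
    using U pe_arc[OF that] by (simp add: spectral_solution_def)
  note et = edge_transfer[OF s _ sp]
  fix v assume v: "v \<in> edges R"
  show "top_value R s (\<lambda>v. gval N U (pe v) v) (\<lambda>v. gforce N U (pe v) v) v =
      (if parent R v = base R then 0 else gval N U (pe (parent R v)) (parent R v))"
  proof (cases "par v = r")
    case True
    then have "pe v \<in> edges_at N r"
      using v edges_at_iff by blast
    then show ?thesis
      using root True et(1)[OF v v] by (simp add: gval_def)
  next
    case False
    then have pv: "par v \<in> edges R" "par v \<notin> leaves R"
      using net_parent[OF net_R v] parent_not_leaf[OF v] by simp_all
    then have "continuity_at N U (par v)"
      using U by (simp add: spectral_solution_def internal_iff)
    moreover have "pe v \<in> edges_at N (par v)" "pe (par v) \<in> edges_at N (par v)"
      using v pv edges_at_iff by blast+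
    ultimately have "gval N U (pe v) (par v) = gval N U (pe (par v)) (par v)"
      unfolding continuity_at_iff by blast
    then show ?thesis
      using False et(1)[OF v v] by simp
  qed
next
  have sp: "spectral_equations_on N (- (s\<^sup>2)) U (pe v)" if "v \<in> edges R" for v
    using U pe_arc[OF that] by (simp add: spectral_solution_def)
  note et = edge_transfer[OF s _ sp]
  fix v assume v: "v \<in> edges R - leaves R"
  then have "force_balance_at N U v"
    using U by (simp add: spectral_solution_def internal_iff)
  then have "(\<Sum>e\<in>edges_at N v. gforce N U e v) = 0"
    using force_balance_at_iff[of N v U] finite_edges_at[of v] v by blast
  moreover have "gforce N U (pe w) v = - top_force R s (\<lambda>v. gval N U (pe v) v) (\<lambda>v. gforce N U (pe v) v) w"
    if "w \<in> children R v" for w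
    using et(2)[of w] child_par[OF that] by simp
  ultimately show "ext_force R s (\<lambda>v. gval N U (pe v) v) (\<lambda>v. gforce N U (pe v) v) v = 0"
    using gforce_sum[of v U s] v by (simp add: ext_force_def)
qed

lemma sol_imp_spectral:
  assumes s: "s \<noteq> 0" and S: "sol R (leaves R) s p f"
  shows "\<exists>U. spectral_solution N (- (s\<^sup>2)) U \<and> (\<forall>v\<in>edges R. gval N U (pe v) v = p v) \<and>
     (\<forall>e\<in>edges_at N r. value_at N U e r = 0)"
proof -
  define vt where "vt e = (THE v. v \<in> edges R \<and> pe v = e)" for e
  have vt: "vt (pe v) = v" if "v \<in> edges R" for v
    unfolding vt_def using that pe_inj by (intro the_equality) auto
  define W where "W e = wave N s e (rot (- dir N e) *v p (vt e)) (rot (- dir N e) *v f (vt e))" for e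
  \<comment> \<open>The wave starts at the child vertex; it is reversed if the arc is parametrised
    from the parent.\<close>
  define U where "U e = (if tail (graph N) e = vt e then W e else (\<lambda>x. W e (len N e - x)))" for e
  have v_end: "spectral_equations_on N (- (s\<^sup>2)) U (pe v) \<and> gval N U (pe v) v = p v \<and> gforce N U (pe v) v = f v"
    if v: "v \<in> edges R" for v
  proof -
    let ?e = "pe v" and ?y = "rot (- dir N (pe v)) *v p v" and ?f = "rot (- dir N (pe v)) *v f v"
    have ps: "len N ?e > 0" "k1 N ?e > 0" "k2 N ?e > 0"
      using pos[OF pe_arc[OF v]] by auto
    note ws = wave_spectral[OF ps s, of ?y ?f]
    show ?thesis
    proof (cases "tail (graph N) ?e = v")
      case True
      have Ue: "U ?e = wave N s ?e ?y ?f"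
        using True by (simp add: U_def W_def vt[OF v])
      have "end_deriv N U ?e 0 = compliance N ?e *v ?f"
        using end_deriv_cong[of U ?e "\<lambda>_. wave N s ?e ?y ?f", OF Ue] ws(2) by metis
      moreover have "spectral_equations_on N (- (s\<^sup>2)) U ?e"
        using spectral_equations_on_cong[of U ?e "\<lambda>_. wave N s ?e ?y ?f", OF Ue] ws(1) by metis
      ultimately show ?thesis
        using Ue True
        by (simp add: gval_def gforce_def value_at_def deriv_away_end wave_0 stiffness_compliance ps)
    next
      case False
      have Ue: "U ?e = (\<lambda>x. wave N s ?e ?y ?f (len N ?e - x))"
        using False by (simp add: U_def W_def vt[OF v])
      have "end_deriv N U ?e (len N ?e) = - (compliance N ?e *v ?f)"
        using end_deriv_cong[of U ?e "\<lambda>_ x. wave N s ?e ?y ?f (len N ?e - x)", OF Ue] ws(4) by metis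
      moreover have "spectral_equations_on N (- (s\<^sup>2)) U ?e"
        using spectral_equations_on_cong[of U ?e "\<lambda>_ x. wave N s ?e ?y ?f (len N ?e - x)", OF Ue] ws(3) by metis
      ultimately show ?thesis
        using Ue False
        by (simp add: gval_def gforce_def value_at_def deriv_away_end wave_0 stiffness_compliance ps)
    qed
  qed
  have et: "gval N U (pe v) (par v) = top_value R s p f v" "gforce N U (pe v) (par v) = - top_force R s p f v"
    if v: "v \<in> edges R" for v
  proof -
    have sp: "spectral_equations_on N (- (s\<^sup>2)) U (pe v)"
      using v_end[OF v] by blast
    have "top_value R s (\<lambda>v. gval N U (pe v) v) (\<lambda>v. gforce N U (pe v) v) v = top_value R s p f v"
      "top_force R s (\<lambda>v. gval N U (pe v) v) (\<lambda>v. gforce N U (pe v) v) v = top_force R s p f v"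
      by (intro top_cong; use v_end[OF v] in simp)+
    then show "gval N U (pe v) (par v) = top_value R s p f v" "gforce N U (pe v) (par v) = - top_force R s p f v"
      using edge_transfer[OF s v sp] by simp_all
  qed
  have "spectral_solution N (- (s\<^sup>2)) U"
    unfolding spectral_solution_def
  proof (intro conjI ballI)
    fix e assume "e \<in> arcs (graph N)"
    then show "spectral_equations_on N (- (s\<^sup>2)) U e"
      using arc_pe v_end by blast
  next
    fix v assume "v \<in> internal N"
    then have v: "v \<in> edges R" "v \<notin> leaves R"
      by (auto simp: internal_iff)
    have "gval N U e v = p v" if "e \<in> edges_at N v" for e
    proof -
      have "e = pe v \<or> (\<exists>w\<in>children R v. e = pe w)"
        using that edges_at_inner[OF v(1)] by auto
      then show ?thesis
        using v_end[OF v(1)] et(1) child_par sol_child[OF S _ v(1)] by metis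
    qed
    then show "continuity_at N U v"
      unfolding continuity_at_iff by simp
    have "gforce N U (pe w) v = - top_force R s p f w" if "w \<in> children R v" for w
      using et(2)[of w] child_par[OF that] by simp
    then have "(\<Sum>e\<in>edges_at N v. gforce N U e v) = f v - (\<Sum>w\<in>children R v. top_force R s p f w)"
      using gforce_sum[OF v(1)] v_end[OF v(1)] by simp
    also have "\<dots> = 0"
      using sol_balance[OF S v] by simp
    finally have "(\<Sum>e\<in>edges_at N v. gforce N U e v) = 0" .
    then show "force_balance_at N U v"
      using finite_edges_at[OF v(1)] by (simp add: force_balance_at_iff)
  qed
  moreover have "value_at N U e r = 0" if e: "e \<in> edges_at N r" for e
  proof -
    obtain w where w: "w \<in> children R r" "e = pe w"
      using e unfolding edges_at_root by blast
    have "gval N U e r = 0"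
      using et(1)[of w] child_par[OF w(1)] w(2) sol_root_child[OF S, of w] w(1) by simp
    then show ?thesis
      using rot_cancel(2)[of "dir N e" "value_at N U e r"] by (simp add: gval_def)
  qed
  moreover have "gval N U (pe v) v = p v" if "v \<in> edges R" for v
    using v_end[OF that] by blast
  ultimately show ?thesis
    by (intro exI[of _ U]) simp
qed

lemma leaf_props:
  assumes "\<gamma> \<in> leaves R"
  shows "\<gamma> \<in> edges R" "\<gamma> \<in> boundary N" "\<gamma> \<noteq> r" "edges_at N \<gamma> = {pe \<gamma>}"
proof -
  show e: "\<gamma> \<in> edges R"
    using assms by (simp add: leaves_def)
  then show "\<gamma> \<in> boundary N" "\<gamma> \<noteq> r" "edges_at N \<gamma> = {pe \<gamma>}"
    using assms boundary_iff by (auto simp: edges_R edges_at_inner leaves_def)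
qed

lemma boundary_cases: "v \<in> boundary N \<Longrightarrow> v = r \<or> v \<in> leaves R"
  using boundary_iff[of v] by (auto simp: edges_R boundary_def)

lemma tw_exists:
  assumes s: "s \<noteq> 0" "Re (s\<^sup>2) \<ge> 0" and \<gamma>: "\<gamma> \<in> leaves R"
  shows "\<exists>U. tw_solution N (- (s\<^sup>2)) \<gamma> b U"
proof -
  obtain p f where S: "sol R (leaves R) s p f" "\<And>v. v \<in> leaves R \<Longrightarrow> p v = (if v = \<gamma> then rot (dir N (pe \<gamma>)) *v b else 0)"
    using dirichlet_exists[OF net_R s(2) order_refl leaves_edges, of "\<lambda>v. if v = \<gamma> then rot (dir N (pe \<gamma>)) *v b else 0"] by blast
  obtain U where U: "spectral_solution N (- (s\<^sup>2)) U" "\<And>v. v \<in> edges R \<Longrightarrow> gval N U (pe v) v = p v"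
     "\<And>e. e \<in> edges_at N r \<Longrightarrow> value_at N U e r = 0"
    using sol_imp_spectral[OF s(1) S(1)] by blast
  have "value_at N U e v = (if v = \<gamma> then b else 0)" if v: "v \<in> boundary N" "e \<in> edges_at N v" for v e
  proof (cases "v = r")
    case True
    then show ?thesis
      using U(3) v(2) leaf_props(3)[OF \<gamma>] by auto
  next
    case False
    then have vl: "v \<in> leaves R"
      using boundary_cases[OF v(1)] by blast
    then have e: "e = pe v"
      using leaf_props(4) v(2) by blast
    have "rot (dir N (pe v)) *v value_at N U (pe v) v = p v"
      using U(2)[OF leaf_props(1)[OF vl]] by (simp add: gval_def)
    then have "value_at N U (pe v) v = rot (- dir N (pe v)) *v p v"
      by (metis rot_cancel(2))
    then show ?thesis
      using S(2)[OF vl] e by auto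
  qed
  then show ?thesis
    using U(1) unfolding tw_solution_def by blast
qed

lemma tw_sol:
  assumes s: "s \<noteq> 0" and \<gamma>: "\<gamma> \<in> leaves R" and U: "tw_solution N (- (s\<^sup>2)) \<gamma> b U"
  shows "sol R (leaves R) s (\<lambda>v. gval N U (pe v) v) (\<lambda>v. gforce N U (pe v) v)"
    and "\<And>v. v \<in> leaves R \<Longrightarrow> gval N U (pe v) v = (if v = \<gamma> then rot (dir N (pe \<gamma>)) *v b else 0)"
proof -
  show "sol R (leaves R) s (\<lambda>v. gval N U (pe v) v) (\<lambda>v. gforce N U (pe v) v)"
    using U r_boundary leaf_props(3)[OF \<gamma>] by (intro spectral_imp_sol s) (auto simp: tw_solution_def)
  fix v assume "v \<in> leaves R"
  then have "value_at N U (pe v) v = (if v = \<gamma> then b else 0)"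
    using U leaf_props[of v] by (simp add: tw_solution_def)
  then show "gval N U (pe v) v = (if v = \<gamma> then rot (dir N (pe \<gamma>)) *v b else 0)"
    by (simp add: gval_def)
qed

lemma bij_bvertex: "bij_betw (bvertex N) {1..m - 1} (leaves R)"
proof -
  have b: "bij_betw (bvertex N) {1..m} (boundary N)"
    using N by (simp add: elastic_tree_def)
  have "bvertex N ` {1..m - 1} = bvertex N ` ({1..m} - {m})"
    by (rule arg_cong[where f = "image (bvertex N)"]) auto
  also have "\<dots> = boundary N - {r}"
    using b m by (subst inj_on_image_set_diff[of _ "{1..m}"]) (auto simp: bij_betw_def r_eq)
  also have "\<dots> = leaves R"
    using boundary_cases leaf_props by blast
  finally show ?thesis
    using b inj_on_subset[of "bvertex N" "{1..m}" "{1..m - 1}"] by (auto simp: bij_betw_def)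
qed

lemma bvertex_leaf: "i \<in> {1..m - 1} \<Longrightarrow> bvertex N i \<in> leaves R"
  using bij_bvertex by (auto simp: bij_betw_def)

lemma bedge_pe: "i \<in> {1..m - 1} \<Longrightarrow> bedge N i = pe (bvertex N i)"
  using leaf_props(4)[OF bvertex_leaf] by (simp add: bedge_def)

text \<open>The boundary displacements, in the frames of their edges, are expanded in unit vectors.
  The same combination of the solutions behind \<open>tw_matrix\<close> has these boundary values,
  so by uniqueness it has the same forces. The root has zero displacement, so the indices up to
  \<open>m - 1\<close> suffice.\<close>

lemma response:
  assumes s: "s \<noteq> 0" "Re (s\<^sup>2) \<ge> 0" and S: "sol R (leaves R) s p f" and j: "j \<in> {1..m - 1}"
  shows "f (bvertex N j) = rot (dir N (bedge N j)) *v (stiffness N (bedge N j) *v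
    (\<Sum>i\<in>{1..m - 1}. \<Sum>k\<in>UNIV. (rot (- dir N (bedge N i)) *v p (bvertex N i)) $ k *s (tw_matrix N (- (s\<^sup>2)) i j $ k)))"
proof -
  define \<gamma> where "\<gamma> = bvertex N"
  define U where "U i k = (SOME U. tw_solution N (- (s\<^sup>2)) (\<gamma> i) (axis k 1) U)" for i :: nat and k :: 2
  define a where "a i k = (rot (- dir N (bedge N i)) *v p (\<gamma> i)) $ k" for i and k :: 2
  define P where "P i k v = gval N (U i k) (pe v) v" for i k v
  define F where "F i k v = gforce N (U i k) (pe v) v" for i k v
  have U: "tw_solution N (- (s\<^sup>2)) (\<gamma> i) (axis k 1) (U i k)" if "i \<in> {1..m - 1}" for i k
    unfolding U_def using someI_ex[OF tw_exists[OF s bvertex_leaf[OF that]]] by (simp add: \<gamma>_def)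
  have gl: "\<gamma> i \<in> leaves R" if "i \<in> {1..m - 1}" for i
    using bvertex_leaf[OF that] by (simp add: \<gamma>_def)
  have PF: "sol R (leaves R) s (P i k) (F i k)"
    "v \<in> leaves R \<Longrightarrow> P i k v = (if v = \<gamma> i then rot (dir N (pe (\<gamma> i))) *v axis k 1 else 0)"
    if "i \<in> {1..m - 1}" for i k v
    unfolding P_def F_def using tw_sol[OF s(1) gl[OF that] U[OF that]] by blast+
  define q where "q v = (\<Sum>i\<in>{1..m - 1}. \<Sum>k\<in>UNIV. a i k *s P i k v)" for v
  define g where "g v = (\<Sum>i\<in>{1..m - 1}. \<Sum>k\<in>UNIV. a i k *s F i k v)" for v
  have S2: "sol R (leaves R) s q g"
    unfolding q_def g_def by (intro sol_sum sol_scale PF)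
  have q: "p v = q v" if v: "v \<in> leaves R" for v
  proof -
    obtain n where n: "n \<in> {1..m - 1}" "v = \<gamma> n"
      using v bij_bvertex unfolding bij_betw_def \<gamma>_def by blast
    have inj: "\<gamma> n = \<gamma> i \<longleftrightarrow> i = n" if "i \<in> {1..m - 1}" for i
      using that n(1) bij_bvertex by (auto simp: bij_betw_def \<gamma>_def dest: inj_onD)
    have "q v = (\<Sum>i\<in>{1..m - 1}. if i = n then (\<Sum>k\<in>UNIV. a n k *s (rot (dir N (pe (\<gamma> n))) *v axis k 1)) else 0)"
      unfolding q_def
    proof (rule sum.cong[OF refl])
      fix i assume i: "i \<in> {1..m - 1}"
      show "(\<Sum>k\<in>UNIV. a i k *s P i k v) =
        (if i = n then (\<Sum>k\<in>UNIV. a n k *s (rot (dir N (pe (\<gamma> n))) *v axis k 1)) else 0)"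
        using PF(2)[OF i v] inj[OF i] n(2) by (auto intro: sum.neutral)
    qed
    also have "\<dots> = (\<Sum>k\<in>UNIV. a n k *s (rot (dir N (pe (\<gamma> n))) *v axis k 1))"
      using n(1) by simp
    also have "\<dots> = rot (dir N (pe (\<gamma> n))) *v (\<Sum>k\<in>UNIV. a n k *s axis k 1)"
      by (simp add: linear_sum[OF matrix_vector_mul_linear] vector_scalar_commute)
    also have "(\<Sum>k\<in>UNIV. a n k *s axis k 1) = rot (- dir N (bedge N n)) *v p v"
      by (simp add: vec_eq_iff forall_2 sum_2 axis_def a_def n(2))
    also have "rot (dir N (pe (\<gamma> n))) *v \<dots> = p v"
      using bedge_pe[OF n(1)] by (simp add: \<gamma>_def)
    finally show ?thesis ..
  qed
  have e: "bedge N j = pe (\<gamma> j)"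
    using bedge_pe[OF j] by (simp add: \<gamma>_def)
  have D: "tw_matrix N (- (s\<^sup>2)) i j $ k = deriv_away N (U i k) (bedge N j) (\<gamma> j)" for i k
    by (simp add: tw_matrix_def U_def \<gamma>_def vec_eq_iff)
  have "f (\<gamma> j) = g (\<gamma> j)"
    by (rule sol_unique(2)[OF net_R order_refl leaves_edges s(2) S S2 q leaf_props(1)[OF gl[OF j]]])
  also have "\<dots> = (\<Sum>i\<in>{1..m - 1}. \<Sum>k\<in>UNIV. a i k *s (rot (dir N (bedge N j)) *v (stiffness N (bedge N j) *v tw_matrix N (- (s\<^sup>2)) i j $ k)))"
    by (simp add: g_def F_def gforce_def D e)
  also have "\<dots> = rot (dir N (bedge N j)) *v (stiffness N (bedge N j) *v
      (\<Sum>i\<in>{1..m - 1}. \<Sum>k\<in>UNIV. a i k *s (tw_matrix N (- (s\<^sup>2)) i j $ k)))"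
    by (simp add: linear_sum[OF matrix_vector_mul_linear] vector_scalar_commute)
  finally show ?thesis
    by (simp add: a_def \<gamma>_def)
qed

lemma no_fictitious_R:
  assumes "\<And>v. \<not> fictitious_vertex N v"
  shows "no_fictitious R"
  unfolding no_fictitious_def
proof (intro ballI allI impI notI)
  fix v w assume v: "v \<in> edges R" and w: "children R v = {w}" and eq: "efun R w of_real = efun R v of_real"
  have we: "w \<in> edges R" "par w = v" "pe w \<noteq> pe v"
    using w child_par[of w v] par_ne[of w] pe_inj[of w v] v by auto
  define x y where xy: "x = dir N (pe v)" "y = dir N (pe w)"
  have "turned y (of_real (k1 N (pe w))) (of_real (k2 N (pe w))) = turned x (of_real (k1 N (pe v))) (of_real (k2 N (pe v)))"
    using eq by (simp add: efun_def xy)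
  from turned_functional_calculus[OF this, of "\<lambda>k. of_real (k\<^sup>2)"]
  have "rot y ** stiffness N (pe w) ** rot (- y) = rot x ** stiffness N (pe v) ** rot (- x)"
    by (simp add: turned_def stiffness_diag2)
  then have "rot (- y) ** (rot y ** stiffness N (pe w) ** rot (- y)) ** rot y =
      rot (- y) ** (rot x ** stiffness N (pe v) ** rot (- x)) ** rot y"
    by simp
  then have "(rot (- y) ** rot y) ** stiffness N (pe w) ** (rot (- y) ** rot y) =
      (rot (- y) ** rot x) ** stiffness N (pe v) ** (rot (- x) ** rot y)"
    by (simp only: matrix_mul_assoc)
  then have "stiffness N (pe w) = rot (- (y - x)) ** stiffness N (pe v) ** rot (y - x)"
    by (simp add: rot_mult rot_0 add.commute)
  then have "frame_change (angle N (pe v) (pe w)) (k1 N (pe v)) (k2 N (pe v)) (k1 N (pe w)) (k2 N (pe w))"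
    using frame_change_iff[of N "pe v" N "pe w"] pos[OF pe_arc[OF v]] pos[OF pe_arc[OF we(1)]]
    by (simp add: angle_def xy)
  moreover have "edges_at N v = {pe v, pe w}"
    using edges_at_inner[OF v] w by simp
  ultimately have "\<exists>e e'. e \<noteq> e' \<and> edges_at N v = {e, e'} \<and>
      frame_change (angle N e e') (k1 N e) (k2 N e) (k1 N e') (k2 N e')"
    using we(3) by (intro exI[of _ "pe v"] exI[of _ "pe w"]) simp
  then have "fictitious_vertex N v"
    using v by (simp add: fictitious_vertex_def edges_R)
  then show False
    using assms by blast
qed

end

section \<open>Recovery of the tree\<close>

lemma rot_eqE:
  assumes "rot a = rot b"
  shows "rot (- a) = rot (- b)"
proof -
  have "rot (- a) = rot (- a) ** (rot b ** rot (- b))"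
    by simp
  also have "\<dots> = (rot (- a) ** rot a) ** rot (- b)"
    by (simp only: matrix_mul_assoc assms)
  finally show ?thesis
    by simp
qed

lemma (in rooted_string_tree) stiffness_efun:
  "efun R v (\<lambda>k. of_real (k\<^sup>2)) = rot (dir N (pe v)) ** stiffness N (pe v) ** rot (- dir N (pe v))"
  by (simp add: efun_def turned_def stiffness_diag2)

theorem theorem3:
  fixes N :: "('v, 'e) string_network" and N' :: "('w, 'f) string_network" and m :: nat
  assumes "elastic_tree m N" and "elastic_tree m N'"
    and "\<And>v. \<not> fictitious_vertex N v" and "\<And>v. \<not> fictitious_vertex N' v"
    and "\<And>lam i j. lam \<notin> \<real> \<Longrightarrow> i \<in> {1..m-1} \<Longrightarrow> j \<in> {1..m-1} \<Longrightarrow>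
           tw_matrix N lam i j = tw_matrix N' lam i j"
  shows "same_network m N N'"
proof -
  obtain par pe h where A: "rooted_string_tree N m (bvertex N m) par pe h" "bvertex N m \<in> boundary N" "m \<ge> 1"
    using rooted_string_tree_exists[OF assms(1)] by blast
  interpret A: rooted_boundary_tree N m "bvertex N m" par pe h
    using A by (simp add: rooted_boundary_tree_def rooted_boundary_tree_axioms_def)
  obtain par' pe' h' where B: "rooted_string_tree N' m (bvertex N' m) par' pe' h'" "bvertex N' m \<in> boundary N'" "m \<ge> 1"
    using rooted_string_tree_exists[OF assms(2)] by blast
  interpret B: rooted_boundary_tree N' m "bvertex N' m" par' pe' h'
    using B by (simp add: rooted_boundary_tree_def rooted_boundary_tree_axioms_def)
  let ?I = "{1..m - 1}"
  define \<phi> where "\<phi> v = bvertex N' (inv_into ?I (bvertex N) v)" for v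
  have \<phi>i: "\<phi> (bvertex N i) = bvertex N' i" if "i \<in> ?I" for i
    using A.bij_bvertex that by (simp add: \<phi>_def bij_betw_def del: One_nat_def)
  have \<phi>: "bij_betw \<phi> (leaves A.R) (leaves B.R)"
  proof -
    have "\<phi> = bvertex N' \<circ> inv_into ?I (bvertex N)"
      by (simp add: fun_eq_iff \<phi>_def)
    then show ?thesis
      using bij_betw_trans[OF bij_betw_inv_into[OF A.bij_bvertex] B.bij_bvertex] by simp
  qed
  have leafE: "\<exists>i\<in>?I. v = bvertex N i" if "v \<in> leaves A.R" for v
    using A.bij_bvertex that by (auto simp: bij_betw_def simp del: One_nat_def)
  \<comment> \<open>Equal components in the observed frames are related in the plane by the
    difference of the frame directions.\<close>
  define q where "q v = dir N' (pe' (\<phi> v)) - dir N (pe v)" for v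
  \<comment> \<open>From force to derivative in the first network, over to the second, and back to
    force there.\<close>
  define H where "H v = efun B.R (\<phi> v) (\<lambda>k. of_real (k\<^sup>2)) ** rot (q v) ** efun A.R v (\<lambda>k. 1 / of_real (k\<^sup>2))" for v

  \<comment> \<open>The data are derivatives; the forces differ from them by the stiffness, which is not known yet.\<close>
  have data0: "same_data A.R (leaves A.R) B.R (leaves B.R) \<phi> (\<lambda>j. rot (q j)) H s"
    if s: "Re (s\<^sup>2) \<ge> 0" "Im (s\<^sup>2) \<noteq> 0" for s
    unfolding same_data_def
  proof (intro allI impI)
    fix p f assume S: "sol A.R (leaves A.R) s p f"
    have s0: "s \<noteq> 0"
      using s(2) by auto
    have lam: "- (s\<^sup>2) \<notin> \<real>"
      using s(2) by (auto simp: complex_is_Real_iff)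
    obtain p' f' where S': "sol B.R (leaves B.R) s p' f'"
      "\<And>w. w \<in> leaves B.R \<Longrightarrow> p' w = rot (q (inv_into (leaves A.R) \<phi> w)) *v p (inv_into (leaves A.R) \<phi> w)"
      using dirichlet_exists[OF B.net_R s(1) order_refl leaves_edges,
          of "\<lambda>w. rot (q (inv_into (leaves A.R) \<phi> w)) *v p (inv_into (leaves A.R) \<phi> w)"] by blast
    have p': "p' (\<phi> j) = rot (q j) *v p j" if "j \<in> leaves A.R" for j
      using S'(2)[of "\<phi> j"] \<phi> that by (auto simp: bij_betw_def)
    have loc: "rot (- dir N' (bedge N' i)) *v p' (bvertex N' i) = rot (- dir N (bedge N i)) *v p (bvertex N i)"
      if i: "i \<in> ?I" for i
      using p'[OF A.bvertex_leaf[OF i]] \<phi>i[OF i] A.bedge_pe[OF i] B.bedge_pe[OF i]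
      by (simp add: q_def matrix_vector_mul_assoc rot_mult)
    have force: "f' (bvertex N' j) = H (bvertex N j) *v f (bvertex N j)" if j: "j \<in> ?I" for j
    proof -
      define x where "x = (\<Sum>i\<in>?I. \<Sum>k\<in>UNIV. (rot (- dir N (bedge N i)) *v p (bvertex N i)) $ k *s (tw_matrix N (- (s\<^sup>2)) i j $ k))"
      have x': "(\<Sum>i\<in>?I. \<Sum>k\<in>UNIV. (rot (- dir N' (bedge N' i)) *v p' (bvertex N' i)) $ k *s (tw_matrix N' (- (s\<^sup>2)) i j $ k)) = x"
        unfolding x_def by (intro sum.cong refl) (simp add: loc assms(5)[OF lam _ j] del: One_nat_def)
      define v where "v = bvertex N j"
      have v: "pe v = bedge N j" "pe' (\<phi> v) = bedge N' j" "\<phi> v = bvertex N' j" "v \<in> leaves A.R"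
        using A.bedge_pe[OF j] B.bedge_pe[OF j] \<phi>i[OF j] A.bvertex_leaf[OF j] by (simp_all add: v_def)
      have f: "f v = rot (dir N (pe v)) *v (stiffness N (pe v) *v x)"
        unfolding v(1) unfolding x_def v_def by (rule A.response[OF s0 s(1) S j])
      have f': "f' (\<phi> v) = rot (dir N' (pe' (\<phi> v))) *v (stiffness N' (pe' (\<phi> v)) *v x)"
        unfolding v(2) unfolding v(3) x'[symmetric] by (rule B.response[OF s0 s(1) S'(1) j])
      have pos: "k1 N (pe v) > 0" "k2 N (pe v) > 0"
        using A.pos[OF A.pe_arc[OF A.leaf_props(1)[OF v(4)]]] by auto
      have "efun A.R v (\<lambda>k. 1 / of_real (k\<^sup>2)) *v f v = rot (dir N (pe v)) *v x"
        unfolding f A.efun_rot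
        using stiffness_compliance(2)[where e = "pe v" and N = N, OF pos] by (simp add: compliance_def)
      then have "H v *v f v = efun B.R (\<phi> v) (\<lambda>k. of_real (k\<^sup>2)) *v (rot (dir N' (pe' (\<phi> v))) *v x)"
        by (simp add: H_def q_def matrix_vector_mul_assoc[symmetric]) (simp add: matrix_vector_mul_assoc rot_mult matrix_mul_assoc[symmetric])
      also have "\<dots> = f' (\<phi> v)"
        unfolding f' B.efun_rot by (simp add: stiffness_diag2)
      finally show ?thesis
        by (simp add: v_def \<phi>i[OF j])
    qed
    show "\<exists>p' f'. sol B.R (leaves B.R) s p' f' \<and> (\<forall>j\<in>leaves A.R. p' (\<phi> j) = rot (q j) *v p j \<and>
        ext_force B.R s p' f' (\<phi> j) = H j *v ext_force A.R s p f j)"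
    proof (intro exI conjI ballI)
      show "sol B.R (leaves B.R) s p' f'"
        by (rule S')
      fix j assume j: "j \<in> leaves A.R"
      show "p' (\<phi> j) = rot (q j) *v p j"
        by (rule p'[OF j])
      obtain i where i: "i \<in> ?I" "j = bvertex N i"
        using leafE[OF j] by blast
      have "\<phi> j \<in> leaves B.R"
        using \<phi> j by (auto simp: bij_betw_def)
      then show "ext_force B.R s p' f' (\<phi> j) = H j *v ext_force A.R s p f j"
        using force[OF i(1)] i(2) \<phi>i[OF i(1)] j by (simp add: ext_force_def leaves_def)
    qed
  qed
  have data1: "same_data A.R (leaves A.R) B.R (leaves B.R) \<phi> (\<lambda>j. rot (q j)) H (of_real t)" if t: "t \<ge> 0" for t
  proof (rule same_data_limit[OF A.net_R order_refl leaves_edges B.net_R order_refl leaves_edges])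
    \<comment> \<open>With e = 1 / (n + 1) the square has real part t^2 + 4 t e + 3 e^2 \<ge> 0 and
      imaginary part 2 t e + 4 e^2 > 0, also for t = 0.\<close>
    define s where "s n = Complex (t + 2 / real (Suc n)) (1 / real (Suc n))" for n
    show "\<phi> ` leaves A.R = leaves B.R"
      using \<phi> by (simp add: bij_betw_def)
    have 0: "(\<lambda>n. c / real (Suc n)) \<longlonglongrightarrow> 0" for c
      by real_asymp
    have "(\<lambda>n. t + 2 / real (Suc n)) \<longlonglongrightarrow> t + 0"
      by (rule tendsto_add[OF tendsto_const 0])
    then show "s \<longlonglongrightarrow> of_real t"
      unfolding s_def[abs_def] complex_of_real_def using tendsto_Complex[OF _ 0[of 1]] by simp
    fix n
    define e where "e = 1 / real (Suc n)"
    have e: "e > 0"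
      by (simp add: e_def)
    have sn: "s n = Complex (t + 2 * e) e"
      by (simp add: s_def e_def)
    have sq: "Re ((s n)\<^sup>2) = t\<^sup>2 + 4 * (t * e) + 3 * e\<^sup>2" "Im ((s n)\<^sup>2) = 2 * (t * e) + 4 * e\<^sup>2"
      unfolding sn by (simp_all add: power2_eq_square algebra_simps)
    have pos: "t * e \<ge> 0" "e\<^sup>2 > 0"
      using e t by simp_all
    show re: "Re ((s n)\<^sup>2) \<ge> 0"
      unfolding sq using pos by simp
    have "Im ((s n)\<^sup>2) \<noteq> 0"
      unfolding sq using pos by linarith
    then show "same_data A.R (leaves A.R) B.R (leaves B.R) \<phi> (\<lambda>j. rot (q j)) H (s n)"
      by (rule data0[OF re])
  qed

  \<comment> \<open>With impedances Z, Z' and Q = rot (q j), \<open>H\<close> is Z'^2 Q Z^-2, while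
    the asymptotics give H Z = Z' Q. Applied to Z x this reads Z'^2 Q = Z' Q Z; cancelling Z' yields
    Z' Q = Q Z and hence H = Q.\<close>
  have H: "H j = rot (q j)" if j: "j \<in> leaves A.R" for j
  proof -
    have \<phi>j: "\<phi> j \<in> leaves B.R"
      using \<phi> j by (auto simp: bij_betw_def)
    have pos: "k1 N (pe j) > 0" "k2 N (pe j) > 0"
      using A.pos[OF A.pe_arc[OF A.leaf_props(1)[OF j]]] by auto
    have pos': "k1 N' (pe' (\<phi> j)) > 0" "k2 N' (pe' (\<phi> j)) > 0"
      using B.pos[OF B.pe_arc[OF B.leaf_props(1)[OF \<phi>j]]] by auto
    have inv: "efun A.R j (\<lambda>k. 1 / of_real (k\<^sup>2)) *v (efun A.R j of_real *v (efun A.R j of_real *v x)) = x" for x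
    proof -
      have "efun A.R j (\<lambda>k. 1 / of_real (k\<^sup>2) * (of_real k * of_real k)) = efun A.R j (\<lambda>_. 1)"
        using pos by (intro efun_cong) (simp_all add: power2_eq_square)
      then show ?thesis
        by (simp add: efun_mult_vec)
    qed
    have inv': "efun B.R (\<phi> j) (\<lambda>k. 1 / of_real k) *v (efun B.R (\<phi> j) (\<lambda>k. of_real (k\<^sup>2)) *v x) = efun B.R (\<phi> j) of_real *v x"
      "efun B.R (\<phi> j) (\<lambda>k. 1 / of_real k) *v (efun B.R (\<phi> j) of_real *v x) = x" for x
    proof -
      have "efun B.R (\<phi> j) (\<lambda>k. 1 / of_real k * of_real (k\<^sup>2)) = efun B.R (\<phi> j) of_real"
        "efun B.R (\<phi> j) (\<lambda>k. 1 / of_real k * of_real k) = efun B.R (\<phi> j) (\<lambda>_. 1)"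
        using pos' by (intro efun_cong; simp add: power2_eq_square)+
      then show "efun B.R (\<phi> j) (\<lambda>k. 1 / of_real k) *v (efun B.R (\<phi> j) (\<lambda>k. of_real (k\<^sup>2)) *v x) = efun B.R (\<phi> j) of_real *v x"
        "efun B.R (\<phi> j) (\<lambda>k. 1 / of_real k) *v (efun B.R (\<phi> j) of_real *v x) = x"
        by (simp_all add: efun_mult_vec)
    qed
    have "rot (q j) *v (efun A.R j of_real *v x) = efun B.R (\<phi> j) of_real *v (rot (q j) *v x)" for x
    proof -
      have "H j *v (efun A.R j of_real *v (efun A.R j of_real *v x)) =
          efun B.R (\<phi> j) of_real *v (rot (q j) *v (efun A.R j of_real *v x))"
        by (rule same_data_conj[OF A.net_R order_refl leaves_edges B.net_R order_refl leaves_edges \<phi> data1 j \<phi>j])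
      moreover have "H j *v (efun A.R j of_real *v (efun A.R j of_real *v x)) =
          efun B.R (\<phi> j) (\<lambda>k. of_real (k\<^sup>2)) *v (rot (q j) *v x)"
        unfolding H_def matrix_vector_mul_assoc[symmetric] inv ..
      ultimately have "efun B.R (\<phi> j) (\<lambda>k. of_real (k\<^sup>2)) *v (rot (q j) *v x) =
          efun B.R (\<phi> j) of_real *v (rot (q j) *v (efun A.R j of_real *v x))"
        by simp
      from arg_cong[OF this, of "\<lambda>y. efun B.R (\<phi> j) (\<lambda>k. 1 / of_real k) *v y"]
      show ?thesis
        unfolding inv' ..
    qed
    note conj = efun_conj[OF this]
    show ?thesis
      unfolding matrix_eq
    proof
      fix x
      have "H j *v x = efun B.R (\<phi> j) (\<lambda>k. of_real (k\<^sup>2)) *v (rot (q j) *v (efun A.R j (\<lambda>k. 1 / of_real (k\<^sup>2)) *v x))"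
        unfolding H_def matrix_vector_mul_assoc[symmetric] ..
      also have "\<dots> = efun B.R (\<phi> j) (\<lambda>k. of_real (k\<^sup>2) * (1 / of_real (k\<^sup>2))) *v (rot (q j) *v x)"
        unfolding conj efun_mult_vec ..
      also have "efun B.R (\<phi> j) (\<lambda>k. of_real (k\<^sup>2) * (1 / of_real (k\<^sup>2))) = efun B.R (\<phi> j) (\<lambda>_. 1)"
        using pos' by (intro efun_cong) simp_all
      finally show "H j *v x = rot (q j) *v x"
        by simp
    qed
  qed

  have "paired_nets A.R B.R \<phi> q"
  proof
    fix t :: real assume t: "t \<ge> 0"
    show "rot_data A.R (leaves A.R) B.R (leaves B.R) \<phi> q (of_real t)"
      using data1[OF t] H unfolding same_data_def by simp
  qed (use A.net_R B.net_R A.single_root_R B.single_root_R A.r_boundary B.r_boundary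
      A.no_fictitious_R B.no_fictitious_R assms(3,4) \<phi> in auto)
  moreover have "edges A.R \<noteq> {}"
    using assms(1) A.arc_pe by (auto simp: elastic_tree_def)
  ultimately obtain F c where F: "isomorphic_nets A.R B.R \<phi> q F c"
    using isomorphism_exists by blast
  have Fb: "bij_betw F (edges A.R) (edges B.R)"
    using F by (simp add: isomorphic_nets_def)
  have Fe: "F v \<in> edges B.R" if "v \<in> edges A.R" for v
    using Fb that by (auto simp: bij_betw_def)
  have Fl: "F v = \<phi> v" "rot (q v) = rot c" if "v \<in> leaves A.R" for v
    using F that by (simp_all add: isomorphic_nets_def)
  have Fp: "par' (F v) = (if par v = bvertex N m then bvertex N' m else F (par v))"
    and Flen: "len N' (pe' (F v)) = len N (pe v)"
    and Fc: "rot c *v (efun A.R v of_real *v a) = efun B.R (F v) of_real *v (rot c *v a)"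
    if "v \<in> edges A.R" for v a
  proof -
    have *: "(if parent A.R v = base A.R then parent B.R (F v) = base B.R else parent B.R (F v) = F (parent A.R v)) \<and>
        elen B.R (F v) = elen A.R v \<and> (\<forall>a. rot c *v (efun A.R v of_real *v a) = efun B.R (F v) of_real *v (rot c *v a))"
      using F that unfolding isomorphic_nets_def by blast
    then show "par' (F v) = (if par v = bvertex N m then bvertex N' m else F (par v))"
      by (simp split: if_splits)
    show "len N' (pe' (F v)) = len N (pe v)"
      using * by simp
    show "rot c *v (efun A.R v of_real *v a) = efun B.R (F v) of_real *v (rot c *v a)"
      using * by blast
  qed

  define ve where "ve e = inv_into (edges A.R) pe e" for e
  have pe_inj: "inj_on pe (edges A.R)"
    using A.pe_inj by (auto simp: inj_on_def)
  have ve: "ve (pe v) = v" if "v \<in> edges A.R" for v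
    using that pe_inj by (simp add: ve_def)
  define f where "f v = (if v = bvertex N m then bvertex N' m else F v)" for v
  define g where "g e = pe' (F (ve e))" for e
  \<comment> \<open>The turn of the local frame that remains after the common rotation by c. On
    observed edges it is a multiple of a full turn, and 0 is chosen there because
    \<open>same_network\<close> demands exactly 0.\<close>
  define \<rho> where "\<rho> e = (if e \<in> bedge N ` ?I then 0 else dir N' (g e) - dir N e - c)" for e
  have g: "g (pe v) = pe' (F v)" if "v \<in> edges A.R" for v
    using ve[OF that] by (simp add: g_def)
  have rot\<rho>: "rot (\<rho> e) = rot (dir N' (g e) - dir N e - c)" if e: "e \<in> arcs (graph N)" for e
  proof (cases "e \<in> bedge N ` ?I")
    case True
    then obtain i where i: "i \<in> ?I" "e = bedge N i"
      by blast
    define v where "v = bvertex N i"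
    have v: "v \<in> leaves A.R" "e = pe v"
      using A.bvertex_leaf[OF i(1)] A.bedge_pe[OF i(1)] i(2) by (simp_all add: v_def)
    have "dir N' (g e) - dir N e = q v"
      using g[OF A.leaf_props(1)[OF v(1)]] Fl(1)[OF v(1)] v(2) by (simp add: q_def)
    then have "rot (dir N' (g e) - dir N e - c) = rot (q v) ** rot (- c)"
      by (simp add: rot_mult)
    also have "\<dots> = rot 0"
      unfolding Fl(2)[OF v(1)] by (simp add: rot_0)
    finally show ?thesis
      using True by (simp add: \<rho>_def)
  qed (simp add: \<rho>_def)
  show ?thesis
    unfolding same_network_def
  proof (rule exI[of _ f], rule exI[of _ g], rule exI[of _ \<rho>], intro conjI ballI)
    have "bij_betw f (edges A.R) (edges B.R)"
      using Fb by (rule bij_betw_cong[THEN iffD1, rotated]) (auto simp: f_def A.edges_R)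
    then have "bij_betw f (edges A.R \<union> {bvertex N m}) (edges B.R \<union> {f (bvertex N m)})"
      by (rule notIn_Un_bij_betw[rotated 2]) (auto simp: f_def A.edges_R B.edges_R)
    moreover have "edges A.R \<union> {bvertex N m} = verts (graph N)" "edges B.R \<union> {f (bvertex N m)} = verts (graph N')"
      using A.r B.r by (auto simp: f_def A.edges_R B.edges_R)
    ultimately show "bij_betw f (verts (graph N)) (verts (graph N'))"
      by simp
  next
    have "bij_betw (pe' \<circ> (F \<circ> inv_into (edges A.R) pe)) (arcs (graph N)) (arcs (graph N'))"
      using bij_betw_trans[OF bij_betw_trans[OF bij_betw_inv_into[OF A.bij] Fb[unfolded A.edges_R]] B.bij[folded B.edges_R]]
      by (simp add: A.edges_R)
    then show "bij_betw g (arcs (graph N)) (arcs (graph N'))"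
      by (simp add: g_def[abs_def] ve_def[abs_def] o_def)
  next
    fix e assume "e \<in> arcs (graph N)"
    then obtain v where v: "v \<in> edges A.R" "e = pe v"
      using A.arc_pe by blast
    have "{tail (graph N') (g e), head (graph N') (g e)} = {F v, par' (F v)}"
      using B.ends[OF Fe[OF v(1)]] g[OF v(1)] v(2) by simp
    also have "\<dots> = {f v, f (par v)}"
      using Fp[OF v(1)] v(1) by (auto simp: f_def A.edges_R)
    also have "\<dots> = {f (tail (graph N) e), f (head (graph N) e)}"
      using A.ends[OF v(1)] v(2) by (auto simp: doubleton_eq_iff)
    finally show "{tail (graph N') (g e), head (graph N') (g e)} = {f (tail (graph N) e), f (head (graph N) e)}" .
  next
    fix i assume i: "i \<in> {1..m}"
    show "f (bvertex N i) = bvertex N' i"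
    proof (cases "i = m")
      case False
      then have i': "i \<in> ?I"
        using i by auto
      show ?thesis
        using A.leaf_props(3)[OF A.bvertex_leaf[OF i']] Fl(1)[OF A.bvertex_leaf[OF i']] \<phi>i[OF i'] by (simp add: f_def)
    qed (simp add: f_def)
  next
    fix e assume "e \<in> arcs (graph N)"
    then obtain v where "v \<in> edges A.R" "e = pe v"
      using A.arc_pe by blast
    then show "len N' (g e) = len N e"
      using Flen g by simp
  next
    fix e assume e: "e \<in> arcs (graph N)"
    then obtain v where v: "v \<in> edges A.R" "e = pe v"
      using A.arc_pe by blast
    define x y where xy: "x = dir N e" "y = dir N' (g e)"
    have "efun B.R (F v) (\<lambda>k. of_real (k\<^sup>2)) *v (rot c *v a) = rot c *v (efun A.R v (\<lambda>k. of_real (k\<^sup>2)) *v a)" for a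
      using efun_conj[OF Fc[OF v(1)]] by simp
    then have "efun B.R (F v) (\<lambda>k. of_real (k\<^sup>2)) ** rot c = rot c ** efun A.R v (\<lambda>k. of_real (k\<^sup>2))"
      unfolding matrix_eq matrix_vector_mul_assoc by blast
    then have "rot y ** stiffness N' (g e) ** rot (- y) ** rot c = rot c ** (rot x ** stiffness N e ** rot (- x))"
      unfolding A.stiffness_efun B.stiffness_efun by (simp add: xy v(2) g[OF v(1)])
    then have "rot (- y) ** (rot y ** stiffness N' (g e) ** rot (- y) ** rot c) ** rot (y - c) =
        rot (- y) ** (rot c ** (rot x ** stiffness N e ** rot (- x))) ** rot (y - c)"
      by simp
    then have "(rot (- y) ** rot y) ** stiffness N' (g e) ** (rot (- y) ** (rot c ** rot (y - c))) =
        (rot (- y) ** rot c ** rot x) ** stiffness N e ** (rot (- x) ** rot (y - c))"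
      by (simp only: matrix_mul_assoc)
    then have "stiffness N' (g e) = rot (- (y - x - c)) ** stiffness N e ** rot (y - x - c)"
      by (simp add: rot_mult rot_0 algebra_simps)
    then have "stiffness N' (g e) = rot (- \<rho> e) ** stiffness N e ** rot (\<rho> e)"
      using rot\<rho>[OF e] rot_eqE[OF rot\<rho>[OF e]] by (simp add: xy)
    moreover have "g e \<in> arcs (graph N')"
      using B.pe_arc[OF Fe[OF v(1)]] g[OF v(1)] v(2) by simp
    ultimately show "frame_change (\<rho> e) (k1 N e) (k2 N e) (k1 N' (g e)) (k2 N' (g e))"
      using frame_change_iff[of N e N' "g e" "\<rho> e"] A.pos[OF e] B.pos[of "g e"] by blast
  next
    fix v e e' assume ee: "e \<in> edges_at N v" "e' \<in> edges_at N v"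
    then have "e \<in> arcs (graph N)" "e' \<in> arcs (graph N)"
      by (auto simp: edges_at_def)
    then obtain n n' :: int where "dir N' (g e) - dir N e - c = \<rho> e + 2 * pi * of_int n"
        "dir N' (g e') - dir N e' - c = \<rho> e' + 2 * pi * of_int n'"
      using rot_eq_imp[OF rot\<rho>[symmetric]] by meson
    then show "\<exists>n::int. angle N' (g e) (g e') = angle N e e' + \<rho> e' - \<rho> e + 2 * pi * of_int n"
      by (intro exI[of _ "n' - n"]) (simp add: angle_def algebra_simps)
  next
    fix i assume "i \<in> ?I"
    then show "\<rho> (bedge N i) = 0"
      by (simp add: \<rho>_def)
  qed
qed

end
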